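(* Let $N\ge2$, let $M\in{\mathbb Z}\setminus\{0\}$, and let ${\cal A}_{q,p}(\widehat{sl}(N)_{c})$ be the elliptic quantum algebra with trace-like generating function $t(z)={\rm Tr}\left(L^+(q^{c/2}z)\,L^-(z)^{-1}\right)$, as defined in the context. On the two-dimensional surface \[ \Sigma_{N,M}=\{(p,q)\;|\;(-p^{\frac12})^{NM}=q^{-c-N}\} \] of the three-dimensional space of parameters $q,p,c$, the operators generated by $t(z)$ close a quadratic algebra: \[ t(z)\,t(w)={\cal Y}_{N,p,q,M}\Big(\frac wz\Big)\,t(w)\,t(z), \] where \[ {\cal Y}_{N,p,q,M}(x)=\left\{\begin{array}{ll} \displaystyle\prod_{k=1}^{NM}\frac{\Theta_{q^{2N}}^2(x^2p^{-k})\,\Theta_{q^{2N}}(x^2q^2p^k)\,\Theta_{q^{2N}}(x^2q^{-2}p^k)}{\Theta_{q^{2N}}^2(x^2p^k)\,\Theta_{q^{2N}}(x^2q^2p^{-k})\,\Theta_{q^{2N}}(x^2q^{-2}p^{-k})}&\mbox{for }M>0,\\ \\ \displaystyle\prod_{k=1}^{N|M|-1}\frac{\Theta_{q^{2N}}^2(x^2p^{-k})\,\Theta_{q^{2N}}(x^2q^2p^k)\,\Theta_{q^{2N}}(x^2q^{-2}p^k)}{\Theta_{q^{2N}}^2(x^2p^k)\,\Theta_{q^{2N}}(x^2q^2p^{-k})\,\Theta_{q^{2N}}(x^2q^{-2}p^{-k})}&\mbox{for }M<0. \end{array}\right. \]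
   Context: Notation. $N\ge2$ is an integer, ${\mathbb Z}_N={\mathbb Z}/N{\mathbb Z}$, $z=e^{i\pi\xi}$, $q=e^{i\pi\zeta}$, $p=e^{2i\pi\tau}$ (fractional powers of $q,p$ are understood through $\zeta,\tau$, e.g. $p^{1/2}=e^{i\pi\tau}$), $\omega=e^{2i\pi/N}$. Infinite products are $(x;p_1,\dots,p_m)_\infty=\prod_{n_i\ge0}(1-xp_1^{n_1}\cdots p_m^{n_m})$ (convergent for $|p_i|<1$) and $\Theta_a(x)=(x;a)_\infty(ax^{-1};a)_\infty(a;a)_\infty$. Jacobi theta functions with rational characteristics $(\gamma_1,\gamma_2)$ are \[ \vartheta\left[\begin{array}{c}\gamma_1\\ \gamma_2\end{array}\right](\xi,\tau)=\sum_{m\in{\mathbb Z}}\exp\big(i\pi(m+\gamma_1)^2\tau+2i\pi(m+\gamma_1)(\xi+\gamma_2)\big). \] The $R$-matrix. Let $g,h$ be the $N\times N$ matrices $g_{ij}=\omega^i\delta_{ij}$, $h_{ij}=\delta_{i+1,j}$ (indices mod $N$), $g^{1/2}$ a fixed diagonal square root of $g$, and $I_{(\alpha_1,\alpha_2)}=g^{\alpha_2}h^{\alpha_1}$ for $(\alpha_1,\alpha_2)\in{\mathbb Z}_N\times{\mathbb Z}_N$. Set \[ W_{(\alpha_1,\alpha_2)}(\xi,\zeta,\tau)=\frac1N\,\frac{\vartheta\left[\begin{array}{c}\frac12+\alpha_1/N\\ \frac12+\alpha_2/N\end{array}\right](\xi+\zeta/N,\tau)}{\vartheta\left[\begin{array}{c}\frac12+\alpha_1/N\\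 \frac12+\alpha_2/N\end{array}\right](\zeta/N,\tau)}, \] \[ \frac1{\kappa(z^2)}=\frac{(q^{2N}z^{-2};p,q^{2N})_\infty(q^2z^2;p,q^{2N})_\infty(pz^{-2};p,q^{2N})_\infty(pq^{2N-2}z^2;p,q^{2N})_\infty}{(q^{2N}z^2;p,q^{2N})_\infty(q^2z^{-2};p,q^{2N})_\infty(pz^2;p,q^{2N})_\infty(pq^{2N-2}z^{-2};p,q^{2N})_\infty}, \] \[ \widetilde R(z,q,p)=\frac{z^{2/N-2}}{\kappa(z^2)}\,\frac{\vartheta\left[\begin{array}{c}\frac12\\ \frac12\end{array}\right](\zeta,\tau)}{\vartheta\left[\begin{array}{c}\frac12\\ \frac12\end{array}\right](\xi+\zeta,\tau)}\sum_{(\alpha_1,\alpha_2)\in{\mathbb Z}_N\times{\mathbb Z}_N}W_{(\alpha_1,\alpha_2)}(\xi,\zeta,\tau)\,I_{(\alpha_1,\alpha_2)}\otimes I_{(\alpha_1,\alpha_2)}^{-1}, \] \[ R(z,q,p)=(g^{1/2}\otimes g^{1/2})\,\widetilde R(z,q,p)\,(g^{-1/2}\otimes g^{-1/2}), \] \[ \tau_N(z)=z^{\frac2N-2}\,\frac{\Theta_{q^{2N}}(qz^2)}{\Theta_{q^{2N}}(qz^{-2})},\qquad \widehat R_{12}(x)=\tau_N(q^{1/2}x^{-1})\,R_{12}(x). \] Write $\widehat R^{*}_{12}(z)=\widehat R^*_{12}(z,q,p)=\widehat R_{12}(z,q,p^* )$ with $p^*=pq^{-2c}$. The algebra. ${\cal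 A}_{q,p}(\widehat{gl}(N)_c)$ is the algebra of operators $L_{ij}(z)=\sum_{n\in{\mathbb Z}}L_{ij}(n)z^n$, $i,j\in{\mathbb Z}_N$, gathered in the $N\times N$ matrix $L(z)=(L_{ij}(z))$, with relations \[ \widehat R_{12}(z/w)\,L_1(z)\,L_2(w)=L_2(w)\,L_1(z)\,\widehat R^*_{12}(z/w), \] where $L_1(z)=L(z)\otimes{\mathbb I}$, $L_2(z)={\mathbb I}\otimes L(z)$. The $q$-determinant \[ q\mbox{-}\det L(z)=\sum_{\sigma\in{\mathfrak S}_N}\varepsilon(\sigma)\prod_{i=1}^N L_{i,\sigma(i)}(zq^{i-N-1}) \] ($\varepsilon(\sigma)$ the signature of $\sigma$) is central, and ${\cal A}_{q,p}(\widehat{sl}(N)_c)={\cal A}_{q,p}(\widehat{gl}(N)_c)/\langle q\mbox{-}\det L-q^{c/2}\rangle$. Generating matrices. $L^+(z)=L(q^{c/2}z)$ and $L^-(z)=g^{1/2}hg^{1/2}\,L(-p^{1/2}z)\,(g^{1/2}hg^{1/2})^{-1}$. Finally \[ t(z)={\rm Tr}\left(L^+(q^{c/2}z)\,L^-(z)^{-1}\right). \] Exchange relations are understood with structure functions taken as meromorphic functions (analytic continuation).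
   Formalization: The surface equation is also required for its (2/N)-th power, with powers of -p^{1/2} and q taken through τ+1 and ζ: R depends on z^{2/N}, and for N≥3 on other branches the shifted R is only conjugate, not proportional, to R, so the relation fails. *)

theory Defs
  imports
    "HOL-Analysis.Analysis"
    "HOL-Combinatorics.Permutations"
    "Berlekamp_Zassenhaus.Finite_Field"
begin

text \<open>
  The integer \<open>N \<ge> 2\<close> is \<open>CARD('n)\<close> for a type \<open>'n\<close> of class \<^class>\<open>nontriv\<close>
  (more than one element), and \<open>'n mod_ring\<close> is the ring of integers modulo \<open>N\<close>; it
  indexes rows and columns, and \<open>'n mod_ring \<times> 'n mod_ring\<close> indexes the tensor square.

  The R-matrix contains \<open>z powr (2/N)\<close> and is not a single-valued function of \<open>z\<close>.
  Hence every function of \<open>z = exp (\<i> * pi * \<xi>)\<close> is written as a function of \<open>\<xi>\<close>,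
  and \<open>q, p\<close> are given through \<open>\<zeta>, \<tau>\<close>.  Multiplying \<open>z\<close> by \<open>q powr a\<close>
  is adding \<open>a * \<zeta>\<close> to \<open>\<xi>\<close>, multiplying it by \<open>- p powr (1/2)\<close> is adding \<open>\<tau> + 1\<close>, and
  \<open>p* = p * q powr (- 2 * c)\<close> corresponds to \<open>\<tau> - c * \<zeta>\<close>.
\<close>

definition q_of :: "complex \<Rightarrow> complex" where
  "q_of \<zeta> = exp (\<i> * pi * \<zeta>)"

definition p_of :: "complex \<Rightarrow> complex" where
  "p_of \<tau> = exp (2 * \<i> * pi * \<tau>)"

definition tau_star :: "complex \<Rightarrow> complex \<Rightarrow> complex \<Rightarrow> complex" where
  "tau_star \<zeta> \<tau> c = \<tau> - c * \<zeta>"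

text \<open>\<open>qpoch x [p\<^sub>1, \<dots>, p\<^sub>m]\<close> is the infinite product over \<open>n\<^sub>1, \<dots>, n\<^sub>m \<ge> 0\<close>,
  taken iteratively; for \<open>\<bar>p\<^sub>i\<bar> < 1\<close> it converges absolutely.\<close>

fun qpoch :: "complex \<Rightarrow> complex list \<Rightarrow> complex" where
  "qpoch x [] = 1 - x"
| "qpoch x (a # as) = prodinf (\<lambda>n. qpoch (x * a ^ n) as)"

definition Theta :: "complex \<Rightarrow> complex \<Rightarrow> complex" where
  "Theta a x = qpoch x [a] * qpoch (a / x) [a] * qpoch a [a]"

definition jtheta :: "real \<Rightarrow> real \<Rightarrow> complex \<Rightarrow> complex \<Rightarrow> complex" where
  "jtheta \<gamma>1 \<gamma>2 \<xi> \<tau> =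
     (\<Sum>\<^sub>\<infinity>m::int. exp (\<i> * pi * (of_int m + \<gamma>1)\<^sup>2 * \<tau>
        + 2 * \<i> * pi * (of_int m + \<gamma>1) * (\<xi> + \<gamma>2)))"

definition mat_power :: "'a::semiring_1^'k^'k \<Rightarrow> nat \<Rightarrow> 'a^'k^'k" where
  "mat_power A m = (((**) A) ^^ m) (mat 1)"

definition tensor_mat :: "'a::semiring_1^'k^'k \<Rightarrow> 'a^'l^'l \<Rightarrow> 'a^('k \<times> 'l)^('k \<times> 'l)" where
  "tensor_mat A B = (\<chi> i j. A $ fst i $ fst j * B $ snd i $ snd j)"

definition omega :: "nat \<Rightarrow> complex" where
  "omega N = exp (2 * \<i> * pi / of_nat N)"

definition gmat :: "complex^('n::nontriv mod_ring)^('n mod_ring)" where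
  "gmat = (\<chi> i j. if i = j then omega CARD('n) powi (to_int_mod_ring i) else 0)"

definition hmat :: "complex^('n::nontriv mod_ring)^('n mod_ring)" where
  "hmat = (\<chi> i j. if j = i + 1 then 1 else 0)"

definition diagonal_sqrt_g :: "complex^('n::nontriv mod_ring)^('n mod_ring) \<Rightarrow> bool" where
  "diagonal_sqrt_g s \<longleftrightarrow> (\<forall>i j. i \<noteq> j \<longrightarrow> s $ i $ j = 0) \<and> s ** s = gmat"

definition Imat ::
  "'n::nontriv mod_ring \<Rightarrow> 'n mod_ring \<Rightarrow> complex^('n mod_ring)^('n mod_ring)" where
  "Imat \<alpha>1 \<alpha>2 = mat_power gmat (nat (to_int_mod_ring \<alpha>2))
                    ** mat_power hmat (nat (to_int_mod_ring \<alpha>1))"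

text \<open>The quotient of theta functions does not depend on the choice of integer representatives
  of \<open>\<alpha>1, \<alpha>2\<close>.  Some of the denominators vanish exactly if \<open>q\<^sup>2\<close> is an integer
  power of \<open>p\<close>; the R-matrix is then undefined.\<close>

definition Wfun :: "'n::nontriv mod_ring \<Rightarrow> 'n mod_ring \<Rightarrow> complex \<Rightarrow> complex \<Rightarrow> complex \<Rightarrow> complex" where
  "Wfun \<alpha>1 \<alpha>2 \<xi> \<zeta> \<tau> =
     (let N = CARD('n);
          \<gamma>1 = 1/2 + of_int (to_int_mod_ring \<alpha>1) / of_nat N;
          \<gamma>2 = 1/2 + of_int (to_int_mod_ring \<alpha>2) / of_nat N
      in 1 / of_nat N * (jtheta \<gamma>1 \<gamma>2 (\<xi> + \<zeta> / of_nat N) \<tau> / jtheta \<gamma>1 \<gamma>2 (\<zeta> / of_nat N) \<tau>))"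

text \<open>\<open>inv_kappa N q p x\<close> is \<open>1 / \<kappa>(x)\<close>, to be taken at \<open>x = z\<^sup>2\<close>.\<close>

definition inv_kappa :: "nat \<Rightarrow> complex \<Rightarrow> complex \<Rightarrow> complex \<Rightarrow> complex" where
  "inv_kappa N q p x =
     (let b = [p, q ^ (2 * N)] in
      (qpoch (q ^ (2 * N) / x) b * qpoch (q\<^sup>2 * x) b * qpoch (p / x) b
         * qpoch (p * q ^ (2 * N - 2) * x) b)
      / (qpoch (q ^ (2 * N) * x) b * qpoch (q\<^sup>2 / x) b * qpoch (p * x) b
         * qpoch (p * q ^ (2 * N - 2) / x) b))"

definition Rtilde ::
  "complex \<Rightarrow> complex \<Rightarrow> complex
   \<Rightarrow> complex^('n::nontriv mod_ring \<times> 'n mod_ring)^('n mod_ring \<times> 'n mod_ring)" where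
  "Rtilde \<xi> \<zeta> \<tau> =
     (let N = CARD('n);
          pref = exp (\<i> * pi * \<xi> * (2 / of_nat N - 2))
                 * inv_kappa N (q_of \<zeta>) (p_of \<tau>) (exp (2 * \<i> * pi * \<xi>))
                 * (jtheta (1/2) (1/2) \<zeta> \<tau> / jtheta (1/2) (1/2) (\<xi> + \<zeta>) \<tau>)
      in map_matrix ((*) pref)
           (\<Sum>\<alpha>1\<in>UNIV. \<Sum>\<alpha>2\<in>UNIV. map_matrix ((*) (Wfun \<alpha>1 \<alpha>2 \<xi> \<zeta> \<tau>))
              (tensor_mat (Imat \<alpha>1 \<alpha>2) (matrix_inv (Imat \<alpha>1 \<alpha>2)))))"

text \<open>Throughout, \<open>s\<close> is the fixed diagonal square root of \<open>g\<close>.\<close>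

definition Rmat ::
  "complex^('n::nontriv mod_ring)^('n mod_ring) \<Rightarrow> complex \<Rightarrow> complex \<Rightarrow> complex
   \<Rightarrow> complex^('n mod_ring \<times> 'n mod_ring)^('n mod_ring \<times> 'n mod_ring)" where
  "Rmat s \<xi> \<zeta> \<tau> = tensor_mat s s ** Rtilde \<xi> \<zeta> \<tau> ** tensor_mat (matrix_inv s) (matrix_inv s)"

definition tauN :: "nat \<Rightarrow> complex \<Rightarrow> complex \<Rightarrow> complex" where
  "tauN N \<zeta> \<xi> =
     (let q = q_of \<zeta>; zz = exp (2 * \<i> * pi * \<xi>) in
      exp (\<i> * pi * \<xi> * (2 / of_nat N - 2)) * (Theta (q ^ (2 * N)) (q * zz) / Theta (q ^ (2 * N)) (q / zz)))"

definition Rhat ::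
  "complex^('n::nontriv mod_ring)^('n mod_ring) \<Rightarrow> complex \<Rightarrow> complex \<Rightarrow> complex
   \<Rightarrow> complex^('n mod_ring \<times> 'n mod_ring)^('n mod_ring \<times> 'n mod_ring)" where
  "Rhat s \<xi> \<zeta> \<tau> = map_matrix ((*) (tauN CARD('n) \<zeta> (\<zeta> / 2 - \<xi>))) (Rmat s \<xi> \<zeta> \<tau>)"

text \<open>A unital complex algebra is a ring together with a unital ring homomorphism \<open>\<iota>\<close>
  from the complex numbers into its centre.\<close>

definition complex_algebra :: "(complex \<Rightarrow> 'a::ring_1) \<Rightarrow> bool" where
  "complex_algebra \<iota> \<longleftrightarrow> \<iota> 1 = 1 \<and> (\<forall>x y. \<iota> (x + y) = \<iota> x + \<iota> y)
     \<and> (\<forall>x y. \<iota> (x * y) = \<iota> x * \<iota> y) \<and> (\<forall>x a. \<iota> x * a = a * \<iota> x)"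

text \<open>The defining relations of \<open>A\<^sub>q\<^sub>,\<^sub>p(gl(N)\<^sub>c)\<close> for a family \<open>L(\<xi>)\<close> of matrices
  over a complex algebra.  As an identity with meromorphic structure functions, the exchange relation
  holds for all \<open>\<xi>, \<eta>\<close> whose difference avoids a closed discrete set.\<close>

definition exchange_relation ::
  "(complex \<Rightarrow> 'a::ring_1) \<Rightarrow> complex^('n::nontriv mod_ring)^('n mod_ring)
   \<Rightarrow> complex \<Rightarrow> complex \<Rightarrow> complex \<Rightarrow> (complex \<Rightarrow> 'a^('n mod_ring)^('n mod_ring)) \<Rightarrow> bool" where
  "exchange_relation \<iota> s \<zeta> \<tau> c L \<longleftrightarrow>
     (\<forall>\<^sub>\<approx>u. \<forall>\<xi> \<eta>. \<xi> - \<eta> = u \<longrightarrow>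
        map_matrix \<iota> (Rhat s u \<zeta> \<tau>) ** tensor_mat (L \<xi>) (mat 1) ** tensor_mat (mat 1) (L \<eta>)
        = tensor_mat (mat 1) (L \<eta>) ** tensor_mat (L \<xi>) (mat 1)
            ** map_matrix \<iota> (Rhat s u \<zeta> (tau_star \<zeta> \<tau> c)))"

text \<open>The entries of \<open>L\<close> do not commute, so the product over \<open>i\<close> needs an order: the
  factor \<open>i = 1\<close> stands on the right.  It is this order that is compatible with centrality of the
  quantum determinant: already for \<open>c = 0\<close> and the representation
  \<open>L(z) = Rhat\<^sub>1\<^sub>3(z)\<close> the opposite order does not give a scalar.\<close>

definition qdet ::
  "complex \<Rightarrow> (complex \<Rightarrow> 'a::ring_1^('n::nontriv mod_ring)^('n mod_ring)) \<Rightarrow> complex \<Rightarrow> 'a" where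
  "qdet \<zeta> L \<xi> =
     (\<Sum>\<sigma> | \<sigma> permutes (UNIV :: 'n mod_ring set). of_int (sign \<sigma>) *
        prod_list (map (\<lambda>i. L (\<xi> + (of_nat i - of_nat CARD('n) - 1) * \<zeta>) $ of_nat i $ \<sigma> (of_nat i))
                       (rev [1..<CARD('n) + 1])))"

definition elliptic_sl_algebra ::
  "(complex \<Rightarrow> 'a::ring_1) \<Rightarrow> complex^('n::nontriv mod_ring)^('n mod_ring)
   \<Rightarrow> complex \<Rightarrow> complex \<Rightarrow> complex \<Rightarrow> (complex \<Rightarrow> 'a^('n mod_ring)^('n mod_ring)) \<Rightarrow> bool" where
  "elliptic_sl_algebra \<iota> s \<zeta> \<tau> c L \<longleftrightarrow>
     complex_algebra \<iota> \<and> exchange_relation \<iota> s \<zeta> \<tau> c L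
     \<and> (\<forall>\<xi>. qdet \<zeta> L \<xi> = \<iota> (exp (\<i> * pi * \<zeta> * (c / 2))))"

definition Lplus :: "complex \<Rightarrow> complex \<Rightarrow> (complex \<Rightarrow> 'a) \<Rightarrow> complex \<Rightarrow> 'a" where
  "Lplus \<zeta> c L \<xi> = L (\<xi> + c / 2 * \<zeta>)"

definition Lminus ::
  "(complex \<Rightarrow> 'a::ring_1) \<Rightarrow> complex^('n::nontriv mod_ring)^('n mod_ring) \<Rightarrow> complex
   \<Rightarrow> (complex \<Rightarrow> 'a^('n mod_ring)^('n mod_ring)) \<Rightarrow> complex \<Rightarrow> 'a^('n mod_ring)^('n mod_ring)" where
  "Lminus \<iota> s \<tau> L \<xi> =
     (let G = s ** hmat ** s
      in map_matrix \<iota> G ** L (\<xi> + (\<tau> + 1)) ** map_matrix \<iota> (matrix_inv G))"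

text \<open>\<^const>\<open>matrix_inv\<close> is the two-sided inverse whenever \<open>Lminus\<close> is invertible.\<close>

definition tgen ::
  "(complex \<Rightarrow> 'a::ring_1) \<Rightarrow> complex^('n::nontriv mod_ring)^('n mod_ring) \<Rightarrow> complex \<Rightarrow> complex
   \<Rightarrow> complex \<Rightarrow> (complex \<Rightarrow> 'a^('n mod_ring)^('n mod_ring)) \<Rightarrow> complex \<Rightarrow> 'a" where
  "tgen \<iota> s \<zeta> \<tau> c L \<xi> =
     trace (Lplus \<zeta> c L (\<xi> + c / 2 * \<zeta>) ** matrix_inv (Lminus \<iota> s \<tau> L \<xi>))"

text \<open>The surface.  The second equation is the first one raised to the power \<open>2/N\<close> through
  the exponents \<open>\<tau> + 1\<close> and \<open>\<zeta>\<close>: the shifts by both sides must agree on the variable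
  \<open>z powr (2/N)\<close>, of which \<^const>\<open>Rhat\<close> is a function.  For \<open>N = 2\<close> it follows from the
  first; in general both hold if \<open>N * M * (\<tau> + 1) = - (c + N) * \<zeta>\<close>.\<close>

definition on_surface :: "nat \<Rightarrow> int \<Rightarrow> complex \<Rightarrow> complex \<Rightarrow> complex \<Rightarrow> bool" where
  "on_surface N M \<zeta> \<tau> c \<longleftrightarrow>
     (- exp (\<i> * pi * \<tau>)) powi (int N * M) = exp (\<i> * pi * \<zeta> * (- c - of_nat N))
     \<and> exp (2 * \<i> * pi * of_int M * (\<tau> + 1))
        = exp (2 * \<i> * pi * \<zeta> * (- c - of_nat N) / of_nat N)"

definition Yfactor :: "nat \<Rightarrow> complex \<Rightarrow> complex \<Rightarrow> complex \<Rightarrow> nat \<Rightarrow> complex" where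
  "Yfactor N p q x k =
     (let \<Theta> = Theta (q ^ (2 * N)) in
      ((\<Theta> (x\<^sup>2 / p ^ k))\<^sup>2 * \<Theta> (x\<^sup>2 * q\<^sup>2 * p ^ k) * \<Theta> (x\<^sup>2 / q\<^sup>2 * p ^ k))
      / ((\<Theta> (x\<^sup>2 * p ^ k))\<^sup>2 * \<Theta> (x\<^sup>2 * q\<^sup>2 / p ^ k) * \<Theta> (x\<^sup>2 / q\<^sup>2 / p ^ k)))"

definition Ystruct :: "nat \<Rightarrow> complex \<Rightarrow> complex \<Rightarrow> int \<Rightarrow> complex \<Rightarrow> complex" where
  "Ystruct N p q M x =
     (if M > 0 then \<Prod>k = 1..N * nat M. Yfactor N p q x k
      else \<Prod>k = 1..N * nat \<bar>M\<bar> - 1. Yfactor N p q x k)"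

end

theory Submission
  imports Defs "HOL-Complex_Analysis.Complex_Analysis"
begin

text \<open>
  Write \<open>R(u)\<close> for the normalised R-matrix, \<open>R*(u)\<close> for the one at \<open>p*\<close>, \<open>U(u)\<close> for the factor
  of unitarity \<open>R\<^sub>1\<^sub>2(u) R\<^sub>2\<^sub>1(- u) = U(u)\<close>, and \<open>G\<close> for the matrix that conjugates \<open>L\<close> in \<open>L\<^sup>-\<close>.
  Besides unitarity, \<open>R\<close> has a crossing symmetry, by which the partial transpose of \<open>R\<^sub>2\<^sub>1(v)\<close> is
  inverted, up to a constant times \<open>U(v)\<close>, by the partial transpose of \<open>R(- v - N \<zeta>)\<close>, and a
  quasi-periodicity: \<open>u \<mapsto> u + \<tau> + 1\<close> conjugates \<open>R(u)\<close> by \<open>G\<close> in one tensor factor and divides it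
  by \<open>U(u)\<close>.  The coefficients of \<open>R\<close> are theta quotients indexed by the square of the integers modulo
  \<open>N\<close>, and matrix products become convolutions of them.  Unitarity and crossing thus become
  identities between theta functions, which hold because an entire function is determined up to a
  constant by its multipliers and zeros.

  Let \<open>A = L\<^sup>+\<close> (suitably shifted) and \<open>B\<close> the inverse of \<open>L\<^sup>-\<close>, so that \<open>t = Tr (A B)\<close>.  The exchange relation
  gives \<open>R A\<^sub>1 A'\<^sub>2 = A'\<^sub>2 A\<^sub>1 R*\<close> and \<open>R* B'\<^sub>2 B\<^sub>1 = B\<^sub>1 B'\<^sub>2 R\<close>, and with quasi-periodicity and unitarity also
  an exchange relation between \<open>B\<close> and \<open>A'\<close> with \<open>R\<^sub>2\<^sub>1\<close> at an argument shifted by \<open>c \<zeta>\<close> on one side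
  and \<open>R*\<^sub>2\<^sub>1\<close> on the other.
  Removing the former from the trace by crossing produces \<open>R(u - (c + N) \<zeta>)\<close>.  On the surface
  \<open>- (c + N) \<zeta>\<close> agrees with \<open>N M (\<tau> + 1)\<close> modulo the period \<open>N\<close> of \<open>R\<close>, and the \<open>N\<close>-th power of \<open>G\<close> acts
  trivially, so this matrix is a multiple of \<open>R(u)\<close> by a product of values of \<open>U\<close>; then all R-matrices
  cancel.  The structure function is the quotient of the factors for \<open>u\<close> and \<open>- u\<close>, simplified by means
  of \<open>U(- u) = U(u) = U(u + N \<zeta>)\<close>.
\<close>

section \<open>Entire functions and discrete exceptional sets\<close>

text \<open>The hard identity is unitarity. Its component at index 0 compares two even theta
  functions of order two that agree at 0; a multiple of the square of \<open>th\<close> may still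
  separate them, so their second derivatives at 0 must match. The sum over \<alpha> has no evident
  second derivative, but a product of functions 1 + O(u^2) has the same u^2-coefficient as their
  sum, and the product over all N-torsion points is an explicit theta quotient. Crossing needs no
  such comparison: a partial transpose cancels the commutation phases of the matrices I_\<alpha>,
  the convolution becomes untwisted, and the finite Fourier transform diagonalises it.

  The entries of L do not commute, so under a trace only relabelling of indices and moving of scalar
  matrices are available. This forces a detour through partial transposes, and crossing is exactly
  the invertibility that the detour requires.

  The product for M < 0 is one factor shorter because the two values of U left over from crossing
  contribute the factor of index n = N |M| when M > 0 and its inverse when M < 0.\<close>

lemma entire_doubly_periodic_norm_const:
  fixes f :: "complex \<Rightarrow> complex"
  assumes hol: "f holomorphic_on UNIV" and im: "Im \<tau> > 0"
    and p1: "\<And>z. norm (f (z + 1)) = norm (f z)" and p2: "\<And>z. norm (f (z + \<tau>)) = norm (f z)"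
  obtains c where "\<And>z. f z = c"
proof -
  have n1: "norm (f (z + of_nat n)) = norm (f z)" for z n
  proof (induction n)
    case (Suc n) then show ?case using p1[of "z + of_nat n"] by (simp add: algebra_simps)
  qed simp
  have i1: "norm (f (z + of_int n)) = norm (f z)" for z n
  proof (cases n rule: int_cases2)
    case (nonneg m) then show ?thesis using n1[of z m] by simp
  next
    case (nonpos m) then show ?thesis using n1[of "z - of_nat m" m] by simp
  qed
  have n2: "norm (f (z + of_nat n * \<tau>)) = norm (f z)" for z n
  proof (induction n)
    case (Suc n) then show ?case using p2[of "z + of_nat n * \<tau>"] by (simp add: algebra_simps)
  qed simp
  have i2: "norm (f (z + of_int n * \<tau>)) = norm (f z)" for z n
  proof (cases n rule: int_cases2)
    case (nonneg m) then show ?thesis using n2[of z m] by simp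
  next
    case (nonpos m) then show ?thesis using n2[of "z - of_nat m * \<tau>" m] by simp
  qed
  \<comment> \<open>Every point is congruent modulo the lattice to one whose coordinates with
    respect to 1 and \<tau> lie in [0, 1), and such a point has norm at most 1 + |\<tau>|.\<close>
  define K where "K = cball (0::complex) (1 + norm \<tau>)"
  have "compact (f ` K)"
    by (intro compact_continuous_image holomorphic_on_imp_continuous_on holomorphic_on_subset[OF hol])
      (auto simp: K_def)
  then obtain B where B: "\<And>z. z \<in> K \<Longrightarrow> norm (f z) \<le> B"
    using compact_imp_bounded bounded_iff by (metis imageI)
  have "norm (f z) \<le> B" for z
  proof -
    define s where "s = Im z / Im \<tau>"
    define z1 where "z1 = z - of_int \<lfloor>s\<rfloor> * \<tau>"
    define r where "r = Re z1 - frac s * Re \<tau>"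
    define z2 where "z2 = z1 - of_int \<lfloor>r\<rfloor>"
    have "z2 = complex_of_real (frac r) + complex_of_real (frac s) * \<tau>"
      using im by (auto simp: complex_eq_iff z2_def z1_def r_def s_def frac_def field_simps)
    then have "norm z2 \<le> norm (complex_of_real (frac r)) + norm (complex_of_real (frac s)) * norm \<tau>"
      by (metis norm_mult norm_triangle_ineq)
    also have "\<dots> \<le> 1 + 1 * norm \<tau>"
      using frac_lt_1[of r] frac_lt_1[of s]
      by (intro add_mono mult_right_mono) (auto simp: less_imp_le frac_ge_0)
    finally have "z2 \<in> K" by (simp add: K_def)
    have "norm (f z) = norm (f z1)" using i2[of z1 "\<lfloor>s\<rfloor>"] by (simp add: z1_def)
    also have "\<dots> = norm (f z2)" using i1[of z2 "\<lfloor>r\<rfloor>"] by (simp add: z2_def)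
    finally show ?thesis using B[OF \<open>z2 \<in> K\<close>] by simp
  qed
  then have "bounded (range f)" by (auto simp: bounded_iff)
  then obtain c where "\<And>z. f z = c" using Liouville_theorem[OF hol] by (auto simp: constant_on_def)
  then show ?thesis using that by blast
qed

lemma entire_divide_simple_zeros:
  fixes f g :: "complex \<Rightarrow> complex"
  assumes f: "f holomorphic_on UNIV" and g: "g holomorphic_on UNIV"
    and z: "\<And>z. g z = 0 \<Longrightarrow> f z = 0 \<and> deriv g z \<noteq> 0"
  obtains h where "h holomorphic_on UNIV" "\<And>z. f z = g z * h z"
proof -
  \<comment> \<open>At a zero of \<open>g\<close> the value is the limit given by l'Hopital's rule.
    Simplicity of the zero makes it finite, so \<open>h\<close> is continuous there and the
    singularity is removable.\<close>
  define h where "h z = (if g z = 0 then deriv f z / deriv g z else f z / g z)" for z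
  have df: "(f has_field_derivative deriv f z) (at z)" and dg: "(g has_field_derivative deriv g z) (at z)" for z
    using f g by (auto intro: holomorphic_derivI[of _ UNIV])
  have nz: "eventually (\<lambda>w. g w \<noteq> 0) (at z)" if "g z = 0" for z
  proof -
    have "((\<lambda>w. (g w - g z) / (w - z)) \<longlongrightarrow> deriv g z) (at z)"
      using dg[of z] by (simp add: has_field_derivative_iff)
    then have "eventually (\<lambda>w. (g w - g z) / (w - z) \<noteq> 0) (at z)"
      using z[OF that] by (intro tendsto_imp_eventually_ne) auto
    then show ?thesis by eventually_elim (use that in auto)
  qed
  have "h field_differentiable at z" for z
  proof (cases "g z = 0")
    case False
    have op: "open {w. g w \<noteq> 0}"
    proof -
      have "{w. g w \<noteq> 0} = g -` (-{0})" by auto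
      then show ?thesis using holomorphic_on_imp_continuous_on[OF g]
        by (metis continuous_on_open_vimage open_UNIV inf_top.right_neutral open_Compl closed_singleton)
    qed
    have "(\<lambda>w. f w / g w) holomorphic_on {w. g w \<noteq> 0}"
      by (intro holomorphic_intros holomorphic_on_subset[OF f] holomorphic_on_subset[OF g]) auto
    then have "h holomorphic_on {w. g w \<noteq> 0}"
      by (rule holomorphic_transform) (auto simp: h_def)
    then show ?thesis using op False by (auto simp: holomorphic_on_open field_differentiable_def)
  next
    case True
    obtain d where d: "d > 0" "\<And>w. w \<noteq> z \<Longrightarrow> dist w z < d \<Longrightarrow> g w \<noteq> 0"
      using nz[OF True] by (auto simp: eventually_at)
    have 1: "h holomorphic_on (ball z d - {z})"
    proof -
      have "(\<lambda>w. f w / g w) holomorphic_on (ball z d - {z})"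
        using d by (intro holomorphic_intros holomorphic_on_subset[OF f] holomorphic_on_subset[OF g])
          (auto simp: dist_commute)
      then show ?thesis
        by (rule holomorphic_transform) (use d in \<open>auto simp: h_def dist_commute\<close>)
    qed
    have "((\<lambda>w. ((f w - f z) / (w - z)) / ((g w - g z) / (w - z))) \<longlongrightarrow> deriv f z / deriv g z) (at z)"
      using df[of z] dg[of z] z[OF True] by (intro tendsto_divide) (auto simp: has_field_derivative_iff)
    moreover have "eventually (\<lambda>w. ((f w - f z) / (w - z)) / ((g w - g z) / (w - z)) = h w) (at z)"
      using nz[OF True] eventually_neq_at_within[of z]
      by eventually_elim (use True z in \<open>auto simp: h_def\<close>)
    ultimately have lim: "(h \<longlongrightarrow> h z) (at z)"
      using True by (auto simp: h_def elim: Lim_transform_eventually)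
    have "continuous_on (ball z d) h"
      unfolding continuous_on_eq_continuous_at[OF open_ball]
    proof
      fix w assume w: "w \<in> ball z d"
      show "isCont h w"
      proof (cases "w = z")
        case True then show ?thesis using lim by (simp add: continuous_at)
      next
        case False
        have "continuous_on (ball z d - {z}) h" using 1 holomorphic_on_imp_continuous_on by blast
        then show ?thesis using w False by (simp add: continuous_on_eq_continuous_at open_delete)
      qed
    qed
    then have "h holomorphic_on ball z d"
      using no_isolated_singularity[of "ball z d" h "{z}"] 1 by auto
    then show ?thesis using d by (auto simp: holomorphic_on_open field_differentiable_def)
  qed
  then have "h holomorphic_on UNIV" by (auto simp: holomorphic_on_def)
  moreover have "f w = g w * h w" for w using z by (auto simp: h_def)
  ultimately show ?thesis using that by blast
qed

lemma entire_divide_monomial: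
  fixes f :: "complex \<Rightarrow> complex"
  assumes "f holomorphic_on UNIV" "f 0 = 0"
  obtains h where "h holomorphic_on UNIV" "\<And>z. f z = z * h z" "h 0 = deriv f 0"
proof -
  obtain h where h: "h holomorphic_on UNIV" "\<And>z. f z = z * h z"
    by (rule entire_divide_simple_zeros[of f "\<lambda>z. z"]) (use assms in auto)
  have "((\<lambda>z. z * h z) has_field_derivative h 0) (at 0)"
    using holomorphic_derivI[OF h(1), of 0] by (auto intro!: derivative_eq_intros)
  then have "h 0 = deriv f 0" using h(2) by (metis DERIV_imp_deriv ext)
  then show ?thesis using that h by blast
qed

text \<open>Zeros of a nontrivial entire function are isolated. The exceptional sets for the
  structure functions (\<open>cosparse_generic_at\<close>) arise from this fact.\<close>

lemma cosparse_entire_nonzero: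
  fixes f :: "complex \<Rightarrow> complex"
  assumes "f holomorphic_on UNIV" "f z0 \<noteq> 0"
  shows "\<forall>\<^sub>\<approx>z. f z \<noteq> 0"
proof -
  have "eventually (\<lambda>w. f w \<noteq> 0) (at z)" for z
  proof (cases "f z = 0")
    case True
    obtain r where "0 < r" "\<And>w. w \<in> ball z r - {z} \<Longrightarrow> f w \<noteq> 0"
      using isolated_zeros[OF assms(1) open_UNIV connected_UNIV UNIV_I True UNIV_I assms(2)] by metis
    then show ?thesis unfolding eventually_at by (auto simp: dist_commute intro!: exI[of _ r])
  next
    case False
    have "isCont f z" using holomorphic_on_imp_continuous_on[OF assms(1)] by (simp add: continuous_on_eq_continuous_at)
    then show ?thesis using False by (simp add: continuous_at tendsto_imp_eventually_ne)
  qed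
  then show ?thesis by (simp add: eventually_cosparse_open_eq)
qed

lemma cosparse_compose_affine:
  fixes P :: "complex \<Rightarrow> bool"
  assumes "\<forall>\<^sub>\<approx>z. P z" "a \<noteq> 0"
  shows "\<forall>\<^sub>\<approx>z. P (a * z + b)"
proof -
  have "eventually (\<lambda>w. P (a * w + b)) (at z)" for z
  proof -
    have "eventually P (at (a * z + b))"
      using assms(1) by (simp add: eventually_cosparse_open_eq)
    moreover have "filterlim (\<lambda>w. a * w + b) (at (a * z + b)) (at z)"
      unfolding filterlim_at using assms(2)
      by (auto intro!: tendsto_eq_intros eventually_mono[OF eventually_neq_at_within[of z]])
    ultimately show ?thesis by (simp add: filterlim_iff)
  qed
  then show ?thesis by (simp add: eventually_cosparse_open_eq)
qed

lemma cosparse_shift: "\<forall>\<^sub>\<approx>z. P z \<Longrightarrow> \<forall>\<^sub>\<approx>z. P (z + b)" for P :: "complex \<Rightarrow> bool"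
  using cosparse_compose_affine[of P 1 b] by simp

lemma cosparse_reflect: "\<forall>\<^sub>\<approx>z. P z \<Longrightarrow> \<forall>\<^sub>\<approx>z. P (b - z)" for P :: "complex \<Rightarrow> bool"
  using cosparse_compose_affine[of P "-1" b] by simp

lemma cosparse_happens:
  fixes P :: "complex \<Rightarrow> bool"
  assumes "\<forall>\<^sub>\<approx>z. P z"
  shows "\<exists>z. P z"
  using assms by (rule eventually_happens'[rotated]) simp

text \<open>If \<open>f - g\<close> were not identically zero, its zeros and those of
  \<open>A\<close> would both be discrete, and some point would avoid both sets. This allows
  division by a theta function without treating its zeros separately.\<close>

lemma entire_cancel:
  fixes f g A :: "complex \<Rightarrow> complex"
  assumes "f holomorphic_on UNIV" "g holomorphic_on UNIV" "A holomorphic_on UNIV" "A z0 \<noteq> 0"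
    and "\<And>z. A z * f z = A z * g z"
  shows "f z = g z"
proof (rule ccontr)
  assume "f z \<noteq> g z"
  then have "\<forall>\<^sub>\<approx>z. f z - g z \<noteq> 0"
    by (intro cosparse_entire_nonzero[of _ z]) (use assms in \<open>auto intro!: holomorphic_intros\<close>)
  moreover have "\<forall>\<^sub>\<approx>z. A z \<noteq> 0" using assms by (intro cosparse_entire_nonzero)
  ultimately have "\<forall>\<^sub>\<approx>z. f z - g z \<noteq> 0 \<and> A z \<noteq> 0" by (rule eventually_conj)
  then obtain w where "f w - g w \<noteq> 0" "A w \<noteq> 0"
    using cosparse_happens[of "\<lambda>z. f z - g z \<noteq> 0 \<and> A z \<noteq> 0"] by auto
  then show False using assms(5)[of w] by simp
qed

lemma holomorphic_compose_affine:
  assumes "f holomorphic_on UNIV"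
  shows "(\<lambda>z. f (a * z + b)) holomorphic_on UNIV"
proof -
  have "(f \<circ> (\<lambda>z. a * z + b)) holomorphic_on UNIV"
    by (rule holomorphic_on_compose) (auto intro!: holomorphic_intros holomorphic_on_subset[OF assms])
  then show ?thesis by (simp add: o_def)
qed

section \<open>Infinite products\<close>

text \<open>One level of the recursion of \<open>qpoch\<close>: \<open>F\<close> stands for the
  product over the remaining parameters. The two properties required of \<open>F\<close> are
  inherited by the new product, which makes induction over the parameter list possible.\<close>

locale scaled_product =
  fixes F :: "complex \<Rightarrow> complex" and a :: complex
  assumes hol: "F holomorphic_on UNIV" and F0: "F 0 = 1" and a: "norm a < 1"
begin

lemma bound:
  assumes "R > 0"
  obtains B where "\<And>x n. norm x \<le> R \<Longrightarrow> norm (F (x * a ^ n) - 1) \<le> B * norm a ^ n"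
proof -
  \<comment> \<open>Since \<open>F - 1\<close> vanishes at 0 it is x times an entire function. On a
    disc the n-th factor therefore differs from 1 by at most a constant times |a|^n,
    uniformly.\<close>
  obtain h where h: "h holomorphic_on UNIV" "\<And>z. F z - 1 = z * h z"
    by (rule entire_divide_monomial[of "\<lambda>z. F z - 1"]) (use hol F0 in \<open>auto intro!: holomorphic_intros\<close>)
  have "compact (h ` cball 0 R)"
    by (intro compact_continuous_image holomorphic_on_imp_continuous_on holomorphic_on_subset[OF h(1)]) auto
  then obtain B where B: "\<And>z. z \<in> cball 0 R \<Longrightarrow> norm (h z) \<le> B"
    using compact_imp_bounded bounded_iff by (metis imageI)
  have "norm (F (x * a ^ n) - 1) \<le> (R * B) * norm a ^ n" if "norm x \<le> R" for x n
  proof -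
    have an: "norm a ^ n \<le> 1" using a by (simp add: power_le_one)
    have "norm x * norm a ^ n \<le> R * 1" using that an assms by (intro mult_mono) auto
    then have "norm (h (x * a ^ n)) \<le> B" by (intro B) (auto simp: norm_mult norm_power)
    then have "norm x * norm a ^ n * norm (h (x * a ^ n)) \<le> R * norm a ^ n * B"
      using that assms by (intro mult_mono) auto
    then show ?thesis by (simp add: h norm_mult norm_power mult_ac)
  qed
  then show ?thesis using that by blast
qed

lemma convergent: "convergent_prod (\<lambda>n. F (x * a ^ n))"
proof -
  obtain B where B: "\<And>(y::complex) n. norm y \<le> norm x + 1 \<Longrightarrow> norm (F (y * a ^ n) - 1) \<le> B * norm a ^ n"
    using bound[of "norm x + 1"] by (metis add.commute add_pos_nonneg norm_ge_zero zero_less_one)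
  have "summable (\<lambda>n. norm (F (x * a ^ n) - 1))"
    by (rule summable_comparison_test'[of "\<lambda>n. B * norm a ^ n" 0])
      (use B[of x] a in \<open>auto intro!: summable_mult summable_geometric\<close>)
  then have "abs_convergent_prod (\<lambda>n. F (x * a ^ n))"
    by (simp add: abs_convergent_prod_conv_summable)
  then show ?thesis by (rule abs_convergent_prod_imp_convergent_prod)
qed

definition P where "P x = prodinf (\<lambda>n. F (x * a ^ n))"

lemma lim: "(\<lambda>n. \<Prod>i\<le>n. F (x * a ^ i)) \<longlonglongrightarrow> P x"
  using convergent_prod_LIMSEQ[OF convergent[of x]] by (simp add: P_def)

lemma holomorphic: "P holomorphic_on UNIV"
proof (rule holomorphic_uniform_sequence)
  fix z :: complex
  define R where "R = norm z + 1"
  have R: "R > 0" by (simp add: R_def add_nonneg_pos)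
  obtain B where B: "\<And>(y::complex) n. norm y \<le> R \<Longrightarrow> norm (F (y * a ^ n) - 1) \<le> B * norm a ^ n"
    using bound[OF R] by blast
  have "uniformly_convergent_on (cball 0 R) (\<lambda>N (y::complex). \<Prod>n<N. F (y * a ^ n))"
  proof (rule uniformly_convergent_on_prod')
    show "uniformly_convergent_on (cball 0 R) (\<lambda>N (y::complex). \<Sum>n<N. norm (F (y * a ^ n) - 1))"
      by (rule Weierstrass_m_test'[where M = "\<lambda>n. B * norm a ^ n"])
        (use B a in \<open>auto intro!: summable_mult summable_geometric\<close>)
    have "continuous_on UNIV F" using hol holomorphic_on_imp_continuous_on by blast
    then show "continuous_on (cball 0 R) (\<lambda>y::complex. F (y * a ^ n))" for n
      by (rule continuous_on_compose2) (auto intro!: continuous_intros)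
  qed auto
  then obtain g where g: "uniform_limit (cball 0 R) (\<lambda>N (y::complex). \<Prod>n<N. F (y * a ^ n)) g sequentially"
    by (auto simp: uniformly_convergent_on_def)
  also have "?this \<longleftrightarrow> uniform_limit (cball 0 R) (\<lambda>N (y::complex). \<Prod>n<N. F (y * a ^ n)) P sequentially"
  proof (intro uniform_limit_cong)
    fix y :: complex assume "y \<in> cball 0 R"
    have "(\<lambda>N. \<Prod>n<Suc N. F (y * a ^ n)) \<longlonglongrightarrow> g y"
      by (rule LIMSEQ_Suc, rule tendsto_uniform_limitI[OF g]) fact
    then have "(\<lambda>N. \<Prod>n\<le>N. F (y * a ^ n)) \<longlonglongrightarrow> g y"
      by (simp only: lessThan_Suc_atMost)
    then show "g y = P y"
      using lim[of y] by (rule LIMSEQ_unique)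
  qed auto
  finally have "uniform_limit (cball z 1) (\<lambda>N (y::complex). \<Prod>n<N. F (y * a ^ n)) P sequentially"
    by (rule uniform_limit_on_subset) (simp add: cball_subset_cball_iff R_def)
  then show "\<exists>d>0. cball z d \<subseteq> UNIV \<and>
      uniform_limit (cball z d) (\<lambda>N (y::complex). \<Prod>n<N. F (y * a ^ n)) P sequentially"
    by (intro exI[of _ 1]) auto
next
  have "(F \<circ> (\<lambda>y::complex. y * a ^ k)) holomorphic_on UNIV" for k
    by (rule holomorphic_on_compose) (auto intro!: holomorphic_intros holomorphic_on_subset[OF hol])
  then show "(\<lambda>y::complex. \<Prod>k<n. F (y * a ^ k)) holomorphic_on UNIV" for n
    by (auto intro!: holomorphic_intros simp: o_def)
qed auto

lemma at_0: "P 0 = 1"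
  by (simp add: P_def F0)

lemma rec: "P x = F x * P (x * a)"
proof -
  have "(\<Prod>i\<le>Suc n. F (x * a ^ i)) = F x * (\<Prod>i\<le>n. F (x * a * a ^ i))" for n
    by (subst prod.atMost_Suc_shift) (simp add: mult_ac)
  then have "(\<lambda>n. \<Prod>i\<le>Suc n. F (x * a ^ i)) \<longlonglongrightarrow> F x * P (x * a)"
    by (simp only:) (intro tendsto_intros lim)
  moreover have "(\<lambda>n. \<Prod>i\<le>Suc n. F (x * a ^ i)) \<longlonglongrightarrow> P x"
    using LIMSEQ_Suc[OF lim] .
  ultimately show ?thesis using LIMSEQ_unique by blast
qed

lemma zero_iff: "P x = 0 \<longleftrightarrow> (\<exists>n. F (x * a ^ n) = 0)"
  using has_prod_eq_0_iff[OF convergent_prod_has_prod[OF convergent[of x]]]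
  by (metis (mono_tags, lifting) P_def rangeE rangeI)

end

lemma qpoch_entire:
  assumes "\<forall>a\<in>set as. norm a < 1"
  shows "(\<lambda>x. qpoch x as) holomorphic_on UNIV \<and> qpoch 0 as = 1"
  using assms
proof (induction as)
  case Nil show ?case by (auto intro!: holomorphic_intros)
next
  case (Cons a as)
  interpret scaled_product "\<lambda>x. qpoch x as" a using Cons by unfold_locales auto
  show ?case using holomorphic at_0 by (simp add: P_def[abs_def])
qed

lemma qpoch_Cons:
  assumes "\<forall>b\<in>set (a # as). norm b < 1"
  shows "qpoch x (a # as) = qpoch x as * qpoch (x * a) (a # as)"
proof -
  interpret scaled_product "\<lambda>x. qpoch x as" a
    using assms qpoch_entire[of as] by unfold_locales auto
  show ?thesis using rec[of x] by (simp add: P_def)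
qed

lemma qpoch_zero_iff:
  assumes "norm a < 1"
  shows "qpoch x [a] = 0 \<longleftrightarrow> (\<exists>n. x * a ^ n = 1)"
proof -
  interpret scaled_product "\<lambda>x. 1 - x" a
    using assms by unfold_locales (auto intro!: holomorphic_intros)
  show ?thesis using zero_iff[of x] by (auto simp: P_def)
qed

text \<open>\<open>qpoch\<close> unfolds its list from the left, so the shift in the second
  parameter is not an instance of \<open>qpoch_Cons\<close>. It holds for every factor of the outer
  product, hence for the partial products, and passes to the limit.\<close>

lemma qpoch_shift_second:
  assumes p: "norm p < 1" and a: "norm a < 1"
  shows "qpoch x [p, a] = qpoch x [p] * qpoch (x * a) [p, a]"
proof -
  interpret one: scaled_product "\<lambda>x. 1 - x" p
    using p by unfold_locales (auto intro!: holomorphic_intros)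
  interpret two: scaled_product "\<lambda>x. qpoch x [a]" p
    using p a qpoch_entire[of "[a]"] by unfold_locales auto
  have "(\<lambda>n. (\<Prod>i\<le>n. 1 - x * p ^ i) * (\<Prod>i\<le>n. qpoch (x * a * p ^ i) [a]))
      \<longlonglongrightarrow> one.P x * two.P (x * a)"
    by (intro tendsto_mult one.lim two.lim)
  moreover have "(\<Prod>i\<le>n. 1 - x * p ^ i) * (\<Prod>i\<le>n. qpoch (x * a * p ^ i) [a])
      = (\<Prod>i\<le>n. qpoch (x * p ^ i) [a])" for n
  proof -
    have *: "qpoch (x * p ^ i) [a] = (1 - x * p ^ i) * qpoch (x * a * p ^ i) [a]" for i
      by (subst qpoch_Cons) (use a in \<open>auto simp: mult_ac\<close>)
    show ?thesis
      by (simp add: prod.distrib[symmetric] * del: qpoch.simps)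
  qed
  ultimately have "two.P x = one.P x * two.P (x * a)"
    using two.lim[of x] LIMSEQ_unique by fastforce
  moreover have "qpoch y [p] = one.P y" for y unfolding one.P_def by simp
  moreover have "qpoch y [p, a] = two.P y" for y unfolding two.P_def by (rule qpoch.simps(2))
  ultimately show ?thesis by simp
qed

declare qpoch.simps(2) [simp del]

lemma holomorphic_qpoch [holomorphic_intros]:
  assumes "f holomorphic_on A" "\<forall>a\<in>set as. norm a < 1"
  shows "(\<lambda>x. qpoch (f x) as) holomorphic_on A"
  using holomorphic_on_compose_gen[OF assms(1) conjunct1[OF qpoch_entire[OF assms(2)]]]
  by (simp add: o_def)

text \<open>Along u = t / b with t tending to minus infinity the argument tends to 0, where the
  product equals 1. Hence the entire function of u is not identically zero.\<close>

lemma cosparse_qpoch_exp: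
  assumes as: "\<forall>a\<in>set as. norm a < 1" and b: "b \<noteq> 0"
  shows "\<forall>\<^sub>\<approx>u. qpoch (c * exp (b * u)) as \<noteq> 0"
proof -
  have hol: "(\<lambda>x. qpoch x as) holomorphic_on UNIV" and q0: "qpoch 0 as = 1"
    using qpoch_entire[OF as] by auto
  have "isCont (\<lambda>x. qpoch x as) 0"
    using holomorphic_on_imp_continuous_on[OF hol] by (simp add: continuous_on_eq_continuous_at)
  moreover have "filterlim (\<lambda>t. c * exp (b * (complex_of_real t / b))) (nhds 0) at_bot"
  proof -
    have "((\<lambda>t. c * complex_of_real (exp t)) \<longlongrightarrow> c * complex_of_real 0) at_bot"
      by (intro tendsto_intros exp_at_bot)
    then show ?thesis using b by (simp add: exp_of_real)
  qed
  ultimately have "((\<lambda>t. qpoch (c * exp (b * (complex_of_real t / b))) as) \<longlongrightarrow> 1) at_bot"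
    using q0 isCont_tendsto_compose by fastforce
  then have "eventually (\<lambda>t. qpoch (c * exp (b * (complex_of_real t / b))) as \<noteq> 0) at_bot"
    by (rule tendsto_imp_eventually_ne) auto
  then obtain t where "qpoch (c * exp (b * (complex_of_real t / b))) as \<noteq> 0"
    using eventually_happens by force
  then show ?thesis
    by (intro cosparse_entire_nonzero[of _ "complex_of_real t / b"])
      (use as in \<open>auto intro!: holomorphic_intros\<close>)
qed

section \<open>Functional equations and zeros of the theta product\<close>

lemma Theta_shift:
  assumes a: "norm a < 1" "a \<noteq> 0" and x: "x \<noteq> 0"
  shows "Theta a (a * x) = - Theta a x / x"
proof -
  have 1: "qpoch x [a] = (1 - x) * qpoch (a * x) [a]"
    using qpoch_Cons[of a "[]" x] a by (simp add: mult.commute)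
  have 2: "qpoch (1 / x) [a] = (1 - 1 / x) * qpoch (a / x) [a]"
    using qpoch_Cons[of a "[]" "1 / x"] a by simp
  have "Theta a (a * x) = qpoch (a * x) [a] * ((1 - 1 / x) * qpoch (a / x) [a]) * qpoch a [a]"
    using a by (simp add: Theta_def 2[symmetric])
  also have "\<dots> = - Theta a x / x"
    unfolding Theta_def 1 using x by (simp add: field_simps)
  finally show ?thesis .
qed

lemma Theta_inverse:
  assumes a: "norm a < 1" and x: "x \<noteq> 0"
  shows "Theta a (1 / x) = - Theta a x / x"
proof -
  have 1: "qpoch x [a] = (1 - x) * qpoch (a * x) [a]"
    using qpoch_Cons[of a "[]" x] a by (simp add: mult.commute)
  have 2: "qpoch (1 / x) [a] = (1 - 1 / x) * qpoch (a / x) [a]"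
    using qpoch_Cons[of a "[]" "1 / x"] a by simp
  show ?thesis unfolding Theta_def 1 2 using x by (simp add: field_simps)
qed

lemma Theta_zero_iff:
  assumes a: "norm a < 1" "a \<noteq> 0" and x: "x \<noteq> 0"
  shows "Theta a x = 0 \<longleftrightarrow> (\<exists>n::int. x = a powi n)"
proof -
  \<comment> \<open>This excludes zeros of the constant third factor \<open>qpoch a [a]\<close>. The
    other two factors supply the nonpositive and the positive powers of \<open>a\<close>.\<close>
  have "a * a ^ n \<noteq> 1" for n
  proof
    assume "a * a ^ n = 1"
    then have "norm a * norm a ^ n = 1" by (metis norm_mult norm_power norm_one)
    moreover have "norm a * norm a ^ n < 1"
      using a by (metis norm_ge_zero power_Suc power_Suc_less_one zero_less_norm_iff)
    ultimately show False by simp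
  qed
  then have "Theta a x = 0 \<longleftrightarrow> (\<exists>n. x * a ^ n = 1) \<or> (\<exists>n. a / x * a ^ n = 1)"
    using a by (auto simp: Theta_def qpoch_zero_iff)
  also have "\<dots> \<longleftrightarrow> (\<exists>n::int. x = a powi n)"
  proof
    assume "(\<exists>n. x * a ^ n = 1) \<or> (\<exists>n. a / x * a ^ n = 1)"
    then show "\<exists>n::int. x = a powi n"
    proof
      assume "\<exists>n. x * a ^ n = 1"
      then obtain n where "x * a ^ n = 1" by blast
      then have "x = a powi (- int n)" using a by (simp add: power_int_minus field_simps)
      then show ?thesis by blast
    next
      assume "\<exists>n. a / x * a ^ n = 1"
      then obtain n where "a / x * a ^ n = 1" by blast
      then have "x = a ^ Suc n" using x by (simp add: field_simps)
      then have "x = a powi (int (Suc n))" by (simp only: power_int_of_nat)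
      then show ?thesis by blast
    qed
  next
    assume "\<exists>n::int. x = a powi n"
    then obtain n :: int where n: "x = a powi n" by blast
    show "(\<exists>n. x * a ^ n = 1) \<or> (\<exists>n. a / x * a ^ n = 1)"
    proof (cases "n \<le> 0")
      case True
      then obtain m where "n = - int m" by (metis nonpos_int_cases)
      then have "x * a ^ m = 1" using n a by (simp add: power_int_minus)
      then show ?thesis by blast
    next
      case False
      then obtain m where "n = int (Suc m)" by (metis not_le zero_less_imp_eq_int gr0_implies_Suc)
      then have "a / x * a ^ m = 1" using n a x by (simp only: power_int_of_nat) simp
      then show ?thesis by blast
    qed
  qed
  finally show ?thesis .
qed

section \<open>The odd theta function\<close>

lemma power_abs_int_summable_on:
  fixes r :: real
  assumes "0 \<le> r" "r < 1"
  shows "(\<lambda>m::int. r ^ nat \<bar>m\<bar>) summable_on UNIV"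
proof -
  have nat: "(\<lambda>n::nat. r ^ n) summable_on UNIV"
    using assms by (subst summable_on_UNIV_nonneg_real_iff) (auto intro!: summable_geometric)
  have "(\<lambda>m::int. r ^ nat \<bar>m\<bar>) summable_on range int"
    by (subst summable_on_reindex) (auto simp: o_def nat)
  moreover have "(\<lambda>m::int. r ^ nat \<bar>m\<bar>) summable_on range (\<lambda>n. - int n)"
    by (subst summable_on_reindex) (auto simp: o_def nat inj_def)
  ultimately have "(\<lambda>m::int. r ^ nat \<bar>m\<bar>) summable_on (range int \<union> range (\<lambda>n. - int n))"
    using summable_on_subset_banach[OF _ Diff_subset]
    by (metis Un_Diff_cancel summable_on_Un_disjoint Diff_disjoint)
  moreover have "range int \<union> range (\<lambda>n. - int n) = UNIV"
    by (metis (no_types, lifting) UNIV_eq_I UnCI int_cases2 rangeI)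
  ultimately show ?thesis by simp
qed

lemma exp_add_2pi_int: "exp (z + 2 * \<i> * pi * of_int m) = exp z"
proof -
  have "exp (2 * \<i> * pi * of_int m) = 1"
    using exp_integer_2pi[OF Ints_of_int, of m] by (simp add: mult_ac of_real_mult del: of_real_mult[symmetric])
  then show ?thesis by (simp only: exp_add) simp
qed

definition theta_term :: "complex \<Rightarrow> int \<Rightarrow> complex \<Rightarrow> complex" where
  "theta_term \<tau> m u = exp (\<i> * pi * (of_int m)\<^sup>2 * \<tau> + 2 * \<i> * pi * of_int m * u)"

definition theta_series :: "complex \<Rightarrow> complex \<Rightarrow> complex" where
  "theta_series \<tau> u = (\<Sum>\<^sub>\<infinity>m::int. theta_term \<tau> m u)"

lemma theta_term_bound:
  assumes t: "Im \<tau> > 0"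
  shows "\<exists>M. M summable_on UNIV \<and> (\<forall>m u. norm u \<le> R \<longrightarrow> norm (theta_term \<tau> m u) \<le> M m)"
proof -
  define t where "t = Im \<tau>"
  define C where "C = exp (pi * ((2 * R + 1)\<^sup>2 / (4 * t)))"
  define M where "M m = C * exp (- pi) ^ nat \<bar>m\<bar>" for m :: int
  have "M summable_on UNIV"
    unfolding M_def by (intro summable_on_cmult_right power_abs_int_summable_on) auto
  moreover have "norm (theta_term \<tau> m u) \<le> M m" if "norm u \<le> R" for m u
  proof -
    define a where "a = real_of_int \<bar>m\<bar>"
    have a0: "a \<ge> 0" and am: "(real_of_int m)\<^sup>2 = a\<^sup>2" by (auto simp: a_def)
    have "- (of_int m * Im u) \<le> a * \<bar>Im u\<bar>"
      unfolding a_def by (metis abs_ge_minus_self abs_mult of_int_abs)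
    also have "\<dots> \<le> a * R" using that abs_Im_le_cmod[of u] a0 by (intro mult_left_mono) auto
    finally have 1: "- (of_int m * Im u) \<le> a * R" .
    \<comment> \<open>Completing the square with slope 2R + 1: the part 2R absorbs the linear term
      in u on the disc, and the extra 1 leaves the geometric factor exp(-pi)^|m|.\<close>
    have "0 \<le> (2 * t * a - (2 * R + 1))\<^sup>2" by simp
    also have "\<dots> = 4 * t * (t * a\<^sup>2 - (2 * R + 1) * a) + (2 * R + 1)\<^sup>2"
      by (simp add: power2_eq_square algebra_simps)
    finally have "- (t * a\<^sup>2) + (2 * R + 1) * a \<le> (2 * R + 1)\<^sup>2 / (4 * t)"
      using t by (simp add: field_simps t_def)
    then have "- (t * a\<^sup>2) + 2 * (- (of_int m * Im u)) \<le> (2 * R + 1)\<^sup>2 / (4 * t) - a"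
      using 1 by (simp add: algebra_simps)
    then have "pi * (- (t * a\<^sup>2) + 2 * (- (of_int m * Im u))) \<le> pi * ((2 * R + 1)\<^sup>2 / (4 * t) - a)"
      by (intro mult_left_mono) auto
    then have "exp (pi * (- (t * a\<^sup>2) + 2 * (- (of_int m * Im u)))) \<le> C * exp (- pi * a)"
      unfolding C_def exp_add[symmetric] by (subst exp_le_cancel_iff) (simp add: algebra_simps)
    moreover have "exp (- pi * a) = exp (- pi) ^ nat \<bar>m\<bar>"
      unfolding a_def by (subst exp_of_nat_mult[symmetric]) (simp add: mult.commute)
    moreover have "norm (theta_term \<tau> m u) = exp (pi * (- (t * a\<^sup>2) + 2 * (- (of_int m * Im u))))"
    proof -
      have "(complex_of_int m)\<^sup>2 = complex_of_real (a\<^sup>2)" by (metis am of_real_of_int_eq of_real_power)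
      then show ?thesis by (simp add: theta_term_def t_def algebra_simps)
    qed
    ultimately show ?thesis by (simp add: M_def)
  qed
  ultimately show ?thesis by (intro exI[of _ M]) simp
qed

lemma theta_series_uniform:
  assumes "Im \<tau> > 0"
  shows "uniform_limit (cball 0 R) (\<lambda>X u. \<Sum>m\<in>X. theta_term \<tau> m u) (theta_series \<tau>)
    (finite_subsets_at_top UNIV)"
proof -
  obtain M where M: "M summable_on UNIV" "\<And>m u. norm u \<le> R \<Longrightarrow> norm (theta_term \<tau> m u) \<le> M m"
    using theta_term_bound[OF assms, of R] by (elim exE conjE) simp
  show ?thesis
    unfolding theta_series_def[abs_def]
    by (rule Weierstrass_m_test_general[OF _ M(1)]) (use M(2) in auto)
qed

lemma theta_series_holomorphic:
  assumes "Im \<tau> > 0"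
  shows "theta_series \<tau> holomorphic_on UNIV"
proof -
  have "theta_series \<tau> holomorphic_on ball 0 R" for R
  proof (rule holomorphic_uniform_limit[OF _ theta_series_uniform[OF assms, of R]])
    show "\<forall>\<^sub>F X in finite_subsets_at_top UNIV.
        continuous_on (cball 0 R) (\<lambda>u. \<Sum>m\<in>X. theta_term \<tau> m u) \<and>
        (\<lambda>u. \<Sum>m\<in>X. theta_term \<tau> m u) holomorphic_on ball 0 R"
      by (intro always_eventually allI conjI)
        (auto simp: theta_term_def intro!: continuous_intros holomorphic_intros)
  qed auto
  then have "theta_series \<tau> field_differentiable at z" for z
    by (metis holomorphic_on_imp_differentiable_at open_ball mem_ball_0 less_add_one)
  then show ?thesis by (auto simp: holomorphic_on_def)
qed

lemma theta_series_plus_1: "theta_series \<tau> (u + 1) = theta_series \<tau> u"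
proof -
  have "theta_term \<tau> m (u + 1) = theta_term \<tau> m u" for m
  proof -
    have "theta_term \<tau> m (u + 1) = exp ((\<i> * pi * (of_int m)\<^sup>2 * \<tau> + 2 * \<i> * pi * of_int m * u)
        + 2 * \<i> * pi * of_int m)"
      unfolding theta_term_def by (rule arg_cong[of _ _ exp]) (simp add: algebra_simps)
    then show ?thesis by (simp only: exp_add_2pi_int theta_term_def)
  qed
  then show ?thesis by (simp add: theta_series_def)
qed

lemma theta_series_plus_tau:
  "theta_series \<tau> (u + \<tau>) = exp (- \<i> * pi * \<tau> - 2 * \<i> * pi * u) * theta_series \<tau> u"
proof -
  have *: "theta_term \<tau> m (u + \<tau>) = exp (- \<i> * pi * \<tau> - 2 * \<i> * pi * u) * theta_term \<tau> (m + 1) u" for m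
    by (simp add: theta_term_def exp_add[symmetric] power2_eq_square algebra_simps)
  have "(\<Sum>\<^sub>\<infinity>m::int. theta_term \<tau> (m + 1) u) = theta_series \<tau> u"
    unfolding theta_series_def
    by (rule infsum_reindex_bij_betw[where g = "\<lambda>m. m + 1"])
      (auto intro!: bij_betwI[where g = "\<lambda>m. m - 1"])
  then show ?thesis
    by (simp only: theta_series_def * infsum_cmult_right')
qed

text \<open>The zeroth Fourier coefficient of the series is 1.\<close>
lemma theta_series_nontrivial:
  assumes t: "Im \<tau> > 0"
  obtains u where "theta_series \<tau> u \<noteq> 0"
proof (rule ccontr)
  assume "\<not> thesis"
  then have 0: "theta_series \<tau> u = 0" for u using that by blast
  have "\<forall>\<^sub>F X in finite_subsets_at_top UNIV.
      \<forall>u\<in>cball 0 1. dist (\<Sum>m\<in>X. theta_term \<tau> m u) (theta_series \<tau> u) < 1/2"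
    using theta_series_uniform[OF t, of 1] by (rule uniform_limitD) simp
  then obtain X0 where X0: "finite X0" "\<forall>X. finite X \<and> X0 \<subseteq> X \<and> X \<subseteq> UNIV \<longrightarrow>
      (\<forall>u\<in>cball 0 1. dist (\<Sum>m\<in>X. theta_term \<tau> m u) (theta_series \<tau> u) < 1/2)"
    unfolding eventually_finite_subsets_at_top by (elim exE conjE)
  \<comment> \<open>The index 0 is included so that the partial sum has mean value 1 over [0, 1]. If
    the series vanished, the uniform error 1/2 would bound that mean by 1/2.\<close>
  define X where "X = insert 0 X0"
  have X: "finite X" "X0 \<subseteq> X" "0 \<in> X" using X0(1) by (auto simp: X_def)
  define S where "S x = (\<Sum>m\<in>X. theta_term \<tau> m (complex_of_real x))" for x
  have "((\<lambda>x. theta_term \<tau> m (complex_of_real x)) has_integral (if m = 0 then 1 else 0)) {0..1}" for m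
  proof (cases "m = 0")
    case True
    then have "theta_term \<tau> m u = 1" for u by (simp add: theta_term_def)
    then show ?thesis using True has_integral_const_real[of "1::complex" 0 1] by simp
  next
    case False
    define F where "F x = theta_term \<tau> m (complex_of_real x) / (2 * \<i> * pi * of_int m)" for x
    have "((\<lambda>x. theta_term \<tau> m (complex_of_real x)) has_integral (F 1 - F 0)) {0..1}"
    proof (rule fundamental_theorem_of_calculus)
      fix x :: real
      have "((\<lambda>u. theta_term \<tau> m u / (2 * \<i> * pi * of_int m)) has_field_derivative
          theta_term \<tau> m (complex_of_real x)) (at (complex_of_real x))"
        unfolding theta_term_def using False by (auto intro!: derivative_eq_intros)
      from has_vector_derivative_real_field[OF this]
      show "(F has_vector_derivative theta_term \<tau> m (complex_of_real x)) (at x within {0..1})"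
        by (simp add: F_def[abs_def])
    qed auto
    moreover have "F 1 = F 0"
    proof -
      have "theta_term \<tau> m 1 = theta_term \<tau> m 0"
        using exp_add_2pi_int[of "\<i> * pi * (of_int m)\<^sup>2 * \<tau>" m] by (simp add: theta_term_def)
      then show ?thesis by (simp add: F_def)
    qed
    ultimately show ?thesis using False by simp
  qed
  then have "(S has_integral (\<Sum>m\<in>X. if m = 0 then 1 else 0)) {0..1}"
    unfolding S_def by (intro has_integral_sum X) auto
  then have S1: "(S has_integral 1) {0..1}" using X by simp
  have "norm (S x) \<le> 1/2" if "x \<in> {0..1}" for x
  proof -
    have "complex_of_real x \<in> cball 0 1" using that by simp
    then have "dist (S x) (theta_series \<tau> x) < 1/2" using X0(2) X(1,2) unfolding S_def by blast
    then show ?thesis by (simp add: 0)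
  qed
  then have "norm (1::complex) \<le> 1/2 * measure lborel {0..1::real}"
    by (intro has_integral_bound_real[OF _ finite.emptyI S1]) auto
  then show False by simp
qed

text \<open>Up to a constant this is the odd Jacobi theta function, in product form so that its
  zeros can be read off. The exponential makes it odd, at the price of the sign in
  \<open>th_plus_1\<close>.\<close>

definition th :: "complex \<Rightarrow> complex \<Rightarrow> complex" where
  "th \<tau> u = exp (- \<i> * pi * u) * Theta (p_of \<tau>) (exp (2 * \<i> * pi * u))"

lemma norm_p_of: "norm (p_of \<tau>) < 1 \<longleftrightarrow> Im \<tau> > 0"
  by (simp add: p_of_def zero_less_mult_iff)

lemma p_of_nonzero [simp]: "p_of \<tau> \<noteq> 0" by (simp add: p_of_def)

lemma Theta_th: "Theta (p_of \<tau>) (exp (2 * \<i> * pi * u)) = exp (\<i> * pi * u) * th \<tau> u"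
  by (simp add: th_def mult.assoc[symmetric] exp_add[symmetric])

section \<open>Multipliers, simple zeros and uniqueness of the odd theta function\<close>

context
  fixes \<tau> :: complex
  assumes im: "Im \<tau> > 0"
begin

lemma norm_p_of_less_1: "norm (p_of \<tau>) < 1" using im by (simp add: norm_p_of)

lemma th_holomorphic: "th \<tau> holomorphic_on UNIV"
  unfolding th_def[abs_def] Theta_def using norm_p_of_less_1 by (auto intro!: holomorphic_intros)

lemma th_minus: "th \<tau> (- u) = - th \<tau> u"
proof -
  have "th \<tau> (- u) = exp (\<i> * pi * u) * Theta (p_of \<tau>) (1 / exp (2 * \<i> * pi * u))"
    by (simp add: th_def exp_minus inverse_eq_divide)
  also have "\<dots> = - (exp (\<i> * pi * u) * exp (- (2 * \<i> * pi * u)) * Theta (p_of \<tau>) (exp (2 * \<i> * pi * u)))"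
    by (subst Theta_inverse) (auto simp: norm_p_of_less_1 exp_minus field_simps)
  also have "exp (\<i> * pi * u) * exp (- (2 * \<i> * pi * u)) = exp (- \<i> * pi * u)"
    by (simp add: exp_add[symmetric] mult_ac)
  finally show ?thesis by (simp add: th_def)
qed

lemma th_plus_1: "th \<tau> (u + 1) = - th \<tau> u"
proof -
  have "exp (2 * \<i> * pi * (u + 1)) = exp (2 * \<i> * pi * u)"
    by (simp add: exp_add algebra_simps)
  moreover have "exp (- \<i> * pi * (u + 1)) = - exp (- \<i> * pi * u)"
  proof -
    have "- \<i> * pi * (u + 1) = - \<i> * pi * u + - (\<i> * pi)" by (simp add: algebra_simps)
    then show ?thesis by (simp only: exp_add exp_minus exp_pi_i') simp
  qed
  ultimately show ?thesis by (simp only: th_def) simp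
qed

lemma th_plus_tau: "th \<tau> (u + \<tau>) = - exp (- \<i> * pi * \<tau> - 2 * \<i> * pi * u) * th \<tau> u"
proof -
  have "exp (2 * \<i> * pi * (u + \<tau>)) = p_of \<tau> * exp (2 * \<i> * pi * u)"
    by (simp add: p_of_def exp_add[symmetric] algebra_simps)
  then have "th \<tau> (u + \<tau>) = exp (- \<i> * pi * (u + \<tau>)) *
      (- Theta (p_of \<tau>) (exp (2 * \<i> * pi * u)) / exp (2 * \<i> * pi * u))"
    by (simp only: th_def) (simp add: Theta_shift norm_p_of_less_1)
  also have "\<dots> = - (exp (- \<i> * pi * (u + \<tau>) - 2 * \<i> * pi * u) * Theta (p_of \<tau>) (exp (2 * \<i> * pi * u)))"
    by (simp add: exp_diff)
  also have "exp (- \<i> * pi * (u + \<tau>) - 2 * \<i> * pi * u)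
      = exp (- \<i> * pi * \<tau> - 2 * \<i> * pi * u) * exp (- \<i> * pi * u)"
    by (simp add: exp_add[symmetric] algebra_simps)
  finally show ?thesis by (simp add: th_def)
qed

lemma th_quasi_nat:
  "th \<tau> (u + of_nat k * \<tau>) = (-1) ^ k * exp (- \<i> * pi * (of_nat k)\<^sup>2 * \<tau> - 2 * \<i> * pi * of_nat k * u) * th \<tau> u"
proof (induction k)
  case (Suc k)
  have "th \<tau> (u + of_nat (Suc k) * \<tau>) = th \<tau> (u + of_nat k * \<tau> + \<tau>)"
    by (simp add: algebra_simps)
  also have "\<dots> = - ((-1) ^ k) * (exp (- \<i> * pi * \<tau> - 2 * \<i> * pi * (u + of_nat k * \<tau>)) *
      exp (- \<i> * pi * (of_nat k)\<^sup>2 * \<tau> - 2 * \<i> * pi * of_nat k * u)) * th \<tau> u"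
    unfolding th_plus_tau Suc by (simp add: mult_ac)
  also have "exp (- \<i> * pi * \<tau> - 2 * \<i> * pi * (u + of_nat k * \<tau>)) *
      exp (- \<i> * pi * (of_nat k)\<^sup>2 * \<tau> - 2 * \<i> * pi * of_nat k * u)
      = exp (- \<i> * pi * (of_nat (Suc k))\<^sup>2 * \<tau> - 2 * \<i> * pi * of_nat (Suc k) * u)"
    by (simp add: exp_add[symmetric] power2_eq_square algebra_simps)
  finally show ?case by simp
qed simp

lemma th_plus_nat: "th \<tau> (u + of_nat k) = (-1) ^ k * th \<tau> u"
proof (induction k)
  case (Suc k)
  show ?case using th_plus_1[of "u + of_nat k"] Suc by (simp add: algebra_simps)
qed simp

lemma th_plus_int: "th \<tau> (u + of_int k) = (-1) powi k * th \<tau> u"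
proof (cases k rule: int_cases2)
  case (nonneg n) then show ?thesis by (simp add: th_plus_nat)
next
  case (nonpos n)
  have "th \<tau> u = (-1) ^ n * th \<tau> (u - of_nat n)" using th_plus_nat[of "u - of_nat n" n] by simp
  then have "(-1) ^ n * th \<tau> u = ((-1) ^ n * (-1) ^ n) * th \<tau> (u - of_nat n)" by simp
  then have "th \<tau> (u - of_nat n) = (-1) ^ n * th \<tau> u"
    by (simp add: power_mult_distrib[symmetric])
  moreover have "(-1 :: complex) powi (- int n) = (-1) ^ n"
    by (cases "even n") (auto simp: power_int_minus)
  ultimately show ?thesis using nonpos by simp
qed

lemma th_zero_iff: "th \<tau> u = 0 \<longleftrightarrow> (\<exists>k l::int. u = of_int k * \<tau> + of_int l)"
proof -
  have "th \<tau> u = 0 \<longleftrightarrow> (\<exists>n::int. exp (2 * \<i> * pi * u) = p_of \<tau> powi n)"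
    by (simp add: th_def Theta_zero_iff norm_p_of_less_1)
  also have "\<dots> \<longleftrightarrow> (\<exists>k l::int. u = of_int k * \<tau> + of_int l)"
  proof -
    have "exp (2 * \<i> * pi * u) = p_of \<tau> powi n \<longleftrightarrow> (\<exists>l::int. u = of_int n * \<tau> + of_int l)" for n
    proof -
      have "p_of \<tau> powi n = exp (2 * \<i> * pi * (of_int n * \<tau>))"
        by (simp add: p_of_def exp_power_int algebra_simps)
      then have "exp (2 * \<i> * pi * u) = p_of \<tau> powi n \<longleftrightarrow>
          (\<exists>l::int. 2 * \<i> * pi * u = 2 * \<i> * pi * (of_int n * \<tau>) + of_int (2 * l) * pi * \<i>)"
        by (simp only: exp_eq)
      also have "\<dots> \<longleftrightarrow> (\<exists>l::int. (2 * \<i> * pi) * u = (2 * \<i> * pi) * (of_int n * \<tau> + of_int l))"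
        by (simp add: algebra_simps)
      finally show ?thesis by simp
    qed
    then show ?thesis by simp
  qed
  finally show ?thesis .
qed

lemma th_0 [simp]: "th \<tau> 0 = 0"
  unfolding th_zero_iff by (rule exI[of _ 0], rule exI[of _ 0]) simp

lemma deriv_th: "(th \<tau> has_field_derivative deriv (th \<tau>) u) (at u)"
  using th_holomorphic by (auto intro: holomorphic_derivI[of _ UNIV])

lemma deriv_th_0: "deriv (th \<tau>) 0 \<noteq> 0"
proof -
  \<comment> \<open>The only factor of the product that vanishes at u = 0 is 1 - exp(2 i pi u);
    \<open>h\<close> collects the others, so the derivative at 0 is -2 i pi h(0).\<close>
  define h where "h u = exp (- \<i> * pi * u) * (qpoch (p_of \<tau> * exp (2 * \<i> * pi * u)) [p_of \<tau>]
    * qpoch (p_of \<tau> * exp (- (2 * \<i> * pi * u))) [p_of \<tau>] * qpoch (p_of \<tau>) [p_of \<tau>])" for u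
  have hol: "h holomorphic_on UNIV" unfolding h_def[abs_def] using norm_p_of_less_1 by (auto intro!: holomorphic_intros)
  have pp: "p_of \<tau> * p_of \<tau> ^ n \<noteq> 1" for n
  proof -
    have "p_of \<tau> * p_of \<tau> ^ n = exp (2 * \<i> * pi * \<tau> * of_nat (Suc n))"
      by (simp add: p_of_def exp_of_nat_mult[symmetric] exp_add[symmetric] algebra_simps)
    moreover have "norm (exp (2 * \<i> * pi * \<tau> * of_nat (Suc n))) < 1"
      using im by (simp add: mult_pos_pos add_pos_nonneg)
    ultimately show ?thesis by force
  qed
  have "h 0 \<noteq> 0" using pp by (auto simp: h_def qpoch_zero_iff norm_p_of_less_1)
  have "th \<tau> = (\<lambda>u. (1 - exp (2 * \<i> * pi * u)) * h u)"
  proof (rule ext)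
    fix u
    have 1: "qpoch (exp (2 * \<i> * pi * u)) [p_of \<tau>]
        = (1 - exp (2 * \<i> * pi * u)) * qpoch (p_of \<tau> * exp (2 * \<i> * pi * u)) [p_of \<tau>]"
      using qpoch_Cons[of "p_of \<tau>" "[]" "exp (2 * \<i> * pi * u)"] norm_p_of_less_1 by (simp add: mult.commute)
    show "th \<tau> u = (1 - exp (2 * \<i> * pi * u)) * h u"
      unfolding th_def Theta_def h_def 1 by (simp add: exp_minus divide_inverse mult_ac)
  qed
  moreover have "((\<lambda>u. (1 - exp (2 * \<i> * pi * u)) * h u) has_field_derivative (- 2 * \<i> * pi * h 0)) (at 0)"
    by (rule derivative_eq_intros holomorphic_derivI[OF hol] refl | simp)+
  ultimately have "deriv (th \<tau>) 0 = - 2 * \<i> * pi * h 0"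
    by (simp add: DERIV_imp_deriv)
  then show ?thesis using \<open>h 0 \<noteq> 0\<close> by simp
qed

text \<open>Differentiating the two quasi-periodicity relations carries the nonzero derivative at 0
  to every lattice point. At a zero the derivative of the multiplier drops out, so only a nonzero
  factor appears.\<close>

lemma deriv_th_zero:
  assumes "th \<tau> u = 0"
  shows "deriv (th \<tau>) u \<noteq> 0"
proof -
  have one: "deriv (th \<tau>) (z + 1) = - deriv (th \<tau>) z" for z
  proof -
    have "((\<lambda>z. th \<tau> (z + 1)) has_field_derivative deriv (th \<tau>) (z + 1)) (at z)"
      by (rule DERIV_shift[THEN iffD1], rule deriv_th)
    moreover have "((\<lambda>z. th \<tau> (z + 1)) has_field_derivative - deriv (th \<tau>) z) (at z)"
      unfolding th_plus_1 by (intro derivative_intros deriv_th)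
    ultimately show ?thesis by (rule DERIV_unique)
  qed
  have tau: "deriv (th \<tau>) (z + \<tau>) = 0 \<longleftrightarrow> deriv (th \<tau>) z = 0" if "th \<tau> z = 0" for z
  proof -
    have "((\<lambda>z. th \<tau> (z + \<tau>)) has_field_derivative deriv (th \<tau>) (z + \<tau>)) (at z)"
      by (rule DERIV_shift[THEN iffD1], rule deriv_th)
    moreover have "((\<lambda>z. th \<tau> (z + \<tau>)) has_field_derivative
        - exp (- \<i> * pi * \<tau> - 2 * \<i> * pi * z) * deriv (th \<tau>) z) (at z)"
      unfolding th_plus_tau using that by (auto intro!: derivative_eq_intros deriv_th)
    ultimately have "deriv (th \<tau>) (z + \<tau>) = - exp (- \<i> * pi * \<tau> - 2 * \<i> * pi * z) * deriv (th \<tau>) z"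
      by (rule DERIV_unique)
    then show ?thesis by simp
  qed
  obtain k l :: int where u: "u = of_int k * \<tau> + of_int l" using assms th_zero_iff by blast
  have z: "th \<tau> (of_int k * \<tau> + of_int l) = 0" for k l :: int using th_zero_iff by blast
  have k: "deriv (th \<tau>) (of_int k * \<tau> + of_int l) \<noteq> 0" if "deriv (th \<tau>) (of_int l) \<noteq> 0" for k l :: int
  proof (induction k rule: int_induct[where k = 0])
    case base then show ?case using that by simp
  next
    case (step1 i) then show ?case using tau[OF z, of i l] by (simp add: algebra_simps)
  next
    case (step2 i) then show ?case using tau[OF z, of "i - 1" l] by (simp add: algebra_simps)
  qed
  have "deriv (th \<tau>) (of_int l) \<noteq> 0" for l :: int
  proof (induction l rule: int_induct[where k = 0])
    case base then show ?case using deriv_th_0 by simp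
  next
    case (step1 i) then show ?case using one[of "of_int i"] by simp
  next
    case (step2 i) then show ?case using one[of "of_int (i - 1)"] by simp
  qed
  then show ?thesis using k u by blast
qed

lemma th_half: "th \<tau> (1/2) \<noteq> 0"
proof
  assume "th \<tau> (1/2) = 0"
  then obtain k l :: int where kl: "(1/2 :: complex) = of_int k * \<tau> + of_int l" using th_zero_iff by blast
  from arg_cong[OF kl, of Im] have "0 = of_int k * Im \<tau>" by simp
  then have "k = 0" using im by simp
  then have "2 * l = 1" using kl by (simp add: complex_eq_iff)
  then show False by presburger
qed

lemma zero_set_translate:
  assumes "\<And>z. f z = 0 \<Longrightarrow> f (z + 1) = 0" "\<And>z. f z = 0 \<Longrightarrow> f (z - 1) = 0"
    and "\<And>z. f z = 0 \<Longrightarrow> f (z + \<tau>) = 0" "\<And>z. f z = 0 \<Longrightarrow> f (z - \<tau>) = 0"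
    and "f z = 0"
  shows "f (z + of_int k * \<tau> + of_int l) = (0::complex)"
proof -
  have k: "f (z + of_int k * \<tau>) = 0"
  proof (induction k rule: int_induct[where k = 0])
    case base then show ?case using assms by simp
  next
    case (step1 i) then show ?case using assms(3)[OF step1(2)] by (simp add: algebra_simps)
  next
    case (step2 i) then show ?case using assms(4)[OF step2(2)] by (simp add: algebra_simps)
  qed
  show ?thesis
  proof (induction l rule: int_induct[where k = 0])
    case base then show ?case using k by simp
  next
    case (step1 i) then show ?case using assms(1)[OF step1(2)] by (simp add: algebra_simps)
  next
    case (step2 i) then show ?case using assms(2)[OF step2(2)] by (simp add: algebra_simps)
  qed
qed

text \<open>Theta functions of order one are unique up to a constant: subtracting a multiple of
  \<^const>\<open>th\<close> one creates a zero at \<open>1/2\<close>, and the quotient by \<^const>\<open>th\<close> translated by \<open>1/2\<close> is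
  then a constant with the multiplier \<open>-1\<close>.\<close>
lemma th_unique:
  assumes hol: "H holomorphic_on UNIV" and H1: "\<And>v. H (v + 1) = - H v"
    and Ht: "\<And>v. H (v + \<tau>) = - exp (- \<i> * pi * \<tau> - 2 * \<i> * pi * (v + w)) * H v"
  shows "\<exists>C. \<forall>v. H v = C * th \<tau> (v + w)"
proof -
  define D where "D v = H (v - w) - (H (1/2 - w) / th \<tau> (1/2)) * th \<tau> v" for v
  have Dhol: "D holomorphic_on UNIV"
    using holomorphic_compose_affine[OF hol, of 1 "- w"] th_holomorphic
    unfolding D_def[abs_def] by (auto intro!: holomorphic_intros)
  have D1: "D (v + 1) = - D v" for v
    unfolding D_def diff_add_eq[symmetric] H1 th_plus_1
    by (simp add: algebra_simps)
  have Dt: "D (v + \<tau>) = - exp (- \<i> * pi * \<tau> - 2 * \<i> * pi * v) * D v" for v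
    unfolding D_def diff_add_eq[symmetric] Ht th_plus_tau
    by (simp add: algebra_simps)
  have D0: "D (1/2) = 0" using th_half by (simp add: D_def)
  have Dz: "D (1/2 + of_int k * \<tau> + of_int l) = 0" for k l
  proof (rule zero_set_translate[where f = D])
    show "D (1/2) = 0" by (rule D0)
    fix z assume z: "D z = 0"
    show "D (z + 1) = 0" "D (z + \<tau>) = 0" using z by (auto simp: D1 Dt)
    show "D (z - 1) = 0" "D (z - \<tau>) = 0" using D1[of "z - 1"] Dt[of "z - \<tau>"] z by auto
  qed
  define g where "g v = th \<tau> (v - 1/2)" for v
  have gd: "(g has_field_derivative deriv (th \<tau>) (v - 1/2)) (at v)" for v
    unfolding g_def[abs_def] by (rule DERIV_chain'[OF _ deriv_th, THEN DERIV_cong]) (auto intro!: derivative_eq_intros)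
  obtain h where h: "h holomorphic_on UNIV" "\<And>v. D v = g v * h v"
  proof (rule entire_divide_simple_zeros[OF Dhol, of g])
    show "g holomorphic_on UNIV" using gd by (auto simp: holomorphic_on_open)
    fix v assume "g v = 0"
    then have "th \<tau> (v - 1/2) = 0" by (simp add: g_def)
    then obtain k l :: int where "v - 1/2 = of_int k * \<tau> + of_int l" using th_zero_iff by blast
    then have "v = 1/2 + of_int k * \<tau> + of_int l" by (simp add: algebra_simps)
    then have "D v = 0" using Dz by blast
    moreover have "deriv g v \<noteq> 0"
      using deriv_th_zero[OF \<open>th \<tau> (v - 1/2) = 0\<close>] DERIV_imp_deriv[OF gd] by simp
    ultimately show "D v = 0 \<and> deriv g v \<noteq> 0" by blast
  next
    fix h assume "h holomorphic_on UNIV" "\<And>v. D v = g v * h v"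
    then show thesis by (rule that)
  qed
  have g1: "g (v + 1) = - g v" for v using th_plus_1[of "v - 1/2"] by (simp add: g_def algebra_simps)
  \<comment> \<open>The translation by 1/2 changes the sign of the multiplier for \<tau>, because
    exp(i pi) = -1. The quotient \<open>h\<close> inherits this sign, and a constant equal to its
    own negative is 0.\<close>
  have gt: "g (v + \<tau>) = exp (- \<i> * pi * \<tau> - 2 * \<i> * pi * v) * g v" for v
  proof -
    have "- \<i> * pi * \<tau> - 2 * \<i> * pi * (v - 1/2) = (- \<i> * pi * \<tau> - 2 * \<i> * pi * v) + \<i> * pi"
      by (simp add: algebra_simps)
    then have "exp (- \<i> * pi * \<tau> - 2 * \<i> * pi * (v - 1/2)) = - exp (- \<i> * pi * \<tau> - 2 * \<i> * pi * v)"
      by (simp only: exp_add exp_pi_i') simp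
    then show ?thesis using th_plus_tau[of "v - 1/2"] by (simp add: g_def algebra_simps)
  qed
  have gh: "g holomorphic_on UNIV" "g 1 \<noteq> 0"
    using gd th_half by (auto simp: holomorphic_on_open g_def)
  have hs: "(\<lambda>v. h (v + c)) holomorphic_on UNIV" for c
    using holomorphic_compose_affine[OF h(1), of 1 c] by simp
  have h1: "h (v + 1) = h v" for v
  proof (rule entire_cancel[OF hs h(1) gh])
    show "g v * h (v + 1) = g v * h v" for v using D1[of v] by (simp add: h(2) g1)
  qed
  have ht: "h (v + \<tau>) = - h v" for v
  proof (rule entire_cancel[OF hs _ gh])
    show "(\<lambda>v. - h v) holomorphic_on UNIV" using h(1) by (auto intro!: holomorphic_intros)
    show "g v * h (v + \<tau>) = g v * - h v" for v
    proof -
      define E where "E = exp (- \<i> * pi * \<tau> - 2 * \<i> * pi * v)"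
      have "E * (g v * h (v + \<tau>)) = E * (g v * - h v)"
        using Dt[of v] unfolding h(2) gt E_def[symmetric] by (simp add: mult_ac)
      moreover have "E \<noteq> 0" by (simp add: E_def)
      ultimately show ?thesis using mult_left_cancel by blast
    qed
  qed
  obtain c where c: "\<And>v. h v = c"
    by (rule entire_doubly_periodic_norm_const[OF h(1) im]) (auto simp: h1 ht)
  then have "c = 0" using ht[of 0] by simp
  then have "D v = 0" for v by (simp add: h(2) c)
  then have "H v = (H (1/2 - w) / th \<tau> (1/2)) * th \<tau> (v + w)" for v
    using D_def[of "v + w"] by simp
  then show ?thesis by (intro exI[of _ "H (1/2 - w) / th \<tau> (1/2)"] allI)
qed

text \<open>The shift by 1/2 + \<tau>/2 moves the zero of the series to the origin, and the factor
  exp(i pi u) gives it the multipliers of \<open>th\<close>; uniqueness then applies with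
  \<open>w = 0\<close>. The constant is nonzero because the series is not identically zero.\<close>

lemma theta_series_th:
  "\<exists>C. C \<noteq> 0 \<and> (\<forall>u. theta_series \<tau> (u + 1/2 + \<tau>/2) = C * exp (- \<i> * pi * u) * th \<tau> u)"
proof -
  define H where "H u = exp (\<i> * pi * u) * theta_series \<tau> (u + 1/2 + \<tau>/2)" for u
  have hol: "H holomorphic_on UNIV"
  proof -
    have "(theta_series \<tau> \<circ> (\<lambda>u. u + 1/2 + \<tau>/2)) holomorphic_on UNIV"
      by (rule holomorphic_on_compose)
        (auto intro!: holomorphic_intros holomorphic_on_subset[OF theta_series_holomorphic[OF im]])
    then show ?thesis unfolding H_def[abs_def] o_def by (auto intro!: holomorphic_intros)
  qed
  have H1: "H (v + 1) = - H v" for v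
    using theta_series_plus_1[of \<tau> "v + 1/2 + \<tau>/2"]
    by (simp add: H_def exp_add algebra_simps)
  have Ht: "H (v + \<tau>) = - exp (- \<i> * pi * \<tau> - 2 * \<i> * pi * (v + 0)) * H v" for v
  proof -
    have "H (v + \<tau>) = exp (\<i> * pi * (v + \<tau>)) * theta_series \<tau> ((v + 1/2 + \<tau>/2) + \<tau>)"
      by (simp add: H_def algebra_simps)
    also have "\<dots> = (exp (\<i> * pi * (v + \<tau>)) * exp (- \<i> * pi * \<tau> - 2 * \<i> * pi * (v + 1/2 + \<tau>/2)))
        * theta_series \<tau> (v + 1/2 + \<tau>/2)" by (simp only: theta_series_plus_tau mult.assoc)
    also have "exp (\<i> * pi * (v + \<tau>)) * exp (- \<i> * pi * \<tau> - 2 * \<i> * pi * (v + 1/2 + \<tau>/2))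
        = exp (- \<i> * pi * \<tau> - 2 * \<i> * pi * v) * exp (\<i> * pi * v) * exp (- (\<i> * pi))"
      unfolding exp_add[symmetric] by (rule arg_cong[of _ _ exp]) (simp add: field_simps)
    also have "exp (- (\<i> * pi)) = -1" by (simp add: exp_minus)
    finally show ?thesis by (simp add: H_def)
  qed
  obtain C where C: "\<forall>v. H v = C * th \<tau> (v + 0)" using th_unique[OF hol H1 Ht] by (elim exE)
  have eq: "theta_series \<tau> (u + 1/2 + \<tau>/2) = C * exp (- \<i> * pi * u) * th \<tau> u" for u
  proof -
    have "theta_series \<tau> (u + 1/2 + \<tau>/2) = exp (- \<i> * pi * u) * H u"
      by (simp add: H_def mult.assoc[symmetric] exp_add[symmetric])
    then show ?thesis using C by simp
  qed
  have "C \<noteq> 0"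
  proof
    assume "C = 0"
    then have "theta_series \<tau> u = 0" for u using eq[of "u - 1/2 - \<tau>/2"] by simp
    then show False using theta_series_nontrivial[OF im] by metis
  qed
  then show ?thesis by (intro exI[of _ C] conjI allI eq)
qed

text \<open>Characteristics amount to a translation of the argument and an exponential factor. It
  matters that \<open>C\<close> does not depend on the characteristics or on \<xi>, since only
  quotients of such functions occur in the R-matrix.\<close>

lemma jtheta_th:
  "\<exists>C. C \<noteq> 0 \<and> (\<forall>(a1::real) (a2::real) (\<xi>::complex). jtheta (1/2 + a1) (1/2 + a2) \<xi> \<tau>
    = C * exp (\<i> * pi * a1\<^sup>2 * \<tau> + 2 * \<i> * pi * a1 * (\<xi> + 1/2 + a2)) * th \<tau> (\<xi> + a1 * \<tau> + a2))"
proof -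
  obtain C where C: "C \<noteq> 0" "\<forall>u. theta_series \<tau> (u + 1/2 + \<tau>/2) = C * exp (- \<i> * pi * u) * th \<tau> u"
    using theta_series_th by (elim exE conjE)
  define C' where "C' = C * exp (\<i> * pi / 4 * \<tau> + \<i> * pi / 2)"
  have eq: "jtheta (1/2 + a1) (1/2 + a2) \<xi> \<tau>
    = C' * exp (\<i> * pi * a1\<^sup>2 * \<tau> + 2 * \<i> * pi * a1 * (\<xi> + 1/2 + a2)) * th \<tau> (\<xi> + a1 * \<tau> + a2)" for a1 a2 :: real and \<xi> :: complex
  proof -
    define w where "w = \<xi> + a1 * \<tau> + a2"
    define E where "E = exp (\<i> * pi * (1/2 + a1)\<^sup>2 * \<tau> + 2 * \<i> * pi * (1/2 + a1) * (\<xi> + (1/2 + a2)))"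
    have "jtheta (1/2 + a1) (1/2 + a2) \<xi> \<tau> = (\<Sum>\<^sub>\<infinity>m::int. E * theta_term \<tau> m (w + 1/2 + \<tau>/2))"
      unfolding jtheta_def
    proof (rule infsum_cong, goal_cases)
      case (1 m)
      show ?case
        unfolding E_def theta_term_def w_def exp_add[symmetric]
        by (rule arg_cong[of _ _ exp]) (simp add: field_simps power2_eq_square)
    qed
    also have "\<dots> = E * (C * exp (- \<i> * pi * w) * th \<tau> w)"
      by (simp only: infsum_cmult_right' theta_series_def[symmetric] C(2)[rule_format])
    also have "\<dots> = C * (E * exp (- \<i> * pi * w)) * th \<tau> w" by simp
    also have "E * exp (- \<i> * pi * w) = exp (\<i> * pi / 4 * \<tau> + \<i> * pi / 2) *
       exp (\<i> * pi * a1\<^sup>2 * \<tau> + 2 * \<i> * pi * a1 * (\<xi> + 1/2 + a2))"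
      unfolding E_def w_def exp_add[symmetric]
      by (rule arg_cong[of _ _ exp]) (simp add: field_simps power2_eq_square)
    finally show ?thesis by (simp only: C'_def w_def mult.assoc)
  qed
  have "C' \<noteq> 0" using C by (simp add: C'_def)
  then show ?thesis by (intro exI[of _ C'] conjI allI eq)
qed

end

section \<open>Fourier transforms of theta quotients\<close>

lemma to_int_mod_ring_add:
  "to_int_mod_ring (a + b) = (to_int_mod_ring a + to_int_mod_ring b) mod int CARD('n)"
  for a b :: "'n::nontriv mod_ring"
  by transfer simp

lemma to_int_mod_ring_uminus:
  "to_int_mod_ring (- a) = (if a = 0 then 0 else int CARD('n) - to_int_mod_ring a)"
  for a :: "'n::nontriv mod_ring"
  by transfer auto

lemma to_int_mod_ring_of_int: "to_int_mod_ring (of_int k :: 'n::nontriv mod_ring) = k mod int CARD('n)"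
  by transfer simp

lemma of_int_to_int_mod_ring [simp]: "of_int (to_int_mod_ring a) = a" for a :: "'n::nontriv mod_ring"
  by (simp add: of_int_of_int_mod_ring)

definition chi :: "'n::nontriv mod_ring \<Rightarrow> complex" where
  "chi a = exp (2 * \<i> * pi * (of_int (to_int_mod_ring a) / of_nat CARD('n)))"

lemma exp_mod_card:
  "exp (2 * \<i> * pi * (of_int (k mod int CARD('n::nontriv)) / of_nat CARD('n))) =
   exp (2 * \<i> * pi * (of_int k / of_nat CARD('n)))"
proof -
  have "of_int k = (of_nat CARD('n) * of_int (k div int CARD('n)) + of_int (k mod int CARD('n)) :: complex)"
    by (metis mult_div_mod_eq of_int_add of_int_mult of_int_of_nat_eq)
  then have "2 * \<i> * pi * (of_int k / of_nat CARD('n)) =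
      2 * \<i> * pi * (of_int (k mod int CARD('n)) / of_nat CARD('n)) + 2 * \<i> * pi * of_int (k div int CARD('n))"
    by (simp add: field_simps)
  then show ?thesis by (simp only: exp_add_2pi_int)
qed

lemma chi_add: "chi (a + b) = chi a * chi b" for a b :: "'n::nontriv mod_ring"
proof -
  have "chi (a + b) = exp (2 * \<i> * pi * (of_int (to_int_mod_ring a + to_int_mod_ring b) / of_nat CARD('n)))"
    by (simp only: chi_def to_int_mod_ring_add exp_mod_card)
  also have "\<dots> = exp (2 * \<i> * pi * (of_int (to_int_mod_ring a) / of_nat CARD('n))
      + 2 * \<i> * pi * (of_int (to_int_mod_ring b) / of_nat CARD('n)))"
    by (rule arg_cong[of _ _ exp]) (simp add: field_simps)
  finally show ?thesis by (simp only: chi_def exp_add)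
qed

lemma chi_0 [simp]: "chi 0 = 1"
  by (simp add: chi_def)

lemma norm_chi [simp]: "norm (chi a) = 1"
  by (simp add: chi_def)

lemma chi_nonzero [simp]: "chi a \<noteq> 0"
  by (simp add: chi_def)

lemma chi_minus_mult: "chi (- a) * chi a = 1" "chi a * chi (- a) = 1"
  using chi_add[of a "- a"] chi_add[of "- a" a] by auto

lemma chi_minus: "chi (- a) = 1 / chi a"
  using chi_minus_mult(1)[of a] by (simp add: field_simps)

lemma chi_eq_1_iff: "chi a = 1 \<longleftrightarrow> a = 0" for a :: "'n::nontriv mod_ring"
proof
  assume "chi a = 1"
  then obtain n :: int where
    "2 * \<i> * pi * (of_int (to_int_mod_ring a) / of_nat CARD('n)) = of_int (2 * n) * pi * \<i>"
    unfolding chi_def exp_eq_1 by (auto simp: complex_eq_iff)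
  then have "(2 * \<i> * pi) * of_int (to_int_mod_ring a) = (2 * \<i> * pi) * (of_int n * of_nat CARD('n) :: complex)"
    by (simp add: field_simps)
  then have "of_int (to_int_mod_ring a) = (of_int (n * int CARD('n)) :: complex)" by simp
  then have "to_int_mod_ring a = n * int CARD('n)" by (simp only: of_int_eq_iff)
  then have "a = of_int (n * int CARD('n))" by (metis of_int_to_int_mod_ring)
  then show "a = 0" by simp
qed simp

lemma sum_chi:
  "(\<Sum>a\<in>UNIV. chi (a * b :: 'n::nontriv mod_ring)) = (if b = 0 then of_nat CARD('n) else 0)"
proof (cases "b = 0")
  case False
  let ?S = "\<Sum>a\<in>UNIV. chi (a * b)"
  have "?S = (\<Sum>a\<in>UNIV. chi ((a + 1) * b))"
    by (rule sum.reindex_bij_witness[of _ "\<lambda>a. a + 1" "\<lambda>a. a - 1"]) auto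
  also have "\<dots> = ?S * chi b"
    by (simp add: distrib_right chi_add sum_distrib_right)
  finally show ?thesis using False chi_eq_1_iff[of b] by simp
qed simp

type_synonym 'n zn2 = "'n mod_ring \<times> 'n mod_ring"

text \<open>This is the commutation phase: I_\<alpha> I_\<beta> equals
  \<open>br \<alpha> \<beta>\<close> times I_\<beta> I_\<alpha>. The same pairing is used as the
  kernel of the finite Fourier transform, which is why translations of u act on transforms by
  translations of the index.\<close>

definition br :: "'n::nontriv zn2 \<Rightarrow> 'n zn2 \<Rightarrow> complex" where
  "br \<alpha> \<beta> = chi (fst \<alpha> * snd \<beta> - snd \<alpha> * fst \<beta>)"

lemma br_add: "br (\<alpha> + \<alpha>') \<beta> = br \<alpha> \<beta> * br \<alpha>' \<beta>" "br \<alpha> (\<beta> + \<beta>') = br \<alpha> \<beta> * br \<alpha> \<beta>'"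
  by (simp_all add: br_def chi_add[symmetric] algebra_simps)

lemma br_self [simp]: "br \<alpha> \<alpha> = 1" "br \<alpha> 0 = 1" "br 0 \<alpha> = 1"
  by (simp_all add: br_def mult.commute)

lemma br_diff: "br (\<gamma> - \<alpha>) \<beta> * br \<alpha> \<beta> = br \<gamma> \<beta>"
  using br_add(1)[of "\<gamma> - \<alpha>" \<alpha> \<beta>] by simp

lemma sum_br:
  "(\<Sum>\<alpha>\<in>UNIV. br \<alpha> (\<beta> :: 'n::nontriv zn2)) = (if \<beta> = 0 then (of_nat CARD('n))\<^sup>2 else 0)"
  "(\<Sum>\<alpha>\<in>UNIV. br \<beta> \<alpha>) = (if \<beta> = 0 then (of_nat CARD('n))\<^sup>2 else 0)"
proof -
  have 1: "(\<Sum>\<alpha>\<in>UNIV. chi (fst \<alpha> * a + snd \<alpha> * b)) = (if a = 0 \<and> b = 0 then (of_nat CARD('n))\<^sup>2 else 0)"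
    for a b :: "'n mod_ring"
  proof -
    have "(\<Sum>\<alpha>\<in>UNIV. chi (fst \<alpha> * a + snd \<alpha> * b)) = (\<Sum>x\<in>UNIV. \<Sum>y\<in>UNIV. chi (x * a) * chi (y * b))"
      unfolding UNIV_Times_UNIV[symmetric]
      by (subst sum.cartesian_product) (simp add: case_prod_unfold chi_add)
    also have "\<dots> = (\<Sum>x\<in>UNIV. chi (x * a)) * (\<Sum>y\<in>UNIV. chi (y * b))"
      by (simp only: sum_product)
    finally show ?thesis by (simp add: sum_chi power2_eq_square)
  qed
  show "(\<Sum>\<alpha>\<in>UNIV. br \<alpha> \<beta>) = (if \<beta> = 0 then (of_nat CARD('n))\<^sup>2 else 0)"
    using 1[of "snd \<beta>" "- fst \<beta>"] by (simp add: br_def prod_eq_iff conj_commute)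
  show "(\<Sum>\<alpha>\<in>UNIV. br \<beta> \<alpha>) = (if \<beta> = 0 then (of_nat CARD('n))\<^sup>2 else 0)"
    using 1[of "- snd \<beta>" "fst \<beta>"] by (simp add: br_def prod_eq_iff conj_commute mult.commute)
qed

text \<open>A representative of an N-torsion point of the elliptic curve with periods 1 and \<tau>.
  The dependence on the representative is compensated by the exponential in
  \<open>phi\<close>.\<close>

definition tors :: "complex \<Rightarrow> 'n::nontriv zn2 \<Rightarrow> complex" where
  "tors \<tau> \<alpha> = (of_int (to_int_mod_ring (fst \<alpha>)) * \<tau> + of_int (to_int_mod_ring (snd \<alpha>))) / of_nat CARD('n)"

text \<open>Up to the factor \<open>1 / N\<close>, this is \<^const>\<open>Wfun\<close> at \<open>\<zeta> = N * y\<close>.\<close>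
definition phi :: "complex \<Rightarrow> 'n::nontriv zn2 \<Rightarrow> complex \<Rightarrow> complex \<Rightarrow> complex" where
  "phi \<tau> \<alpha> u y = exp (2 * \<i> * pi * (of_int (to_int_mod_ring (fst \<alpha>)) / of_nat CARD('n)) * u)
     * th \<tau> (u + y + tors \<tau> \<alpha>) / th \<tau> (y + tors \<tau> \<alpha>)"

text \<open>It says that y is not an N-torsion point modulo the lattice. Quantifying over all
  integers, instead of representatives modulo N, makes the symmetry y to -y immediate.\<close>

definition regular_at :: "nat \<Rightarrow> complex \<Rightarrow> complex \<Rightarrow> bool" where
  "regular_at N \<tau> y \<longleftrightarrow> (\<forall>k l :: int. th \<tau> (y + (of_int k * \<tau> + of_int l) / of_nat N) \<noteq> 0)"

definition gsum :: "complex \<Rightarrow> 'n::nontriv zn2 \<Rightarrow> complex \<Rightarrow> complex \<Rightarrow> complex" where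
  "gsum \<tau> \<beta> u y = (\<Sum>\<alpha>\<in>UNIV. br \<alpha> \<beta> * phi \<tau> \<alpha> u y)"

section \<open>Quasi-periodicity of the theta quotients and of their Fourier sums\<close>

context
  fixes \<tau> :: complex
  assumes im: "Im \<tau> > 0"
begin

lemma holomorphic_th [holomorphic_intros]:
  assumes "f holomorphic_on A"
  shows "(\<lambda>z. th \<tau> (f z)) holomorphic_on A"
  using holomorphic_on_compose_gen[OF assms th_holomorphic[OF im]] by (simp add: o_def)

lemma holomorphic_phi [holomorphic_intros]:
  assumes "f holomorphic_on A"
  shows "(\<lambda>z. phi \<tau> \<alpha> (f z) y) holomorphic_on A"
proof -
  have "(\<lambda>z. exp (2 * \<i> * pi * (of_int (to_int_mod_ring (fst \<alpha>)) / of_nat CARD('a)) * f z)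
     * th \<tau> (f z + y + tors \<tau> \<alpha>) * inverse (th \<tau> (y + tors \<tau> \<alpha>))) holomorphic_on A"
    by (intro holomorphic_intros assms)
  then show ?thesis by (simp add: phi_def divide_inverse)
qed

lemma regular_tors:
  assumes "regular_at CARD('n::nontriv) \<tau> y"
  shows "th \<tau> (y + tors \<tau> (\<alpha> :: 'n zn2)) \<noteq> 0"
  using assms by (auto simp: regular_at_def tors_def)

lemma regular_minus:
  assumes "regular_at N \<tau> y"
  shows "regular_at N \<tau> (- y)"
  unfolding regular_at_def
proof (intro allI)
  fix k l :: int
  have "th \<tau> (- (y + (of_int (- k) * \<tau> + of_int (- l)) / of_nat N)) \<noteq> 0"
    unfolding th_minus[OF im] neg_equal_0_iff_equal using assms unfolding regular_at_def by blast
  also have "- (y + (of_int (- k) * \<tau> + of_int (- l)) / of_nat N) = - y + (of_int k * \<tau> + of_int l) / of_nat N"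
    by (simp add: diff_divide_distrib add_divide_distrib)
  finally show "th \<tau> (- y + (of_int k * \<tau> + of_int l) / of_nat N) \<noteq> 0" .
qed

lemma regular_multiple:
  assumes "regular_at N \<tau> y" "N > 0"
  shows "th \<tau> (of_nat N * y) \<noteq> 0"
proof
  assume "th \<tau> (of_nat N * y) = 0"
  then obtain k l :: int where "of_nat N * y = of_int k * \<tau> + of_int l"
    using th_zero_iff[OF im] by blast
  then have "y = (of_int k * \<tau> + of_int l) / of_nat N" using assms by (simp add: field_simps)
  then have "y + (of_int (- k) * \<tau> + of_int (- l)) / of_nat N = 0"
    by (simp add: diff_divide_distrib add_divide_distrib)
  then show False using assms(1) th_0[OF im] by (metis regular_at_def)
qed

lemma phi_0:
  assumes "regular_at CARD('n::nontriv) \<tau> y"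
  shows "phi \<tau> (\<alpha> :: 'n zn2) 0 y = 1"
  using regular_tors[OF assms, of \<alpha>] by (simp add: phi_def)

lemma phi_plus_1: "phi \<tau> \<alpha> (u + 1) y = - chi (fst \<alpha>) * phi \<tau> \<alpha> u y" for \<alpha> :: "'n::nontriv zn2"
proof -
  have "th \<tau> (u + 1 + y + tors \<tau> \<alpha>) = - th \<tau> (u + y + tors \<tau> \<alpha>)"
    using th_plus_1[OF im, of "u + y + tors \<tau> \<alpha>"] by (simp add: algebra_simps)
  moreover have "exp (2 * \<i> * pi * (of_int (to_int_mod_ring (fst \<alpha>)) / of_nat CARD('n)) * (u + 1))
      = exp (2 * \<i> * pi * (of_int (to_int_mod_ring (fst \<alpha>)) / of_nat CARD('n)) * u) * chi (fst \<alpha>)"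
    unfolding chi_def exp_add[symmetric] by (rule arg_cong[of _ _ exp]) (simp add: field_simps)
  ultimately show ?thesis by (simp only: phi_def) simp
qed

lemma phi_plus_tau:
  "phi \<tau> \<alpha> (u + \<tau>) y = - exp (- \<i> * pi * \<tau> - 2 * \<i> * pi * (u + y)) * chi (- snd \<alpha>) * phi \<tau> \<alpha> u y"
  for \<alpha> :: "'n::nontriv zn2"
proof -
  have "th \<tau> (u + \<tau> + y + tors \<tau> \<alpha>)
      = - exp (- \<i> * pi * \<tau> - 2 * \<i> * pi * (u + y + tors \<tau> \<alpha>)) * th \<tau> (u + y + tors \<tau> \<alpha>)"
    using th_plus_tau[OF im, of "u + y + tors \<tau> \<alpha>"] by (simp add: algebra_simps)
  moreover have "chi (- snd \<alpha>) = exp (- (2 * \<i> * pi * (of_int (to_int_mod_ring (snd \<alpha>)) / of_nat CARD('n))))"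
    unfolding chi_minus by (simp only: chi_def exp_minus inverse_eq_divide)
  moreover have "exp (2 * \<i> * pi * (of_int (to_int_mod_ring (fst \<alpha>)) / of_nat CARD('n)) * (u + \<tau>))
      * exp (- \<i> * pi * \<tau> - 2 * \<i> * pi * (u + y + tors \<tau> \<alpha>))
      = exp (- \<i> * pi * \<tau> - 2 * \<i> * pi * (u + y))
      * exp (- (2 * \<i> * pi * (of_int (to_int_mod_ring (snd \<alpha>)) / of_nat CARD('n))))
      * exp (2 * \<i> * pi * (of_int (to_int_mod_ring (fst \<alpha>)) / of_nat CARD('n)) * u)"
    unfolding exp_add[symmetric] tors_def
    by (rule arg_cong[of _ _ exp]) (simp add: algebra_simps add_divide_distrib)
  ultimately show ?thesis by (simp only: phi_def) simp
qed

lemma phi_minus: "phi \<tau> (- \<alpha>) (- u) y = phi \<tau> \<alpha> u (- y)" for \<alpha> :: "'n::nontriv zn2"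
proof -
  define N where "N = of_nat CARD('n) * (1 :: complex)"
  have N: "N \<noteq> 0" by (simp add: N_def)
  \<comment> \<open>The representative of \<open>- \<alpha>\<close> is N - k, not -k. Extending the
    expression to all integers k, l and showing that it has period N in each makes the naive sign
    change legitimate.\<close>
  define F where "F k l = exp (2 * \<i> * pi * (of_int k / N) * (- u)) * th \<tau> (- u + y + (of_int k * \<tau> + of_int l) / N)
     / th \<tau> (y + (of_int k * \<tau> + of_int l) / N)" for k l :: int
  have F1: "F (k + int CARD('n)) l = F k l" for k l
  proof -
    have w: "(of_int (k + int CARD('n)) * \<tau> + of_int l) / N = (of_int k * \<tau> + of_int l) / N + \<tau>"
      using N by (simp add: field_simps N_def)
    have e: "exp (2 * \<i> * pi * (of_int (k + int CARD('n)) / N) * (- u))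
       = exp (2 * \<i> * pi * (of_int k / N) * (- u)) * exp (- (2 * \<i> * pi * u))"
      unfolding exp_add[symmetric] using N by (intro arg_cong[of _ _ exp]) (simp add: field_simps N_def)
    define w0 where "w0 = (of_int k * \<tau> + of_int l) / N"
    have e2: "exp (- \<i> * pi * \<tau> - 2 * \<i> * pi * (- u + y + w0))
       = exp (2 * \<i> * pi * u) * exp (- \<i> * pi * \<tau> - 2 * \<i> * pi * (y + w0))"
      unfolding exp_add[symmetric] by (intro arg_cong[of _ _ exp]) (simp add: algebra_simps)
    have "F (k + int CARD('n)) l = exp (2 * \<i> * pi * (of_int k / N) * (- u)) * exp (- (2 * \<i> * pi * u)) *
       th \<tau> (- u + y + w0 + \<tau>) / th \<tau> (y + w0 + \<tau>)"
      unfolding F_def w e w0_def by (simp add: add.assoc)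
    also have "\<dots> = F k l"
      unfolding th_plus_tau[OF im] e2 F_def w0_def[symmetric] by (simp add: exp_minus field_simps)
    finally show ?thesis .
  qed
  have F2: "F k (l + int CARD('n)) = F k l" for k l
  proof -
    have w: "(of_int k * \<tau> + of_int (l + int CARD('n))) / N = (of_int k * \<tau> + of_int l) / N + 1"
      using N by (simp add: field_simps N_def)
    show ?thesis unfolding F_def w by (simp only: add.assoc[symmetric] th_plus_1[OF im]) simp
  qed
  define k l where "k = to_int_mod_ring (fst \<alpha>)" and "l = to_int_mod_ring (snd \<alpha>)"
  have "phi \<tau> (- \<alpha>) (- u) y = F (to_int_mod_ring (- fst \<alpha>)) (to_int_mod_ring (- snd \<alpha>))"
    by (simp add: phi_def tors_def F_def N_def)
  also have "\<dots> = F (- k) (to_int_mod_ring (- snd \<alpha>))"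
    using F1[of "- k"] by (simp add: to_int_mod_ring_uminus k_def)
  also have "\<dots> = F (- k) (- l)"
    using F2[of "- k" "- l"] by (simp add: to_int_mod_ring_uminus l_def)
  also have "\<dots> = phi \<tau> \<alpha> u (- y)"
  proof -
    have 1: "- u + y + (of_int (- k) * \<tau> + of_int (- l)) / N = - (u + - y + tors \<tau> \<alpha>)"
      and 2: "y + (of_int (- k) * \<tau> + of_int (- l)) / N = - (- y + tors \<tau> \<alpha>)"
      by (simp_all add: tors_def N_def k_def l_def diff_divide_distrib add_divide_distrib)
    show ?thesis
      unfolding F_def 1 2 th_minus[OF im] phi_def by (simp add: N_def k_def)
  qed
  finally show ?thesis .
qed

lemma holomorphic_gsum [holomorphic_intros]:
  assumes "f holomorphic_on A"
  shows "(\<lambda>z. gsum \<tau> \<beta> (f z) y) holomorphic_on A"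
  unfolding gsum_def by (intro holomorphic_intros assms)

text \<open>The phase \<open>chi (fst \<alpha>)\<close> produced by the shift is
  \<open>br \<alpha> (0, 1)\<close>, so it is absorbed into the index \<beta>. The shift by \<tau>
  likewise yields \<open>br \<alpha> (1, 0)\<close>.\<close>

lemma gsum_plus_1: "gsum \<tau> \<beta> (u + 1) y = - gsum \<tau> (\<beta> + (0, 1)) u y"
  by (simp add: gsum_def phi_plus_1 br_add sum_negf mult_ac) (simp add: br_def)

lemma gsum_plus_tau:
  "gsum \<tau> \<beta> (u + \<tau>) y = - exp (- \<i> * pi * \<tau> - 2 * \<i> * pi * (u + y)) * gsum \<tau> (\<beta> + (1, 0)) u y"
proof -
  define E where "E = - exp (- \<i> * pi * \<tau> - 2 * \<i> * pi * (u + y))"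
  have "br \<alpha> (1, 0) = chi (- snd \<alpha>)" for \<alpha> :: "'a zn2" by (simp add: br_def)
  then show ?thesis
    unfolding gsum_def phi_plus_tau E_def[symmetric] br_add sum_distrib_left
    by (simp add: mult_ac)
qed

lemma gsum_0:
  assumes "regular_at CARD('n::nontriv) \<tau> y"
  shows "gsum \<tau> (\<beta> :: 'n zn2) 0 y = (if \<beta> = 0 then (of_nat CARD('n))\<^sup>2 else 0)"
  using assms by (simp add: gsum_def phi_0 sum_br)

text \<open>A lattice translation moves the question to u = 0 with a translated index. There every
  \<open>phi\<close> equals 1 and the sum is a plain character sum.\<close>

lemma gsum_lattice:
  assumes "regular_at CARD('n::nontriv) \<tau> y"
  shows "gsum \<tau> (\<beta> :: 'n zn2) (of_int k * \<tau> + of_int l) y = 0 \<longleftrightarrow> \<beta> + (of_int k, of_int l) \<noteq> 0"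
proof -
  have 1: "gsum \<tau> \<beta> (z + of_int k * \<tau>) y = 0 \<longleftrightarrow> gsum \<tau> (\<beta> + (of_int k, 0)) z y = 0" for z k and \<beta> :: "'n zn2"
  proof (induction k arbitrary: \<beta> rule: int_induct[where k = 0])
    case base then show ?case by (simp add: zero_prod_def[symmetric])
  next
    case (step1 i)
    have "gsum \<tau> \<beta> (z + of_int (i + 1) * \<tau>) y = 0 \<longleftrightarrow> gsum \<tau> (\<beta> + (1, 0)) (z + of_int i * \<tau>) y = 0"
      using gsum_plus_tau[of \<beta> "z + of_int i * \<tau>" y] by (simp add: algebra_simps)
    also have "\<dots> \<longleftrightarrow> gsum \<tau> (\<beta> + (1, 0) + (of_int i, 0)) z y = 0" by (rule step1)
    also have "\<beta> + (1, 0) + (of_int i, 0) = \<beta> + (of_int (i + 1), 0)" by (simp add: prod_eq_iff)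
    finally show ?case .
  next
    case (step2 i)
    have "gsum \<tau> (\<beta> - (1, 0)) (z + of_int (i - 1) * \<tau> + \<tau>) y = 0 \<longleftrightarrow> gsum \<tau> \<beta> (z + of_int (i - 1) * \<tau>) y = 0"
      unfolding gsum_plus_tau by simp
    moreover have "z + of_int (i - 1) * \<tau> + \<tau> = z + of_int i * \<tau>" by (simp add: algebra_simps)
    ultimately have "gsum \<tau> \<beta> (z + of_int (i - 1) * \<tau>) y = 0 \<longleftrightarrow> gsum \<tau> (\<beta> - (1, 0)) (z + of_int i * \<tau>) y = 0"
      by (simp only:)
    also have "\<dots> \<longleftrightarrow> gsum \<tau> (\<beta> - (1, 0) + (of_int i, 0)) z y = 0" by (rule step2)
    also have "\<beta> - (1, 0) + (of_int i, 0) = \<beta> + (of_int (i - 1), 0)" by (simp add: prod_eq_iff)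
    finally show ?case .
  qed
  have 2: "gsum \<tau> \<beta> (z + of_int k) y = 0 \<longleftrightarrow> gsum \<tau> (\<beta> + (0, of_int k)) z y = 0" for z k and \<beta> :: "'n zn2"
  proof (induction k arbitrary: \<beta> rule: int_induct[where k = 0])
    case base then show ?case by (simp add: zero_prod_def[symmetric])
  next
    case (step1 i)
    have "gsum \<tau> \<beta> (z + of_int (i + 1)) y = 0 \<longleftrightarrow> gsum \<tau> (\<beta> + (0, 1)) (z + of_int i) y = 0"
      using gsum_plus_1[of \<beta> "z + of_int i" y] by (simp add: algebra_simps)
    also have "\<dots> \<longleftrightarrow> gsum \<tau> (\<beta> + (0, 1) + (0, of_int i)) z y = 0" by (rule step1)
    also have "\<beta> + (0, 1) + (0, of_int i) = \<beta> + (0, of_int (i + 1))" by (simp add: prod_eq_iff)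
    finally show ?case .
  next
    case (step2 i)
    have "gsum \<tau> (\<beta> - (0, 1)) (z + of_int (i - 1) + 1) y = 0 \<longleftrightarrow> gsum \<tau> \<beta> (z + of_int (i - 1)) y = 0"
      unfolding gsum_plus_1 by simp
    moreover have "z + of_int (i - 1) + 1 = z + of_int i" by (simp add: algebra_simps)
    ultimately have "gsum \<tau> \<beta> (z + of_int (i - 1)) y = 0 \<longleftrightarrow> gsum \<tau> (\<beta> - (0, 1)) (z + of_int i) y = 0"
      by simp
    also have "\<dots> \<longleftrightarrow> gsum \<tau> (\<beta> - (0, 1) + (0, of_int i)) z y = 0" by (rule step2)
    also have "\<beta> - (0, 1) + (0, of_int i) = \<beta> + (0, of_int (i - 1))" by (simp add: prod_eq_iff)
    finally show ?case .
  qed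
  have "gsum \<tau> \<beta> (of_int k * \<tau> + of_int l) y = 0 \<longleftrightarrow> gsum \<tau> (\<beta> + (0, of_int l) + (of_int k, 0)) 0 y = 0"
    using 2[of \<beta> "of_int k * \<tau>" l] 1[of _ 0 k] by simp
  also have "\<dots> \<longleftrightarrow> \<beta> + (of_int k, of_int l) \<noteq> 0"
    unfolding gsum_0[OF assms] by (simp add: prod_eq_iff add.assoc)
  finally show ?thesis .
qed

end

section \<open>Convolution identities\<close>

text \<open>Evenness removes the linear term: the quotient of \<open>f - 1\<close> by u is odd,
  hence vanishes at 0 and can be divided by u once more.\<close>

lemma even_entire_expansion:
  fixes f :: "complex \<Rightarrow> complex"
  assumes hol: "f holomorphic_on UNIV" and even: "\<And>u. f (- u) = f u" and 1: "f 0 = 1"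
  shows "\<exists>m. m holomorphic_on UNIV \<and> (\<forall>u. f u = 1 + u\<^sup>2 * m u)"
proof -
  have "(\<lambda>u. f u - 1) holomorphic_on UNIV" "f 0 - 1 = 0" using hol 1 by (auto intro!: holomorphic_intros)
  then obtain h where h: "h holomorphic_on UNIV" "\<And>u. f u - 1 = u * h u" "h 0 = deriv (\<lambda>u. f u - 1) 0"
    by (rule entire_divide_monomial) (rule that)
  have "h (- 0) = - h 0"
  proof (rule entire_cancel[where A = "\<lambda>u. u" and f = "\<lambda>u. h (- u)" and g = "\<lambda>u. - h u" and ?z0.0 = 1])
    show "(\<lambda>u. h (- u)) holomorphic_on UNIV" using holomorphic_compose_affine[OF h(1), of "-1" 0] by simp
    show "z * h (- z) = z * - h z" for z using h(2)[of z] h(2)[of "- z"] even[of z] by (simp add: algebra_simps)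
  qed (use h(1) in \<open>auto intro!: holomorphic_intros\<close>)
  then have "h 0 = 0" by simp
  with h(1) obtain m where m: "m holomorphic_on UNIV" "\<And>u. h u = u * m u" "m 0 = deriv h 0"
    by (rule entire_divide_monomial) (rule that)
  have "f u = 1 + u\<^sup>2 * m u" for u
    using h(2)[of u] m(2)[of u] by (simp add: power2_eq_square algebra_simps)
  then show ?thesis using m(1) by (intro exI[of _ m] conjI allI)
qed

text \<open>Cross terms start at u^4, so the u^2-coefficients simply add. This converts a product
  formula into the value of a sum to second order.\<close>

lemma prod_even_entire_expansion:
  fixes m :: "'b \<Rightarrow> complex \<Rightarrow> complex"
  assumes "finite A" "\<And>i. i \<in> A \<Longrightarrow> m i holomorphic_on UNIV"
  shows "\<exists>M. M holomorphic_on UNIV \<and> M 0 = (\<Sum>i\<in>A. m i 0) \<and> (\<forall>u. (\<Prod>i\<in>A. 1 + u\<^sup>2 * m i u) = 1 + u\<^sup>2 * M u)"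
  using assms
proof (induction A)
  case empty
  show ?case by (intro exI[of _ "\<lambda>_. 0"]) auto
next
  case (insert i A)
  then obtain M where M: "M holomorphic_on UNIV" "M 0 = (\<Sum>i\<in>A. m i 0)"
    "\<forall>u. (\<Prod>i\<in>A. 1 + u\<^sup>2 * m i u) = 1 + u\<^sup>2 * M u" by auto
  let ?M = "\<lambda>u. m i u + M u + u\<^sup>2 * m i u * M u"
  have "?M holomorphic_on UNIV" using M(1) insert by (auto intro!: holomorphic_intros)
  moreover have "(\<Prod>i\<in>insert i A. 1 + u\<^sup>2 * m i u) = 1 + u\<^sup>2 * ?M u" for u
    using insert.hyps M(3) by (simp add: algebra_simps)
  ultimately show ?case using insert.hyps M(2) by (intro exI[of _ ?M]) auto
qed

context
  fixes \<tau> :: complex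
  assumes im: "Im \<tau> > 0"
begin

lemma divide_by_th:
  assumes hol: "f holomorphic_on UNIV" and z: "\<And>k l::int. f (of_int k * \<tau> + of_int l) = 0"
  obtains h where "h holomorphic_on UNIV" "\<And>u. f u = th \<tau> u * h u"
proof (rule entire_divide_simple_zeros[OF hol th_holomorphic[OF im]])
  fix u assume "th \<tau> u = 0"
  then show "f u = 0 \<and> deriv (th \<tau>) u \<noteq> 0"
    using th_zero_iff[OF im] deriv_th_zero[OF im] z by auto
qed (rule that)

text \<open>One zero at the origin forces zeros on the whole lattice, all matched by the simple
  zeros of \<open>th\<close>. Keeping \<open>E\<close> general lets the lemma be applied twice to a
  function of order two.\<close>

lemma divide_quasiperiodic_by_th:
  assumes hol: "f holomorphic_on UNIV" and f0: "f 0 = 0"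
    and f1: "\<And>u. f (u + 1) = a * f u" and ft: "\<And>u. f (u + \<tau>) = E u * f u"
    and a: "a \<noteq> 0" and E: "\<And>u. E u \<noteq> 0" and Ehol: "E holomorphic_on UNIV"
  obtains h where "h holomorphic_on UNIV" "\<And>u. f u = th \<tau> u * h u"
    "\<And>u. h (u + 1) = - a * h u"
    "\<And>u. h (u + \<tau>) = - exp (\<i> * pi * \<tau> + 2 * \<i> * pi * u) * E u * h u"
proof -
  have z: "f (of_int k * \<tau> + of_int l) = 0" for k l
  proof -
    have "f (0 + of_int k * \<tau> + of_int l) = 0"
    proof (rule zero_set_translate[OF im, where f = f])
      show "f 0 = 0" by (rule f0)
      fix z assume z: "f z = 0"
      show "f (z + 1) = 0" "f (z + \<tau>) = 0" using z by (auto simp: f1 ft)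
      show "f (z - 1) = 0" "f (z - \<tau>) = 0" using f1[of "z - 1"] ft[of "z - \<tau>"] z a E by auto
    qed
    then show ?thesis by simp
  qed
  obtain h where h: "h holomorphic_on UNIV" "\<And>u. f u = th \<tau> u * h u"
    by (rule divide_by_th[OF hol z]) (rule that)
  have h1: "h (u + 1) = - a * h u" for u
  proof (rule entire_cancel[where A = "th \<tau>" and f = "\<lambda>u. h (u + 1)" and g = "\<lambda>u. - a * h u" and z = u, OF _ _ th_holomorphic[OF im] th_half[OF im]])
    show "(\<lambda>u. h (u + 1)) holomorphic_on UNIV" using holomorphic_compose_affine[OF h(1), of 1 1] by simp
    show "(\<lambda>u. - a * h u) holomorphic_on UNIV" using h(1) by (auto intro!: holomorphic_intros)
    show "th \<tau> z * h (z + 1) = th \<tau> z * (- a * h z)" for z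
    proof -
      have "- (th \<tau> z * h (z + 1)) = a * (th \<tau> z * h z)"
        using f1[of z] by (simp add: h(2) th_plus_1[OF im])
      then have "th \<tau> z * h (z + 1) = - (a * (th \<tau> z * h z))" by (metis minus_minus)
      then show ?thesis by (simp add: mult_ac)
    qed
  qed
  have ht: "h (u + \<tau>) = - exp (\<i> * pi * \<tau> + 2 * \<i> * pi * u) * E u * h u" for u
  proof (rule entire_cancel[where A = "th \<tau>" and f = "\<lambda>u. h (u + \<tau>)" and g = "\<lambda>u. - exp (\<i> * pi * \<tau> + 2 * \<i> * pi * u) * E u * h u" and z = u, OF _ _ th_holomorphic[OF im] th_half[OF im]])
    show "(\<lambda>u. h (u + \<tau>)) holomorphic_on UNIV" using holomorphic_compose_affine[OF h(1), of 1 \<tau>] by simp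
    show "(\<lambda>u. - exp (\<i> * pi * \<tau> + 2 * \<i> * pi * u) * E u * h u) holomorphic_on UNIV"
      using h(1) Ehol by (auto intro!: holomorphic_intros)
    fix z
    define e where "e = exp (\<i> * pi * \<tau> + 2 * \<i> * pi * z)"
    define e' where "e' = exp (- \<i> * pi * \<tau> - 2 * \<i> * pi * z)"
    have ee: "e * e' = 1" unfolding e_def e'_def exp_add[symmetric] by simp
    have "E z * (th \<tau> z * h z) = - e' * th \<tau> z * h (z + \<tau>)"
      using ft[of z] unfolding h(2) th_plus_tau[OF im] e'_def by simp
    then have "- e * (E z * (th \<tau> z * h z)) = - e * (- e' * th \<tau> z * h (z + \<tau>))" by simp
    also have "\<dots> = (e * e') * (th \<tau> z * h (z + \<tau>))" by (simp add: mult_ac)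
    finally show "th \<tau> z * h (z + \<tau>) = th \<tau> z * (- exp (\<i> * pi * \<tau> + 2 * \<i> * pi * z) * E z * h z)"
      unfolding ee e_def[symmetric] by (simp add: mult_ac)
  qed
  show ?thesis by (rule that[OF h h1 ht])
qed

text \<open>The quotient by the square of \<^const>\<open>th\<close> is entire with multipliers of modulus 1.\<close>
lemma order_two_double_zero:
  assumes hol: "f holomorphic_on UNIV" and f0: "f 0 = 0" and df: "deriv f 0 = 0"
    and f1: "\<And>u. f (u + 1) = a * f u"
    and ft: "\<And>u. f (u + \<tau>) = b * exp (- 2 * \<i> * pi * \<tau> - 4 * \<i> * pi * u) * f u"
    and ab: "norm a = 1" "norm b = 1"
  shows "\<exists>C. \<forall>u. f u = C * (th \<tau> u)\<^sup>2"
proof -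
  have a0: "a \<noteq> 0" "b \<noteq> 0" using ab by auto
  obtain h where h: "h holomorphic_on UNIV" "\<And>u. f u = th \<tau> u * h u"
    "\<And>u. h (u + 1) = - a * h u"
    "\<And>u. h (u + \<tau>) = - exp (\<i> * pi * \<tau> + 2 * \<i> * pi * u) * (b * exp (- 2 * \<i> * pi * \<tau> - 4 * \<i> * pi * u)) * h u"
    by (rule divide_quasiperiodic_by_th[OF hol f0 f1 ft]) (use a0 in \<open>auto intro!: holomorphic_intros\<close>)
  have "((\<lambda>u. th \<tau> u * h u) has_field_derivative deriv (th \<tau>) 0 * h 0) (at 0)"
    using deriv_th[OF im, of 0] holomorphic_derivI[OF h(1), of 0] th_0[OF im]
    by (auto intro!: derivative_eq_intros)
  moreover have "f = (\<lambda>u. th \<tau> u * h u)" using h(2) by (rule ext)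
  ultimately have "deriv (th \<tau>) 0 * h 0 = 0" using df by (simp add: DERIV_imp_deriv)
  then have h0: "h 0 = 0" using deriv_th_0[OF im] by simp
  obtain j where j: "j holomorphic_on UNIV" "\<And>u. h u = th \<tau> u * j u"
    "\<And>u. j (u + 1) = - (- a) * j u"
    "\<And>u. j (u + \<tau>) = - exp (\<i> * pi * \<tau> + 2 * \<i> * pi * u) *
      (- exp (\<i> * pi * \<tau> + 2 * \<i> * pi * u) * (b * exp (- 2 * \<i> * pi * \<tau> - 4 * \<i> * pi * u))) * j u"
    by (rule divide_quasiperiodic_by_th[OF h(1) h0 h(3) h(4)]) (use a0 in \<open>auto intro!: holomorphic_intros\<close>)
  have jt: "j (u + \<tau>) = b * j u" for u
  proof -
    have "exp (\<i> * pi * \<tau> + 2 * \<i> * pi * u) * exp (\<i> * pi * \<tau> + 2 * \<i> * pi * u) *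
        exp (- 2 * \<i> * pi * \<tau> - 4 * \<i> * pi * u) = 1"
      unfolding exp_add[symmetric] by simp
    then have "b * (exp (\<i> * pi * \<tau> + 2 * \<i> * pi * u) * exp (\<i> * pi * \<tau> + 2 * \<i> * pi * u) *
        exp (- 2 * \<i> * pi * \<tau> - 4 * \<i> * pi * u)) * j u = b * j u" by simp
    then show ?thesis unfolding j(4) by (simp only: mult_ac minus_mult_minus mult_minus_left mult_minus_right minus_minus)
  qed
  obtain c where c: "\<And>u. j u = c"
    by (rule entire_doubly_periodic_norm_const[OF j(1) im]) (use ab in \<open>auto simp: j(3) jt norm_mult\<close>)
  have "f u = c * (th \<tau> u)\<^sup>2" for u by (simp add: h(2) j(2) c power2_eq_square)
  then show ?thesis by (intro exI[of _ c] allI)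
qed

lemma th_scaled_holomorphic: "(\<lambda>u. th \<tau> (a * u + b)) holomorphic_on UNIV"
  using holomorphic_compose_affine[OF th_holomorphic[OF im]] .

lemma gsum_holomorphic: "(\<lambda>u. gsum \<tau> \<beta> (a * u + b) y) holomorphic_on UNIV"
  by (intro holomorphic_gsum[OF im] holomorphic_intros)

text \<open>The Fourier transform of \<open>\<alpha> \<mapsto> phi \<tau> \<alpha> u y\<close>: the sum vanishes at the points of the lattice
  outside its \<open>N\<close>-fold multiple, so after division by \<open>th \<tau> u\<close> and multiplication by \<open>th \<tau> (u / N)\<close> it is
  a theta function of order one for the \<open>N\<close>-fold lattice.\<close>
lemma gsum_formula:
  assumes reg: "regular_at CARD('n::nontriv) \<tau> y"
  shows "\<exists>C. C \<noteq> 0 \<and> (\<forall>u. gsum \<tau> (0 :: 'n zn2) u y * th \<tau> (u / of_nat CARD('n))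
    = C * th \<tau> u * th \<tau> (u / of_nat CARD('n) + of_nat CARD('n) * y))"
proof -
  define N where "N = CARD('n)"
  have N0: "N > 0" "(of_nat N :: complex) \<noteq> 0" by (simp_all add: N_def)
  define G where "G u = gsum \<tau> (0 :: 'n zn2) u y" for u
  have Ghol: "G holomorphic_on UNIV"
    unfolding G_def using gsum_holomorphic[of 0 1 0 y] by simp
  define f where "f u = G u * th \<tau> (u / of_nat N)" for u
  have thN: "(\<lambda>u. th \<tau> (u / of_nat N)) holomorphic_on UNIV"
    using th_scaled_holomorphic[of "1 / of_nat N" 0] by simp
  have fhol: "f holomorphic_on UNIV"
    unfolding f_def[abs_def] by (intro holomorphic_intros Ghol thN)
  have fz: "f (of_int k * \<tau> + of_int l) = 0" for k l :: int
  proof (cases "(of_int k, of_int l) = (0 :: 'n zn2)")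
    case True
    then have "to_int_mod_ring (of_int k :: 'n mod_ring) = 0" "to_int_mod_ring (of_int l :: 'n mod_ring) = 0"
      by (auto simp: prod_eq_iff)
    then have "k mod int N = 0" "l mod int N = 0" by (simp_all add: to_int_mod_ring_of_int N_def)
    then obtain k' l' where "k = int N * k'" "l = int N * l'" by (auto elim!: dvdE simp: mod_eq_0_iff_dvd)
    then have "(of_int k * \<tau> + of_int l) / of_nat N = of_int k' * \<tau> + of_int l'"
      using N0 by (simp add: field_simps)
    then have "th \<tau> ((of_int k * \<tau> + of_int l) / of_nat N) = 0" using th_zero_iff[OF im] by blast
    then show ?thesis by (simp add: f_def)
  next
    case False
    then have "G (of_int k * \<tau> + of_int l) = 0"
      unfolding G_def by (subst gsum_lattice[OF im reg]) simp
    then show ?thesis by (simp add: f_def)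
  qed
  obtain h where h: "h holomorphic_on UNIV" "\<And>u. f u = th \<tau> u * h u"
    by (rule divide_by_th[OF fhol fz]) (rule that)
  \<comment> \<open>Rescaling by N turns the N-fold lattice back into the lattice of 1 and \<tau>,
    where uniqueness in order one is available.\<close>
  define H where "H v = h (of_nat N * v)" for v
  have Hhol: "H holomorphic_on UNIV"
    using holomorphic_compose_affine[OF h(1), of "of_nat N" 0] by (simp add: H_def[abs_def])
  have GN: "G (u + of_nat N) = (-1) ^ N * G u" for u
  proof -
    have 1: "gsum \<tau> \<beta> (u + of_nat k) y = (-1) ^ k * gsum \<tau> (\<beta> + (0, of_nat k)) u y" for k and \<beta> :: "'n zn2"
    proof (induction k arbitrary: \<beta>)
      case 0 then show ?case by (simp add: zero_prod_def[symmetric])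
    next
      case (Suc k)
      have "gsum \<tau> \<beta> (u + of_nat (Suc k)) y = - gsum \<tau> (\<beta> + (0, 1)) (u + of_nat k) y"
        using gsum_plus_1[OF im, of \<beta> "u + of_nat k" y] by (simp add: add_ac)
      also have "\<dots> = (-1) ^ Suc k * gsum \<tau> (\<beta> + (0, 1) + (0, of_nat k)) u y" by (simp add: Suc)
      also have "\<beta> + (0, 1) + (0, of_nat k) = \<beta> + (0, of_nat (Suc k))" by (simp add: prod_eq_iff)
      finally show ?case .
    qed
    show ?thesis using 1[of 0 N] by (simp add: G_def N_def zero_prod_def[symmetric])
  qed
  have Gt: "G (u + of_nat N * \<tau>) = (-1) ^ N * exp (- \<i> * pi * (of_nat N)\<^sup>2 * \<tau> - 2 * \<i> * pi * of_nat N * (u + y)) * G u" for u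
  proof -
    have 1: "gsum \<tau> \<beta> (u + of_nat k * \<tau>) y = (-1) ^ k * exp (- \<i> * pi * (of_nat k)\<^sup>2 * \<tau> - 2 * \<i> * pi * of_nat k * (u + y))
      * gsum \<tau> (\<beta> + (of_nat k, 0)) u y" for k and \<beta> :: "'n zn2"
    proof (induction k arbitrary: \<beta>)
      case 0 then show ?case by (simp add: zero_prod_def[symmetric])
    next
      case (Suc k)
      have "u + of_nat (Suc k) * \<tau> = u + of_nat k * \<tau> + \<tau>" by (simp add: algebra_simps)
      then have "gsum \<tau> \<beta> (u + of_nat (Suc k) * \<tau>) y
          = - exp (- \<i> * pi * \<tau> - 2 * \<i> * pi * (u + of_nat k * \<tau> + y)) * gsum \<tau> (\<beta> + (1, 0)) (u + of_nat k * \<tau>) y"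
        by (simp only: gsum_plus_tau[OF im])
      also have "\<dots> = (-1) ^ Suc k * (exp (- \<i> * pi * \<tau> - 2 * \<i> * pi * (u + of_nat k * \<tau> + y)) *
          exp (- \<i> * pi * (of_nat k)\<^sup>2 * \<tau> - 2 * \<i> * pi * of_nat k * (u + y)))
          * gsum \<tau> (\<beta> + (1, 0) + (of_nat k, 0)) u y" by (simp add: Suc)
      also have "\<beta> + (1, 0) + (of_nat k, 0) = \<beta> + (of_nat (Suc k), 0)" by (simp add: prod_eq_iff)
      also have "exp (- \<i> * pi * \<tau> - 2 * \<i> * pi * (u + of_nat k * \<tau> + y)) *
          exp (- \<i> * pi * (of_nat k)\<^sup>2 * \<tau> - 2 * \<i> * pi * of_nat k * (u + y))
          = exp (- \<i> * pi * (of_nat (Suc k))\<^sup>2 * \<tau> - 2 * \<i> * pi * of_nat (Suc k) * (u + y))"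
        unfolding exp_add[symmetric] by (rule arg_cong[of _ _ exp]) (simp add: power2_eq_square algebra_simps)
      finally show ?case by (simp only: mult.assoc)
    qed
    show ?thesis using 1[of 0 N] by (simp add: G_def N_def zero_prod_def[symmetric])
  qed
  have H1: "H (v + 1) = - H v" for v
  proof -
    have "h (u + of_nat N) = - h u" for u
    proof (rule entire_cancel[where A = "th \<tau>" and f = "\<lambda>u. h (u + of_nat N)" and g = "\<lambda>u. - h u" and z = u, OF _ _ th_holomorphic[OF im] th_half[OF im]])
      show "(\<lambda>u. h (u + of_nat N)) holomorphic_on UNIV"
        using holomorphic_compose_affine[OF h(1), of 1 "of_nat N"] by simp
      show "(\<lambda>u. - h u) holomorphic_on UNIV" using h(1) by (auto intro!: holomorphic_intros)
      fix z
      have "f (z + of_nat N) = - ((-1) ^ N * f z)"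
        using N0 by (simp add: f_def GN add_divide_distrib th_plus_1[OF im])
      then have "(-1) ^ N * (th \<tau> z * h (z + of_nat N)) = (-1) ^ N * (th \<tau> z * - h z)"
        unfolding h(2) th_plus_nat[OF im] by (simp add: mult_ac)
      moreover have "(-1 :: complex) ^ N \<noteq> 0" by simp
      ultimately show "th \<tau> z * h (z + of_nat N) = th \<tau> z * - h z" using mult_left_cancel by blast
    qed
    from this[of "of_nat N * v"] show ?thesis by (simp add: H_def algebra_simps)
  qed
  have Ht: "H (v + \<tau>) = - exp (- \<i> * pi * \<tau> - 2 * \<i> * pi * (v + of_nat N * y)) * H v" for v
  proof -
    have "h (u + of_nat N * \<tau>) = - exp (- \<i> * pi * \<tau> - 2 * \<i> * pi * (u / of_nat N + of_nat N * y)) * h u" for u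
    proof (rule entire_cancel[where A = "th \<tau>" and f = "\<lambda>u. h (u + of_nat N * \<tau>)" and g = "\<lambda>u. - exp (- \<i> * pi * \<tau> - 2 * \<i> * pi * (u / of_nat N + of_nat N * y)) * h u" and z = u, OF _ _ th_holomorphic[OF im] th_half[OF im]])
      show "(\<lambda>u. h (u + of_nat N * \<tau>)) holomorphic_on UNIV"
        using holomorphic_compose_affine[OF h(1), of 1 "of_nat N * \<tau>"] by simp
      show "(\<lambda>u. - exp (- \<i> * pi * \<tau> - 2 * \<i> * pi * (u / of_nat N + of_nat N * y)) * h u) holomorphic_on UNIV"
        using h(1) N0 by (auto intro!: holomorphic_intros)
      fix z
      define e where "e = exp (- \<i> * pi * (of_nat N)\<^sup>2 * \<tau> - 2 * \<i> * pi * of_nat N * z)"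
      define e1 where "e1 = exp (- \<i> * pi * \<tau> - 2 * \<i> * pi * (z / of_nat N + of_nat N * y))"
      have ee: "exp (- \<i> * pi * (of_nat N)\<^sup>2 * \<tau> - 2 * \<i> * pi * of_nat N * (z + y))
          * exp (- \<i> * pi * \<tau> - 2 * \<i> * pi * (z / of_nat N)) = e * e1"
        unfolding e_def e1_def exp_add[symmetric] by (rule arg_cong[of _ _ exp]) (simp add: algebra_simps)
      have zN: "(z + of_nat N * \<tau>) / of_nat N = z / of_nat N + \<tau>" using N0 by (simp add: field_simps)
      have "f (z + of_nat N * \<tau>) = - ((-1) ^ N) * (exp (- \<i> * pi * (of_nat N)\<^sup>2 * \<tau> - 2 * \<i> * pi * of_nat N * (z + y))
          * exp (- \<i> * pi * \<tau> - 2 * \<i> * pi * (z / of_nat N))) * f z"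
        unfolding f_def zN Gt th_plus_tau[OF im] by (simp add: mult_ac)
      then have "((-1) ^ N * e) * (th \<tau> z * h (z + of_nat N * \<tau>)) = ((-1) ^ N * e) * (th \<tau> z * (- e1 * h z))"
        unfolding ee h(2) th_quasi_nat[OF im] e_def[symmetric] by (simp add: mult_ac)
      moreover have "(-1) ^ N * e \<noteq> 0" by (simp add: e_def)
      ultimately show "th \<tau> z * h (z + of_nat N * \<tau>)
          = th \<tau> z * (- exp (- \<i> * pi * \<tau> - 2 * \<i> * pi * (z / of_nat N + of_nat N * y)) * h z)"
        unfolding e1_def[symmetric] using mult_left_cancel by blast
    qed
    from this[of "of_nat N * v"] N0 show ?thesis by (simp add: H_def distrib_left)
  qed
  obtain C where C: "\<forall>v. H v = C * th \<tau> (v + of_nat N * y)"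
    using th_unique[OF im Hhol H1 Ht] by (elim exE)
  have eq: "G u * th \<tau> (u / of_nat N) = C * th \<tau> u * th \<tau> (u / of_nat N + of_nat N * y)" for u
    using C[rule_format, of "u / of_nat N"] h(2)[of u] N0 by (simp add: H_def f_def mult_ac)
  \<comment> \<open>At u = 0 the sum is N^2 by orthogonality; \<open>C = 0\<close> would make it
    vanish identically.\<close>
  have "C \<noteq> 0"
  proof
    assume "C = 0"
    have "G 0 = 0"
    proof (rule entire_cancel[where A = "\<lambda>u. th \<tau> (u / of_nat N)" and ?z0.0 = "of_nat N / 2" and f = G and g = "\<lambda>_. 0" and z = 0, OF Ghol _ thN])
      show "th \<tau> (of_nat N / 2 / of_nat N) \<noteq> 0" using th_half[OF im] N0 by simp
      show "th \<tau> (z / of_nat N) * G z = th \<tau> (z / of_nat N) * 0" for z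
        using eq[of z] \<open>C = 0\<close> by (simp add: mult.commute)
    qed auto
    then show False using gsum_0[OF im reg, of 0] N0 by (simp add: G_def N_def)
  qed
  then show ?thesis unfolding G_def[symmetric] N_def[symmetric]
    by (intro exI[of _ C] conjI allI eq)
qed


text \<open>Without phases the convolution is a product of Fourier transforms, and in that product the
  \<open>\<beta>\<close>-dependent factors of \<open>gsum_formula\<close> cancel; a constant Fourier transform means a delta.\<close>
lemma crossing_convolution:
  assumes reg: "regular_at CARD('n::nontriv) \<tau> y"
  shows "\<exists>C. C \<noteq> 0 \<and> (\<forall>u (\<gamma> :: 'n zn2).
    (\<Sum>\<alpha>\<in>UNIV. phi \<tau> \<alpha> u y * phi \<tau> (\<gamma> - \<alpha>) (u + (of_nat CARD('n))\<^sup>2 * y) (- y))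
     = (if \<gamma> = 0 then C * th \<tau> u * th \<tau> (u + (of_nat CARD('n))\<^sup>2 * y) else 0))"
proof -
  define N where "N = CARD('n)"
  have N0: "N > 0" "(of_nat N :: complex) \<noteq> 0" by (simp_all add: N_def)
  have reg': "regular_at N \<tau> y" using reg by (simp add: N_def)
  have regm: "regular_at CARD('n) \<tau> (- y)" by (rule regular_minus[OF im reg])
  \<comment> \<open>This is the shift with (u + s) / N = u / N + N y. With it the quotient of th(u/N
    + N y) by th(u/N) in the first transform is the inverse of the corresponding quotient in the
    second.\<close>
  define s where "s = (of_nat N)\<^sup>2 * y"
  obtain C1 where C1: "C1 \<noteq> 0" "\<forall>u. gsum \<tau> (0 :: 'n zn2) u y * th \<tau> (u / of_nat N)
    = C1 * th \<tau> u * th \<tau> (u / of_nat N + of_nat N * y)"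
    using gsum_formula[OF reg] unfolding N_def[symmetric] by (elim exE conjE)
  obtain C2 where C2: "C2 \<noteq> 0" "\<forall>u. gsum \<tau> (0 :: 'n zn2) u (- y) * th \<tau> (u / of_nat N)
    = C2 * th \<tau> u * th \<tau> (u / of_nat N + of_nat N * (- y))"
    using gsum_formula[OF regm] unfolding N_def[symmetric] by (elim exE conjE)
  define P where "P \<beta> u = gsum \<tau> (\<beta> :: 'n zn2) u y * gsum \<tau> \<beta> (u + s) (- y)" for \<beta> u
  define Q where "Q u = C1 * C2 * th \<tau> u * th \<tau> (u + s)" for u
  have "\<forall>\<^sub>\<approx>u. th \<tau> u \<noteq> 0" by (rule cosparse_entire_nonzero[OF th_holomorphic[OF im] th_half[OF im]])
  then have "\<forall>\<^sub>\<approx>u. th \<tau> (1 / of_nat N * u + 0) \<noteq> 0 \<and> th \<tau> (1 / of_nat N * u + of_nat N * y) \<noteq> 0"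
    using N0 by (intro eventually_conj cosparse_compose_affine[of "\<lambda>u. th \<tau> u \<noteq> 0"]) auto
  from cosparse_happens[OF this] obtain u0 where
    u0: "th \<tau> (u0 / of_nat N) * th \<tau> (u0 / of_nat N + of_nat N * y) \<noteq> 0" by auto
  have P0: "P 0 u = Q u" for u
  proof (rule entire_cancel[where A = "\<lambda>u. th \<tau> (u / of_nat N) * th \<tau> (u / of_nat N + of_nat N * y)" and f = "P 0" and g = Q and z = u, OF _ _ _ u0])
    show "P 0 holomorphic_on UNIV" unfolding P_def[abs_def]
      using gsum_holomorphic[of 0 1 0 y] gsum_holomorphic[of 0 1 s "- y"] by (intro holomorphic_on_mult) simp_all
    show "Q holomorphic_on UNIV" unfolding Q_def[abs_def]
      by (intro holomorphic_intros holomorphic_th[OF im])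
    show "(\<lambda>u. th \<tau> (u / of_nat N) * th \<tau> (u / of_nat N + of_nat N * y)) holomorphic_on UNIV"
      using N0 by (intro holomorphic_intros holomorphic_th[OF im]) auto
    fix z
    have 1: "(z + s) / of_nat N = z / of_nat N + of_nat N * y"
      using N0 by (simp add: s_def field_simps power2_eq_square)
    have "th \<tau> (z / of_nat N) * th \<tau> (z / of_nat N + of_nat N * y) * P 0 z
      = (gsum \<tau> (0 :: 'n zn2) z y * th \<tau> (z / of_nat N)) *
        (gsum \<tau> (0 :: 'n zn2) (z + s) (- y) * th \<tau> ((z + s) / of_nat N))"
      by (simp only: P_def 1 mult_ac)
    also have "\<dots> = (C1 * th \<tau> z * th \<tau> (z / of_nat N + of_nat N * y)) * (C2 * th \<tau> (z + s) * th \<tau> (z / of_nat N))"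
      using C1(2)[rule_format, of z] C2(2)[rule_format, of "z + s"] unfolding 1 by simp
    also have "\<dots> = th \<tau> (z / of_nat N) * th \<tau> (z / of_nat N + of_nat N * y) * Q z"
      by (simp only: Q_def mult_ac)
    finally show "th \<tau> (z / of_nat N) * th \<tau> (z / of_nat N + of_nat N * y) * P 0 z
      = th \<tau> (z / of_nat N) * th \<tau> (z / of_nat N + of_nat N * y) * Q z" .
  qed
  \<comment> \<open>The shift u + 1 acts on \<open>P\<close> by translating \<beta>, while
    \<open>Q\<close> has the same multipliers under 1 and \<tau> and no index. Hence the identity
    spreads from \<beta> = 0 to every \<beta>.\<close>
  have P1: "(\<forall>u. P (\<beta> + (0, 1)) u = Q u)" if "\<forall>u. P \<beta> u = Q u" for \<beta>
  proof
    fix u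
    have "P \<beta> (u + 1) = P (\<beta> + (0, 1)) u"
      unfolding P_def gsum_plus_1[OF im] using gsum_plus_1[OF im, of \<beta> "u + s" "- y"] by (simp add: add_ac)
    moreover have "Q (u + 1) = Q u"
      using th_plus_1[OF im, of u] th_plus_1[OF im, of "u + s"] by (simp add: Q_def add_ac)
    ultimately show "P (\<beta> + (0, 1)) u = Q u" using that by simp
  qed
  have Pt: "(\<forall>u. P (\<beta> + (1, 0)) u = Q u)" if "\<forall>u. P \<beta> u = Q u" for \<beta>
  proof
    fix u
    have us: "u + \<tau> + s = u + s + \<tau>" by simp
    define e where "e = exp (- \<i> * pi * \<tau> - 2 * \<i> * pi * u) * exp (- \<i> * pi * \<tau> - 2 * \<i> * pi * (u + s))"
    have e: "exp (- \<i> * pi * \<tau> - 2 * \<i> * pi * (u + y)) * exp (- \<i> * pi * \<tau> - 2 * \<i> * pi * (u + s + - y)) = e"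
      unfolding e_def exp_add[symmetric] by (rule arg_cong[of _ _ exp]) (simp add: algebra_simps)
    have "P \<beta> (u + \<tau>) = (exp (- \<i> * pi * \<tau> - 2 * \<i> * pi * (u + y)) * exp (- \<i> * pi * \<tau> - 2 * \<i> * pi * (u + s + - y)))
      * P (\<beta> + (1, 0)) u"
      unfolding P_def us gsum_plus_tau[OF im] by (simp add: mult_ac)
    then have "P \<beta> (u + \<tau>) = e * P (\<beta> + (1, 0)) u" by (simp only: e)
    moreover have "Q (u + \<tau>) = e * Q u"
      unfolding Q_def us th_plus_tau[OF im] e_def by (simp add: mult_ac)
    moreover have "e \<noteq> 0" by (simp add: e_def)
    ultimately show "P (\<beta> + (1, 0)) u = Q u" using that mult_left_cancel by metis
  qed
  have Pn: "\<forall>u. P (0, of_nat l) u = Q u" for l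
  proof (induction l)
    case 0 then show ?case using P0 by (simp add: zero_prod_def)
  next
    case (Suc l) then show ?case using P1[OF Suc] by (simp add: add.commute)
  qed
  have Pnn: "\<forall>u. P (of_nat k, of_nat l) u = Q u" for k l
  proof (induction k)
    case 0 then show ?case using Pn by simp
  next
    case (Suc k) then show ?case using Pt[OF Suc] by (simp add: add.commute)
  qed
  have P: "P \<beta> u = Q u" for \<beta> u
  proof -
    have "a \<in> range of_nat" for a :: "'n mod_ring"
      by (metis of_int_to_int_mod_ring of_nat_nat rangeI Rep_mod_ring to_int_mod_ring.rep_eq atLeastLessThan_iff of_int_of_nat_eq)
    then obtain k l where "fst \<beta> = of_nat k" "snd \<beta> = of_nat l" by (meson rangeE)
    then have "\<beta> = (of_nat k, of_nat l)" by (simp add: prod_eq_iff)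
    then show ?thesis using Pnn by simp
  qed
  have "(\<Sum>\<alpha>\<in>UNIV. phi \<tau> \<alpha> u y * phi \<tau> (\<gamma> - \<alpha>) (u + s) (- y)) = (if \<gamma> = 0 then Q u else 0)" for u and \<gamma> :: "'n zn2"
  proof -
    define h where "h \<gamma> = (\<Sum>\<alpha>\<in>UNIV. phi \<tau> \<alpha> u y * phi \<tau> (\<gamma> - \<alpha>) (u + s) (- y))" for \<gamma> :: "'n zn2"
    have hP: "(\<Sum>\<gamma>\<in>UNIV. br \<gamma> \<beta> * h \<gamma>) = Q u" for \<beta>
    proof -
      have "(\<Sum>\<gamma>\<in>UNIV. br \<gamma> \<beta> * h \<gamma>) = (\<Sum>\<gamma>\<in>UNIV. \<Sum>\<alpha>\<in>UNIV. (br \<alpha> \<beta> * phi \<tau> \<alpha> u y) * (br (\<gamma> - \<alpha>) \<beta> * phi \<tau> (\<gamma> - \<alpha>) (u + s) (- y)))"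
        unfolding h_def sum_distrib_left
      proof (intro sum.cong refl)
        fix \<gamma> \<alpha> :: "'n zn2"
        show "br \<gamma> \<beta> * (phi \<tau> \<alpha> u y * phi \<tau> (\<gamma> - \<alpha>) (u + s) (- y))
          = (br \<alpha> \<beta> * phi \<tau> \<alpha> u y) * (br (\<gamma> - \<alpha>) \<beta> * phi \<tau> (\<gamma> - \<alpha>) (u + s) (- y))"
          unfolding br_diff[of \<gamma> \<alpha> \<beta>, symmetric] by (simp add: mult_ac)
      qed
      also have "\<dots> = (\<Sum>\<alpha>\<in>UNIV. \<Sum>\<gamma>\<in>UNIV. (br \<alpha> \<beta> * phi \<tau> \<alpha> u y) * (br (\<gamma> - \<alpha>) \<beta> * phi \<tau> (\<gamma> - \<alpha>) (u + s) (- y)))"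
        by (rule sum.swap)
      also have "\<dots> = (\<Sum>\<alpha>\<in>UNIV. \<Sum>\<gamma>\<in>UNIV. (br \<alpha> \<beta> * phi \<tau> \<alpha> u y) * (br \<gamma> \<beta> * phi \<tau> \<gamma> (u + s) (- y)))"
      proof (rule sum.cong[OF refl])
        fix \<alpha> :: "'n zn2"
        show "(\<Sum>\<gamma>\<in>UNIV. (br \<alpha> \<beta> * phi \<tau> \<alpha> u y) * (br (\<gamma> - \<alpha>) \<beta> * phi \<tau> (\<gamma> - \<alpha>) (u + s) (- y)))
          = (\<Sum>\<gamma>\<in>UNIV. (br \<alpha> \<beta> * phi \<tau> \<alpha> u y) * (br \<gamma> \<beta> * phi \<tau> \<gamma> (u + s) (- y)))"
          by (rule sum.reindex_bij_witness[of _ "\<lambda>\<gamma>. \<gamma> + \<alpha>" "\<lambda>\<gamma>. \<gamma> - \<alpha>"]) auto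
      qed
      also have "\<dots> = P \<beta> u" by (simp only: P_def gsum_def sum_product)
      finally show ?thesis by (simp only: P)
    qed
    \<comment> \<open>Fourier inversion: the transform of \<open>h\<close> is the constant
      \<open>Q u\<close>, so \<open>h\<close> is supported at 0.\<close>
    have "(of_nat N)\<^sup>2 * h \<gamma> = (\<Sum>\<gamma>'\<in>UNIV. (if \<gamma>' = \<gamma> then (of_nat N)\<^sup>2 else 0) * h \<gamma>')"
      by (simp add: if_distrib[of "\<lambda>x. x * _"] cong: if_cong)
    also have "\<dots> = (\<Sum>\<gamma>'\<in>UNIV. (\<Sum>\<beta>\<in>UNIV. br (\<gamma>' - \<gamma>) \<beta>) * h \<gamma>')"
      by (simp only: sum_br N_def right_minus_eq)
    also have "\<dots> = (\<Sum>\<beta>\<in>UNIV. \<Sum>\<gamma>'\<in>UNIV. br (\<gamma>' - \<gamma>) \<beta> * h \<gamma>')"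
      by (simp only: sum_distrib_right) (rule sum.swap)
    also have "\<dots> = (\<Sum>\<beta>\<in>UNIV. br (- \<gamma>) \<beta> * (\<Sum>\<gamma>'\<in>UNIV. br \<gamma>' \<beta> * h \<gamma>'))"
      by (simp add: sum_distrib_left diff_conv_add_uminus br_add mult_ac del: add_uminus_conv_diff)
    also have "\<dots> = (\<Sum>\<beta>\<in>UNIV. br (- \<gamma>) \<beta>) * Q u"
      by (simp only: hP sum_distrib_right)
    also have "\<dots> = (of_nat N)\<^sup>2 * (if \<gamma> = 0 then Q u else 0)" by (simp add: sum_br N_def)
    finally show ?thesis using N0 by (simp add: h_def)
  qed
  then have "\<forall>u (\<gamma> :: 'n zn2). (\<Sum>\<alpha>\<in>UNIV. phi \<tau> \<alpha> u y * phi \<tau> (\<gamma> - \<alpha>) (u + s) (- y))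
      = (if \<gamma> = 0 then C1 * C2 * th \<tau> u * th \<tau> (u + s) else 0)"
    unfolding Q_def by (intro allI)
  moreover have "C1 * C2 \<noteq> 0" using C1(1) C2(1) by simp
  ultimately show ?thesis unfolding N_def[symmetric] s_def[symmetric] by (intro exI[of _ "C1 * C2"] conjI)
qed

text \<open>The multiplication formula for theta functions. Each zero of th(N u) is simple and is a
  zero of one of the factors; the exponentials remove the torsion points from the multipliers, so
  the quotient is entire with multipliers of modulus 1, hence constant.\<close>

lemma prod_th_torsion:
  assumes "CARD('n::nontriv) = N"
  shows "\<exists>c. \<forall>u. (\<Prod>\<alpha>\<in>(UNIV :: 'n zn2 set).
     exp (2 * \<i> * pi * (of_int (to_int_mod_ring (fst \<alpha>)) / of_nat N) * u) * th \<tau> (u + tors \<tau> \<alpha>)) = c * th \<tau> (of_nat N * u)"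
proof -
  have N0: "N > 0" "(of_nat N :: complex) \<noteq> 0" by (simp_all add: assms[symmetric])
  define q where "q \<alpha> u = exp (2 * \<i> * pi * (of_int (to_int_mod_ring (fst \<alpha>)) / of_nat N) * u) * th \<tau> (u + tors \<tau> \<alpha>)"
    for \<alpha> :: "'n zn2" and u
  define Q where "Q u = (\<Prod>\<alpha>\<in>UNIV. q \<alpha> u)" for u
  define g where "g u = th \<tau> (of_nat N * u)" for u
  have ghol: "g holomorphic_on UNIV" unfolding g_def[abs_def] using th_scaled_holomorphic[of "of_nat N" 0] by simp
  have Qhol: "Q holomorphic_on UNIV"
    unfolding Q_def[abs_def] q_def by (intro holomorphic_intros holomorphic_th[OF im])
  have q1: "q \<alpha> (u + 1) = - chi (fst \<alpha>) * q \<alpha> u" for \<alpha> u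
  proof -
    have "th \<tau> (u + 1 + tors \<tau> \<alpha>) = - th \<tau> (u + tors \<tau> \<alpha>)"
      using th_plus_1[OF im, of "u + tors \<tau> \<alpha>"] by (simp add: algebra_simps)
    moreover have "exp (2 * \<i> * pi * (of_int (to_int_mod_ring (fst \<alpha>)) / of_nat N) * (u + 1))
      = exp (2 * \<i> * pi * (of_int (to_int_mod_ring (fst \<alpha>)) / of_nat N) * u) * chi (fst \<alpha>)"
      unfolding chi_def exp_add[symmetric] using N0 by (intro arg_cong[of _ _ exp]) (simp add: field_simps assms)
    ultimately show ?thesis by (simp only: q_def) simp
  qed
  have qt: "q \<alpha> (u + \<tau>) = - exp (- \<i> * pi * \<tau> - 2 * \<i> * pi * u) * chi (- snd \<alpha>) * q \<alpha> u" for \<alpha> u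
  proof -
    have "th \<tau> (u + \<tau> + tors \<tau> \<alpha>) = - exp (- \<i> * pi * \<tau> - 2 * \<i> * pi * (u + tors \<tau> \<alpha>)) * th \<tau> (u + tors \<tau> \<alpha>)"
      using th_plus_tau[OF im, of "u + tors \<tau> \<alpha>"] by (simp add: algebra_simps)
    moreover have "chi (- snd \<alpha>) = exp (- (2 * \<i> * pi * (of_int (to_int_mod_ring (snd \<alpha>)) / of_nat N)))"
      unfolding chi_minus by (simp only: chi_def exp_minus inverse_eq_divide assms)
    moreover have "exp (2 * \<i> * pi * (of_int (to_int_mod_ring (fst \<alpha>)) / of_nat N) * (u + \<tau>))
        * exp (- \<i> * pi * \<tau> - 2 * \<i> * pi * (u + tors \<tau> \<alpha>))
        = exp (- \<i> * pi * \<tau> - 2 * \<i> * pi * u)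
        * exp (- (2 * \<i> * pi * (of_int (to_int_mod_ring (snd \<alpha>)) / of_nat N)))
        * exp (2 * \<i> * pi * (of_int (to_int_mod_ring (fst \<alpha>)) / of_nat N) * u)"
      unfolding exp_add[symmetric] tors_def assms
      by (rule arg_cong[of _ _ exp]) (simp add: algebra_simps add_divide_distrib)
    ultimately show ?thesis by (simp only: q_def) simp
  qed
  define A where "A = (\<Prod>\<alpha>\<in>UNIV. - chi (fst (\<alpha> :: 'n zn2)))"
  define B where "B = (\<Prod>\<alpha>\<in>UNIV. - chi (- snd (\<alpha> :: 'n zn2)))"
  have nAB: "norm A = 1" "norm B = 1" by (simp_all add: A_def B_def prod_norm[symmetric])
  have card2: "card (UNIV :: 'n zn2 set) = N\<^sup>2"
    by (simp add: UNIV_Times_UNIV[symmetric] card_cartesian_product assms power2_eq_square del: UNIV_Times_UNIV)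
  have Q1: "Q (u + 1) = A * Q u" for u
    unfolding Q_def q1 A_def by (rule prod.distrib)
  have Qt: "Q (u + \<tau>) = exp (- \<i> * pi * (of_nat N)\<^sup>2 * \<tau> - 2 * \<i> * pi * (of_nat N)\<^sup>2 * u) * B * Q u" for u
  proof -
    have "Q (u + \<tau>) = (\<Prod>\<alpha>\<in>UNIV. exp (- \<i> * pi * \<tau> - 2 * \<i> * pi * u) * (- chi (- snd (\<alpha> :: 'n zn2))) * q \<alpha> u)"
      unfolding Q_def qt by simp
    also have "\<dots> = exp (- \<i> * pi * \<tau> - 2 * \<i> * pi * u) ^ N\<^sup>2 * B * Q u"
      by (simp only: prod.distrib B_def Q_def prod_constant card2)
    also have "exp (- \<i> * pi * \<tau> - 2 * \<i> * pi * u) ^ N\<^sup>2 = exp (- \<i> * pi * (of_nat N)\<^sup>2 * \<tau> - 2 * \<i> * pi * (of_nat N)\<^sup>2 * u)"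
      unfolding exp_of_nat_mult[symmetric] by (rule arg_cong[of _ _ exp]) (simp add: algebra_simps)
    finally show ?thesis .
  qed
  have g1: "g (u + 1) = (-1) ^ N * g u" for u
    using th_plus_nat[OF im, of "of_nat N * u" N] by (simp add: g_def distrib_left)
  have gt: "g (u + \<tau>) = (-1) ^ N * exp (- \<i> * pi * (of_nat N)\<^sup>2 * \<tau> - 2 * \<i> * pi * (of_nat N)\<^sup>2 * u) * g u" for u
    using th_quasi_nat[OF im, of "of_nat N * u" N] by (simp add: g_def distrib_left power2_eq_square mult.assoc)
  have gd: "(g has_field_derivative of_nat N * deriv (th \<tau>) (of_nat N * u)) (at u)" for u
    unfolding g_def[abs_def]
    by (rule DERIV_chain'[OF _ deriv_th[OF im], THEN DERIV_cong]) (auto intro!: derivative_eq_intros)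
  obtain h where h: "h holomorphic_on UNIV" "\<And>u. Q u = g u * h u"
  proof (rule entire_divide_simple_zeros[OF Qhol ghol])
    fix u assume gu: "g u = 0"
    then obtain k l :: int where kl: "of_nat N * u = of_int k * \<tau> + of_int l"
      using th_zero_iff[OF im] by (auto simp: g_def)
    \<comment> \<open>The index is chosen as minus the class of (k, l) modulo N, so that adding its
      torsion point moves u into the lattice; \<open>m1\<close> and \<open>m2\<close> measure the
      choice of representatives.\<close>
    define \<alpha> where "\<alpha> = (- of_int k :: 'n mod_ring, - of_int l :: 'n mod_ring)"
    have mi: "\<exists>m::int. to_int_mod_ring (- of_int k :: 'n mod_ring) = - k + int N * m" for k
    proof -
      have "to_int_mod_ring (of_int (- k) :: 'n mod_ring) = (- k) mod int N"
        by (simp only: to_int_mod_ring_of_int assms)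
      then show ?thesis by (intro exI[of _ "- ((- k) div int N)"]) (simp add: minus_mult_div_eq_mod[symmetric])
    qed
    obtain m1 m2 :: int where m: "to_int_mod_ring (fst \<alpha>) = - k + int N * m1" "to_int_mod_ring (snd \<alpha>) = - l + int N * m2"
      using mi[of k] mi[of l] by (auto simp: \<alpha>_def)
    have "u + tors \<tau> \<alpha> = of_int m1 * \<tau> + of_int m2"
    proof -
      have "of_nat N * (u + tors \<tau> \<alpha>) = of_nat N * u
          + (of_int (to_int_mod_ring (fst \<alpha>)) * \<tau> + of_int (to_int_mod_ring (snd \<alpha>)))"
        using N0 by (simp add: tors_def assms distrib_left[of _ u])
      also have "\<dots> = of_nat N * (of_int m1 * \<tau> + of_int m2)" unfolding kl by (simp add: m algebra_simps)
      finally have "of_nat N * (u + tors \<tau> \<alpha>) = of_nat N * (of_int m1 * \<tau> + of_int m2)" .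
      then show ?thesis using N0 by simp
    qed
    then have "th \<tau> (u + tors \<tau> \<alpha>) = 0" using th_zero_iff[OF im] by blast
    then have "q \<alpha> u = 0" by (simp add: q_def)
    then have "Q u = 0" unfolding Q_def by (intro prod_zero finite bexI[of _ \<alpha>] UNIV_I)
    moreover have "deriv g u \<noteq> 0"
      using deriv_th_zero[OF im] gu DERIV_imp_deriv[OF gd] N0 by (simp add: g_def)
    ultimately show "Q u = 0 \<and> deriv g u \<noteq> 0" by blast
  qed (rule that)
  have gnz: "g (1 / (2 * of_nat N)) \<noteq> 0" using th_half[OF im] N0 by (simp add: g_def)
  have h1: "h (u + 1) = A * (-1) ^ N * h u" for u
  proof (rule entire_cancel[where A = g and f = "\<lambda>u. h (u + 1)" and g = "\<lambda>u. A * (-1) ^ N * h u" and z = u, OF _ _ ghol gnz])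
    show "(\<lambda>u. h (u + 1)) holomorphic_on UNIV" using holomorphic_compose_affine[OF h(1), of 1 1] by simp
    show "(\<lambda>u. A * (-1) ^ N * h u) holomorphic_on UNIV" using h(1) by (auto intro!: holomorphic_intros)
    fix z
    have "(-1) ^ N * (g z * h (z + 1)) = A * (g z * h z)" using Q1[of z] unfolding h(2) g1 by (simp add: mult_ac)
    then have "(-1) ^ N * ((-1) ^ N * (g z * h (z + 1))) = (-1) ^ N * (A * (g z * h z))" by (simp only:)
    moreover have "(-1 :: complex) ^ N * ((-1) ^ N * (g z * h (z + 1))) = g z * h (z + 1)"
      unfolding mult.assoc[symmetric] power_mult_distrib[symmetric] by simp
    ultimately show "g z * h (z + 1) = g z * (A * (-1) ^ N * h z)" by (simp only: mult_ac)
  qed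
  have ht: "h (u + \<tau>) = B * (-1) ^ N * h u" for u
  proof (rule entire_cancel[where A = g and f = "\<lambda>u. h (u + \<tau>)" and g = "\<lambda>u. B * (-1) ^ N * h u" and z = u, OF _ _ ghol gnz])
    show "(\<lambda>u. h (u + \<tau>)) holomorphic_on UNIV" using holomorphic_compose_affine[OF h(1), of 1 \<tau>] by simp
    show "(\<lambda>u. B * (-1) ^ N * h u) holomorphic_on UNIV" using h(1) by (auto intro!: holomorphic_intros)
    fix z
    define e where "e = exp (- \<i> * pi * (of_nat N)\<^sup>2 * \<tau> - 2 * \<i> * pi * (of_nat N)\<^sup>2 * z)"
    have e: "e \<noteq> 0" by (simp add: e_def)
    have "e * ((-1) ^ N * (g z * h (z + \<tau>))) = e * (B * (g z * h z))"
      using Qt[of z] unfolding h(2) gt e_def[symmetric] by (simp add: mult_ac)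
    then have "(-1) ^ N * (g z * h (z + \<tau>)) = B * (g z * h z)" using e mult_left_cancel by blast
    then have "(-1) ^ N * ((-1) ^ N * (g z * h (z + \<tau>))) = (-1) ^ N * (B * (g z * h z))" by (simp only:)
    moreover have "(-1 :: complex) ^ N * ((-1) ^ N * (g z * h (z + \<tau>))) = g z * h (z + \<tau>)"
      unfolding mult.assoc[symmetric] power_mult_distrib[symmetric] by simp
    ultimately show "g z * h (z + \<tau>) = g z * (B * (-1) ^ N * h z)" by (simp only: mult_ac)
  qed
  obtain c where c: "\<And>u. h u = c"
    by (rule entire_doubly_periodic_norm_const[OF h(1) im]) (auto simp: h1 ht norm_mult norm_power nAB)
  have "Q u = c * g u" for u by (simp add: h(2) c)
  then show ?thesis unfolding Q_def q_def g_def by (intro exI[of _ c] allI)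
qed


text \<open>As a function of u the sum has order two. For \<gamma> \<noteq> 0 it has a double zero
  at 0 but the wrong multipliers, so it vanishes. For \<gamma> = 0 its difference from the
  right-hand side has a double zero, and comparing second-order terms removes the remaining multiple
  of the square of \<open>th\<close>.\<close>

lemma unitarity_convolution:
  assumes reg: "regular_at CARD('n::nontriv) \<tau> y"
  shows "(\<Sum>\<alpha>\<in>UNIV. br \<alpha> \<gamma> * (phi \<tau> \<alpha> u y * phi \<tau> (\<gamma> - \<alpha>) u (- y)))
    = (if \<gamma> = (0 :: 'n zn2) then (of_nat CARD('n))\<^sup>2 * th \<tau> (of_nat CARD('n) * y + u) * th \<tau> (of_nat CARD('n) * y - u)
         / (th \<tau> (of_nat CARD('n) * y))\<^sup>2 else 0)"
proof -
  define N where "N = CARD('n)"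
  have N0: "N > 0" "(of_nat N :: complex) \<noteq> 0" by (simp_all add: N_def)
  have regm: "regular_at CARD('n) \<tau> (- y)" by (rule regular_minus[OF im reg])
  define F where "F \<gamma> u = (\<Sum>\<alpha>\<in>UNIV. br \<alpha> \<gamma> * (phi \<tau> \<alpha> u y * phi \<tau> (\<gamma> - \<alpha>) u (- y)))" for \<gamma> :: "'n zn2" and u
  have phol: "(\<lambda>u. phi \<tau> \<alpha> u y) holomorphic_on UNIV" for \<alpha> :: "'n zn2" and y
    by (intro holomorphic_phi[OF im] holomorphic_intros)
  have Fhol: "F \<gamma> holomorphic_on UNIV" for \<gamma>
    unfolding F_def[abs_def] by (intro holomorphic_intros phol)
  have F1: "F \<gamma> (u + 1) = chi (fst \<gamma>) * F \<gamma> u" for \<gamma> u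
  proof -
    have "phi \<tau> \<alpha> (u + 1) y * phi \<tau> (\<gamma> - \<alpha>) (u + 1) (- y) = chi (fst \<gamma>) * (phi \<tau> \<alpha> u y * phi \<tau> (\<gamma> - \<alpha>) u (- y))" for \<alpha>
      using chi_add[of "fst \<alpha>" "fst (\<gamma> - \<alpha>)"] unfolding phi_plus_1[OF im] by (simp add: mult_ac)
    then show ?thesis unfolding F_def by (simp only: sum_distrib_left mult.left_commute)
  qed
  have Ft: "F \<gamma> (u + \<tau>) = chi (- snd \<gamma>) * exp (- 2 * \<i> * pi * \<tau> - 4 * \<i> * pi * u) * F \<gamma> u" for \<gamma> u
  proof -
    define E where "E = exp (- 2 * \<i> * pi * \<tau> - 4 * \<i> * pi * u)"
    have E: "exp (- \<i> * pi * \<tau> - 2 * \<i> * pi * (u + y)) * exp (- \<i> * pi * \<tau> - 2 * \<i> * pi * (u + - y)) = E"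
      unfolding E_def exp_add[symmetric] by (rule arg_cong[of _ _ exp]) (simp add: algebra_simps)
    have "phi \<tau> \<alpha> (u + \<tau>) y * phi \<tau> (\<gamma> - \<alpha>) (u + \<tau>) (- y) = chi (- snd \<gamma>) * E * (phi \<tau> \<alpha> u y * phi \<tau> (\<gamma> - \<alpha>) u (- y))" for \<alpha>
    proof -
      have "chi (- snd \<gamma>) = chi (- snd \<alpha>) * chi (- snd (\<gamma> - \<alpha>))" unfolding chi_add[symmetric] by simp
      then show ?thesis unfolding phi_plus_tau[OF im] E[symmetric] by (simp add: mult_ac)
    qed
    then show ?thesis unfolding F_def E_def[symmetric] by (simp only: sum_distrib_left mult.left_commute)
  qed
  have F0: "F \<gamma> 0 = (if \<gamma> = 0 then (of_nat N)\<^sup>2 else 0)" for \<gamma>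
    by (simp add: F_def phi_0[OF im reg] phi_0[OF im regm] sum_br N_def)
  show ?thesis
  proof (cases "\<gamma> = 0")
    case False
    \<comment> \<open>The derivative of the second factor at 0 is expressed by that of the first
      through \<open>phi_minus\<close>. The resulting two sums agree after translating \<alpha> by
      \<gamma>, because \<open>br \<gamma> \<gamma> = 1\<close>.\<close>
    define D where "D \<alpha> = deriv (\<lambda>u. phi \<tau> \<alpha> u y) 0" for \<alpha> :: "'n zn2"
    have dD: "((\<lambda>u. phi \<tau> \<alpha> u y) has_field_derivative D \<alpha>) (at 0)" for \<alpha>
      unfolding D_def by (rule holomorphic_derivI[OF phol]) auto
    have dm: "((\<lambda>u. phi \<tau> \<alpha> u (- y)) has_field_derivative - D (- \<alpha>)) (at 0)" for \<alpha>
    proof -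
      have "((\<lambda>u. phi \<tau> (- \<alpha>) (- u) y) has_field_derivative D (- \<alpha>) * (- 1)) (at 0)"
        by (rule DERIV_chain'[of uminus "-1" 0]) (use dD[of "- \<alpha>"] in \<open>auto intro!: derivative_eq_intros\<close>)
      then show ?thesis by (simp add: phi_minus[OF im])
    qed
    have "(F \<gamma> has_field_derivative (\<Sum>\<alpha>\<in>UNIV. br \<alpha> \<gamma> * (D \<alpha> - D (\<alpha> - \<gamma>)))) (at 0)"
      unfolding F_def[abs_def]
    proof (rule DERIV_sum)
      fix \<alpha> :: "'n zn2"
      show "((\<lambda>u. br \<alpha> \<gamma> * (phi \<tau> \<alpha> u y * phi \<tau> (\<gamma> - \<alpha>) u (- y))) has_field_derivative br \<alpha> \<gamma> * (D \<alpha> - D (\<alpha> - \<gamma>))) (at 0)"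
        by (rule DERIV_cmult, rule DERIV_cong[OF DERIV_mult[OF dD dm]])
          (simp add: phi_0[OF im reg] phi_0[OF im regm])
    qed
    moreover have "(\<Sum>\<alpha>\<in>UNIV. br \<alpha> \<gamma> * (D \<alpha> - D (\<alpha> - \<gamma>))) = 0"
    proof -
      have "(\<Sum>\<alpha>\<in>UNIV. br \<alpha> \<gamma> * D (\<alpha> - \<gamma>)) = (\<Sum>\<alpha>\<in>UNIV. br (\<alpha> + \<gamma>) \<gamma> * D \<alpha>)"
        by (rule sum.reindex_bij_witness[of _ "\<lambda>\<alpha>. \<alpha> + \<gamma>" "\<lambda>\<alpha>. \<alpha> - \<gamma>"]) auto
      then show ?thesis by (simp add: br_add right_diff_distrib sum_subtractf)
    qed
    ultimately have dF: "deriv (F \<gamma>) 0 = 0" by (simp add: DERIV_imp_deriv)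
    have F00: "F \<gamma> 0 = 0" using False by (simp add: F0)
    obtain C where C: "\<forall>u. F \<gamma> u = C * (th \<tau> u)\<^sup>2"
      using order_two_double_zero[OF Fhol F00 dF F1 Ft norm_chi norm_chi] by (elim exE)
    \<comment> \<open>The square of \<open>th\<close> has multiplier 1 under u + 1, and under u +
      \<tau> no extra phase, whereas \<open>F \<gamma>\<close> carries the phases of \<gamma>. A
      nonzero C would make both phases trivial, so \<gamma> = 0.\<close>
    have "C = 0"
    proof (rule ccontr)
      assume C0: "C \<noteq> 0"
      have "C * (th \<tau> (1/2))\<^sup>2 = chi (fst \<gamma>) * (C * (th \<tau> (1/2))\<^sup>2)"
        using F1[of \<gamma> "1/2"] th_plus_1[OF im, of "1/2"] unfolding C[rule_format] by simp
      then have 1: "chi (fst \<gamma>) = 1" using C0 th_half[OF im] by simp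
      define e where "e = exp (- \<i> * pi * \<tau> - 2 * \<i> * pi * (1/2))"
      have ee: "exp (- 2 * \<i> * pi * \<tau> - 4 * \<i> * pi * (1/2)) = e\<^sup>2"
        unfolding e_def power2_eq_square exp_add[symmetric] by (rule arg_cong[of _ _ exp]) (simp add: algebra_simps)
      have "e\<^sup>2 * (C * (th \<tau> (1/2))\<^sup>2) = chi (- snd \<gamma>) * (e\<^sup>2 * (C * (th \<tau> (1/2))\<^sup>2))"
        using Ft[of \<gamma> "1/2"] unfolding C[rule_format] th_plus_tau[OF im] ee e_def[symmetric]
        by (simp add: power_mult_distrib mult_ac)
      moreover have "e\<^sup>2 * (C * (th \<tau> (1/2))\<^sup>2) \<noteq> 0" using C0 th_half[OF im] by (simp add: e_def)
      ultimately have "chi (- snd \<gamma>) = 1" by simp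
      then have "snd \<gamma> = 0" by (simp add: chi_eq_1_iff)
      with 1 False show False by (simp add: chi_eq_1_iff prod_eq_iff)
    qed
    then have "F \<gamma> u = 0" using C by simp
    then show ?thesis using False by (simp add: F_def)
  next
    case True
    define Y where "Y = of_nat N * y"
    have Y0: "th \<tau> Y \<noteq> 0" using regular_multiple[OF im reg] by (simp add: Y_def N_def)
    define H where "H u = th \<tau> (Y + u) * th \<tau> (Y - u) / (th \<tau> Y)\<^sup>2" for u
    have Hhol: "H holomorphic_on UNIV" unfolding H_def[abs_def]
      by (intro holomorphic_intros holomorphic_th[OF im]) (use Y0 in auto)
    obtain mH where mH: "mH holomorphic_on UNIV" "\<forall>u. H u = 1 + u\<^sup>2 * mH u"
      using even_entire_expansion[OF Hhol] Y0
      by (auto simp: H_def power2_eq_square mult.commute)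
    define p where "p \<alpha> u = phi \<tau> \<alpha> u y * phi \<tau> \<alpha> (- u) y" for \<alpha> :: "'n zn2" and u
    have pF: "F 0 u = (\<Sum>\<alpha>\<in>UNIV. p \<alpha> u)" for u
    proof -
      have "phi \<tau> (- \<alpha>) u (- y) = phi \<tau> \<alpha> (- u) y" for \<alpha> :: "'n zn2"
        using phi_minus[OF im, of "- \<alpha>" u y] by simp
      then show ?thesis by (simp add: F_def p_def)
    qed
    have ex: "\<exists>m. m holomorphic_on UNIV \<and> (\<forall>u. p \<alpha> u = 1 + u\<^sup>2 * m u)" for \<alpha>
    proof (rule even_entire_expansion)
      show "p \<alpha> holomorphic_on UNIV"
        unfolding p_def[abs_def] by (intro holomorphic_intros phol holomorphic_phi[OF im])
    qed (simp_all add: p_def phi_0[OF im reg] mult.commute)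
    define m where "m \<alpha> = (SOME m. m holomorphic_on UNIV \<and> (\<forall>u. p \<alpha> u = 1 + u\<^sup>2 * m u))" for \<alpha>
    have ms: "m \<alpha> holomorphic_on UNIV \<and> (\<forall>u. p \<alpha> u = 1 + u\<^sup>2 * m \<alpha> u)" for \<alpha>
      unfolding m_def by (rule someI_ex[OF ex])
    have m: "m \<alpha> holomorphic_on UNIV" "p \<alpha> u = 1 + u\<^sup>2 * m \<alpha> u" for \<alpha> u
      using ms by blast+
    obtain M where M: "M holomorphic_on UNIV" "M 0 = (\<Sum>\<alpha>\<in>UNIV. m \<alpha> 0)"
      "\<forall>u. (\<Prod>\<alpha>\<in>UNIV. 1 + u\<^sup>2 * m \<alpha> u) = 1 + u\<^sup>2 * M u"
      using prod_even_entire_expansion[of UNIV m] m(1) by auto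
    \<comment> \<open>The multiplication formula is applied at y + u, y - u and y; its unknown
      constant cancels in the quotient.\<close>
    have prodp: "(\<Prod>\<alpha>\<in>UNIV. p \<alpha> u) = H (of_nat N * u)" for u
    proof -
      define q where "q \<alpha> u = exp (2 * \<i> * pi * (of_int (to_int_mod_ring (fst \<alpha>)) / of_nat N) * u) * th \<tau> (u + tors \<tau> \<alpha>)"
        for \<alpha> :: "'n zn2" and u
      obtain c where c: "\<forall>u. (\<Prod>\<alpha>\<in>(UNIV :: 'n zn2 set). q \<alpha> u) = c * th \<tau> (of_nat N * u)"
        using prod_th_torsion[OF N_def[symmetric]] unfolding q_def by (elim exE)
      have q0: "q \<alpha> y \<noteq> 0" for \<alpha> using regular_tors[OF im reg, of \<alpha>] by (simp add: q_def)
      have c0: "c \<noteq> 0"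
      proof
        assume "c = 0"
        then have "(\<Prod>\<alpha>\<in>(UNIV :: 'n zn2 set). q \<alpha> y) = 0" using c by simp
        then show False using q0 by simp
      qed
      have pq: "phi \<tau> \<alpha> u y = q \<alpha> (y + u) / q \<alpha> y" for \<alpha> u
      proof -
        have "exp (2 * \<i> * pi * (of_int (to_int_mod_ring (fst \<alpha>)) / of_nat N) * (y + u))
          = exp (2 * \<i> * pi * (of_int (to_int_mod_ring (fst \<alpha>)) / of_nat N) * u)
          * exp (2 * \<i> * pi * (of_int (to_int_mod_ring (fst \<alpha>)) / of_nat N) * y)"
          unfolding exp_add[symmetric] using N0 by (intro arg_cong[of _ _ exp]) (simp add: field_simps)
        then show ?thesis by (simp only: q_def phi_def N_def add.commute[of y u]) simp
      qed
      have "(\<Prod>\<alpha>\<in>UNIV. p \<alpha> u) = (\<Prod>\<alpha>\<in>UNIV. q \<alpha> (y + u)) * (\<Prod>\<alpha>\<in>UNIV. q \<alpha> (y - u)) /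
          ((\<Prod>\<alpha>\<in>UNIV. q \<alpha> y) * (\<Prod>\<alpha>\<in>UNIV. q \<alpha> y))"
        unfolding p_def pq by (simp add: prod.distrib prod_dividef)
      also have "\<dots> = H (of_nat N * u)"
        unfolding c[rule_format] H_def Y_def using c0 by (simp add: power2_eq_square algebra_simps)
      finally show ?thesis .
    qed
    have mNhol: "(\<lambda>u. mH (of_nat N * u)) holomorphic_on UNIV"
      using holomorphic_compose_affine[OF mH(1), of "of_nat N" 0] by simp
    have "M 0 = (of_nat N)\<^sup>2 * mH (of_nat N * 0)"
    proof (rule entire_cancel[where A = "\<lambda>u. u\<^sup>2" and f = M and g = "\<lambda>u. (of_nat N)\<^sup>2 * mH (of_nat N * u)" and z = 0 and ?z0.0 = 1])
      show "(\<lambda>u. (of_nat N)\<^sup>2 * mH (of_nat N * u)) holomorphic_on UNIV"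
        by (intro holomorphic_intros mNhol)
      show "z\<^sup>2 * M z = z\<^sup>2 * ((of_nat N)\<^sup>2 * mH (of_nat N * z))" for z
        using prodp[of z] M(3)[rule_format, of z] mH(2)[rule_format, of "of_nat N * z"]
        by (simp add: m(2) power_mult_distrib mult_ac)
    qed (use M(1) in \<open>auto intro!: holomorphic_intros\<close>)
    \<comment> \<open>The u^2-coefficient of H(N u) is N^2 times that of H. This is precisely the
      coefficient of N^2 H(u), with which the sum has to be compared.\<close>
    then have sum0: "(\<Sum>\<alpha>\<in>UNIV. m \<alpha> 0) = (of_nat N)\<^sup>2 * mH 0" by (simp add: M(2))
    define K where "K u = (\<Sum>\<alpha>\<in>UNIV. m \<alpha> u) - (of_nat N)\<^sup>2 * mH u" for u
    have Khol: "K holomorphic_on UNIV" unfolding K_def[abs_def]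
      by (intro holomorphic_intros m(1) mH(1))
    have NN: "of_nat CARD('n) * of_nat CARD('n) = (of_nat N :: complex)\<^sup>2"
      by (simp add: N_def power2_eq_square)
    define D where "D u = F 0 u - (of_nat N)\<^sup>2 * H u" for u
    have DK: "D u = u\<^sup>2 * K u" for u
    proof -
      have "F 0 u = (of_nat N)\<^sup>2 + u\<^sup>2 * (\<Sum>\<alpha>\<in>UNIV. m \<alpha> u)"
        by (simp add: pF m(2) sum.distrib sum_distrib_left NN)
      then show ?thesis by (simp add: D_def mH(2) K_def algebra_simps)
    qed
    have Dhol: "D holomorphic_on UNIV" unfolding D_def[abs_def]
      by (intro holomorphic_intros Fhol Hhol)
    have D0: "D 0 = 0" by (simp add: DK)
    have dD: "deriv D 0 = 0"
    proof (rule DERIV_imp_deriv)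
      have "((\<lambda>u. u\<^sup>2 * K u) has_field_derivative 0) (at 0)"
        using holomorphic_derivI[OF Khol, of 0] by (auto intro!: derivative_eq_intros)
      then show "(D has_field_derivative 0) (at 0)" by (simp add: DK[abs_def])
    qed
    have H1: "H (u + 1) = H u" for u
    proof -
      have "th \<tau> (Y + (u + 1)) = - th \<tau> (Y + u)" using th_plus_1[OF im, of "Y + u"] by (simp add: add_ac)
      moreover have "th \<tau> (Y - (u + 1)) = - th \<tau> (Y - u)"
        using th_plus_1[OF im, of "Y - u - 1"] by (simp add: algebra_simps)
      ultimately show ?thesis by (simp add: H_def)
    qed
    have Ht: "H (u + \<tau>) = exp (- 2 * \<i> * pi * \<tau> - 4 * \<i> * pi * u) * H u" for u
    proof -
      define e1 where "e1 = exp (- \<i> * pi * \<tau> - 2 * \<i> * pi * (Y + u))"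
      define e2 where "e2 = exp (- \<i> * pi * \<tau> - 2 * \<i> * pi * (Y - (u + \<tau>)))"
      have 1: "th \<tau> (Y + (u + \<tau>)) = - e1 * th \<tau> (Y + u)"
        using th_plus_tau[OF im, of "Y + u"] by (simp add: add_ac e1_def)
      have 2: "th \<tau> (Y - u) = - e2 * th \<tau> (Y - (u + \<tau>))"
        using th_plus_tau[OF im, of "Y - (u + \<tau>)"] by (simp add: e2_def)
      have e: "e1 = exp (- 2 * \<i> * pi * \<tau> - 4 * \<i> * pi * u) * e2"
        unfolding e1_def e2_def exp_add[symmetric] by (rule arg_cong[of _ _ exp]) (simp add: algebra_simps)
      show ?thesis unfolding H_def 1 2 e by (simp add: mult_ac)
    qed
    obtain C where C: "\<forall>u. D u = C * (th \<tau> u)\<^sup>2"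
    proof -
      have "\<exists>C. \<forall>u. D u = C * (th \<tau> u)\<^sup>2"
      proof (rule order_two_double_zero[OF Dhol D0 dD])
        show "D (u + 1) = 1 * D u" for u by (simp add: D_def H1 F1)
        show "D (u + \<tau>) = 1 * exp (- 2 * \<i> * pi * \<tau> - 4 * \<i> * pi * u) * D u" for u
          unfolding D_def Ht Ft by (simp add: algebra_simps)
      qed auto
      then show ?thesis by (elim exE) (rule that)
    qed
    obtain t where t: "t holomorphic_on UNIV" "\<And>u. th \<tau> u = u * t u" "t 0 = deriv (th \<tau>) 0"
      using th_holomorphic[OF im] th_0[OF im] by (rule entire_divide_monomial) (rule that)
    \<comment> \<open>Both sides are the u^2-coefficient of \<open>D\<close>. Since
      \<open>K 0 = 0\<close> and \<open>t 0\<close>, the derivative of \<open>th\<close> at 0, is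
      nonzero, C vanishes.\<close>
    have "K 0 = C * (t 0)\<^sup>2"
    proof (rule entire_cancel[where A = "\<lambda>u. u\<^sup>2" and f = K and g = "\<lambda>u. C * (t u)\<^sup>2" and z = 0 and ?z0.0 = 1])
      show "z\<^sup>2 * K z = z\<^sup>2 * (C * (t z)\<^sup>2)" for z
        using C[rule_format, of z] by (simp add: DK t(2) power_mult_distrib mult_ac)
    qed (use Khol t(1) in \<open>auto intro!: holomorphic_intros\<close>)
    moreover have "K 0 = 0" by (simp add: K_def sum0)
    ultimately have "C = 0" using deriv_th_0[OF im] t(3) by simp
    then have "D u = 0" using C by simp
    then show ?thesis using True by (simp add: D_def F_def H_def Y_def N_def)
  qed
qed

end

section \<open>The scalar factor\<close>

lemma norm_q_of: "norm (q_of \<zeta>) < 1 \<longleftrightarrow> Im \<zeta> > 0"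
  by (simp add: q_of_def zero_less_mult_iff)

lemma q_of_nonzero [simp]: "q_of \<zeta> \<noteq> 0" by (simp add: q_of_def)

lemma q_of_power: "q_of \<zeta> ^ (2 * n) = exp (2 * \<i> * pi * (of_nat n * \<zeta>))"
  unfolding q_of_def exp_of_nat_mult[symmetric] by (rule arg_cong[of _ _ exp]) simp

text \<open>This is the product of \<open>tauN\<close> at \<zeta>/2 - u and at \<zeta>/2 + u; the
  remaining scalar factors of the R-matrix and its theta sum contribute 1 to unitarity.\<close>

definition unitarity_factor :: "nat \<Rightarrow> complex \<Rightarrow> complex \<Rightarrow> complex" where
  "unitarity_factor N \<zeta> u =
     (let x = exp (2 * \<i> * pi * u); q = q_of \<zeta>; \<Theta> = Theta (q ^ (2 * N)) in
      exp (\<i> * pi * \<zeta> * (2 / of_nat N - 2)) * (\<Theta> (q\<^sup>2 / x) * \<Theta> (q\<^sup>2 * x) / (\<Theta> x * \<Theta> (1 / x))))"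

text \<open>All scalar prefactors of \<open>Rhat\<close> together. The powers of z in
  \<open>tauN\<close> and in \<open>Rtilde\<close> cancel up to the constant exponential, so no
  fractional power of z is left in the prefactor.\<close>

definition scalar_factor :: "nat \<Rightarrow> complex \<Rightarrow> complex \<Rightarrow> complex \<Rightarrow> complex" where
  "scalar_factor N \<zeta> \<tau> u =
     (let x = exp (2 * \<i> * pi * u); q = q_of \<zeta>; \<Theta> = Theta (q ^ (2 * N)) in
      exp (\<i> * pi * \<zeta> / 2 * (2 / of_nat N - 2)) * (\<Theta> (q\<^sup>2 / x) / \<Theta> x)
        * inv_kappa N q (p_of \<tau>) x * (th \<tau> \<zeta> / th \<tau> (u + \<zeta>)))"

text \<open>Every factor that is ever cancelled is nonzero, for x as well as for 1/x, so that
  fractions may be cleared in identities at u and at -u.\<close>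

definition generic_at :: "nat \<Rightarrow> complex \<Rightarrow> complex \<Rightarrow> complex \<Rightarrow> bool" where
  "generic_at N \<zeta> \<tau> u \<longleftrightarrow>
     (let x = exp (2 * \<i> * pi * u); q = q_of \<zeta>; p = p_of \<tau>; a = q ^ (2 * N); P = (\<lambda>y. qpoch y [p, a]) in
      Theta a x \<noteq> 0 \<and> Theta a (1 / x) \<noteq> 0 \<and> Theta a (q\<^sup>2 * x) \<noteq> 0 \<and> Theta a (q\<^sup>2 / x) \<noteq> 0
      \<and> P (a * x) \<noteq> 0 \<and> P (a / x) \<noteq> 0 \<and> P (q\<^sup>2 * x) \<noteq> 0 \<and> P (q\<^sup>2 / x) \<noteq> 0
      \<and> P (p * x) \<noteq> 0 \<and> P (p / x) \<noteq> 0
      \<and> P (p * q ^ (2 * N - 2) * x) \<noteq> 0 \<and> P (p * q ^ (2 * N - 2) / x) \<noteq> 0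
      \<and> th \<tau> u \<noteq> 0 \<and> th \<tau> (u + \<zeta>) \<noteq> 0 \<and> th \<tau> (\<zeta> - u) \<noteq> 0)"

lemma tauN_scalar_factor:
  "tauN N \<zeta> (\<zeta> / 2 - u) * (exp (\<i> * pi * u * (2 / of_nat N - 2))
      * inv_kappa N (q_of \<zeta>) (p_of \<tau>) (exp (2 * \<i> * pi * u)) * (th \<tau> \<zeta> / th \<tau> (u + \<zeta>)))
   = scalar_factor N \<zeta> \<tau> u"
proof -
  define x where "x = exp (2 * \<i> * pi * u)"
  define d where "d = 2 / of_nat N - (2 :: complex)"
  have zz: "exp (2 * \<i> * pi * (\<zeta> / 2 - u)) = q_of \<zeta> / x"
    unfolding q_of_def x_def exp_diff[symmetric] by (rule arg_cong[of _ _ exp]) (simp add: algebra_simps)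
  have e: "exp (\<i> * pi * (\<zeta> / 2 - u) * d) * exp (\<i> * pi * u * d) = exp (\<i> * pi * \<zeta> / 2 * d)"
    unfolding exp_add[symmetric] by (rule arg_cong[of _ _ exp]) (simp add: algebra_simps)
  have x0: "x \<noteq> 0" by (simp add: x_def)
  have "tauN N \<zeta> (\<zeta> / 2 - u) = exp (\<i> * pi * (\<zeta> / 2 - u) * d)
     * (Theta (q_of \<zeta> ^ (2 * N)) ((q_of \<zeta>)\<^sup>2 / x) / Theta (q_of \<zeta> ^ (2 * N)) x)"
    unfolding tauN_def Let_def zz d_def using x0 by (simp add: power2_eq_square)
  then show ?thesis
    unfolding scalar_factor_def Let_def x_def[symmetric] d_def[symmetric] e[symmetric] by (simp only: mult_ac)
qed

context
  fixes N :: nat and \<zeta> :: complex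
  assumes N: "N \<ge> 1" and imz: "Im \<zeta> > 0"
begin

lemma norm_q_of_power_less_1: "norm (q_of \<zeta> ^ (2 * N)) < 1"
  using N imz norm_q_of[of \<zeta>] by (simp add: norm_power power_less_one_iff)

lemma Theta_a_shift: "x \<noteq> 0 \<Longrightarrow> Theta (q_of \<zeta> ^ (2 * N)) (q_of \<zeta> ^ (2 * N) * x) = - Theta (q_of \<zeta> ^ (2 * N)) x / x"
  using norm_q_of_power_less_1 by (intro Theta_shift) auto

lemma Theta_a_inverse: "x \<noteq> 0 \<Longrightarrow> Theta (q_of \<zeta> ^ (2 * N)) (1 / x) = - Theta (q_of \<zeta> ^ (2 * N)) x / x"
  using norm_q_of_power_less_1 by (intro Theta_inverse) auto

lemma unitarity_factor_minus: "unitarity_factor N \<zeta> (- u) = unitarity_factor N \<zeta> u"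
  by (simp add: unitarity_factor_def Let_def exp_minus inverse_eq_divide mult_ac)

lemma unitarity_factor_plus_int: "unitarity_factor N \<zeta> (u + of_int k) = unitarity_factor N \<zeta> u"
proof -
  have "exp (2 * \<i> * pi * (u + of_int k)) = exp (2 * \<i> * pi * u)"
    using exp_add_2pi_int[of "2 * \<i> * pi * u" k] by (simp only: distrib_left)
  then show ?thesis by (simp only: unitarity_factor_def)
qed

text \<open>Inversion of the theta arguments brings the factor into the shape of
  \<open>Yfactor\<close>, which is written in the square of w/z = exp(-i pi u).\<close>

lemma unitarity_factor_alt:
  "unitarity_factor N \<zeta> u = exp (\<i> * pi * \<zeta> * (2 / of_nat N - 2)) * (q_of \<zeta>)\<^sup>2 *
     (Theta (q_of \<zeta> ^ (2 * N)) (exp (- 2 * \<i> * pi * u) * (q_of \<zeta>)\<^sup>2)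
       * Theta (q_of \<zeta> ^ (2 * N)) (exp (- 2 * \<i> * pi * u) / (q_of \<zeta>)\<^sup>2)
       / (Theta (q_of \<zeta> ^ (2 * N)) (exp (- 2 * \<i> * pi * u)))\<^sup>2)"
proof -
  define X where "X = exp (- 2 * \<i> * pi * u)"
  define T where "T = Theta (q_of \<zeta> ^ (2 * N))"
  have x: "exp (2 * \<i> * pi * u) = 1 / X" by (simp add: X_def exp_minus inverse_eq_divide)
  have X0: "X \<noteq> 0" by (simp add: X_def)
  have 1: "T ((q_of \<zeta>)\<^sup>2 * (1 / X)) = - T (X / (q_of \<zeta>)\<^sup>2) * (q_of \<zeta>)\<^sup>2 / X"
    using Theta_a_inverse[of "X / (q_of \<zeta>)\<^sup>2"] X0 by (simp add: T_def)
  have 2: "T (1 / X) = - T X / X" using Theta_a_inverse[OF X0] by (simp add: T_def)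
  have 3: "(q_of \<zeta>)\<^sup>2 / (1 / X) = X * (q_of \<zeta>)\<^sup>2" "1 / (1 / X) = X" using X0 by simp_all
  show ?thesis
    unfolding unitarity_factor_def Let_def x X_def[symmetric] T_def[symmetric] 3 1 2
    using X0 by (simp add: power2_eq_square divide_simps)
qed

text \<open>Multiplying x by a = q^(2N) produces automorphy factors with the same product in
  numerator and denominator.\<close>

lemma unitarity_factor_quasiperiod: "unitarity_factor N \<zeta> (u + of_nat N * \<zeta>) = unitarity_factor N \<zeta> u"
proof -
  define a where "a = q_of \<zeta> ^ (2 * N)"
  define T where "T = Theta a"
  define x where "x = exp (2 * \<i> * pi * u)"
  have x0: "x \<noteq> 0" "a \<noteq> 0" by (simp_all add: x_def a_def)
  have ax: "exp (2 * \<i> * pi * (u + of_nat N * \<zeta>)) = a * x"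
    unfolding a_def q_of_power x_def exp_add[symmetric] by (rule arg_cong[of _ _ exp]) (simp add: algebra_simps)
  have sh: "T (a * y) = - T y / y" if "y \<noteq> 0" for y
    using Theta_a_shift[OF that] by (simp add: T_def a_def)
  have 1: "T ((q_of \<zeta>)\<^sup>2 * (a * x)) = - T ((q_of \<zeta>)\<^sup>2 * x) / ((q_of \<zeta>)\<^sup>2 * x)"
    using sh[of "(q_of \<zeta>)\<^sup>2 * x"] x0 by (simp add: mult_ac)
  have 2: "T (a * x) = - T x / x" using sh[of x] x0 by simp
  have 3: "T (1 / (a * x)) = - T (1 / x) / (a * x)"
    using sh[of "1 / (a * x)"] x0 by (simp add: field_simps)
  have 4: "T ((q_of \<zeta>)\<^sup>2 / (a * x)) = - T ((q_of \<zeta>)\<^sup>2 / x) * (q_of \<zeta>)\<^sup>2 / (a * x)"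
    using sh[of "(q_of \<zeta>)\<^sup>2 / (a * x)"] x0 by (simp add: field_simps)
  show ?thesis
    unfolding unitarity_factor_def Let_def ax x_def[symmetric] a_def[symmetric] T_def[symmetric] 1 2 3 4
    using x0 by (simp add: divide_simps)
qed

text \<open>The substitution x to 1/x exchanges the numerator and the denominator factor by factor;
  genericity excludes 0 / 0.\<close>

lemma inv_kappa_minus:
  assumes "generic_at N \<zeta> \<tau> u"
  shows "inv_kappa N (q_of \<zeta>) (p_of \<tau>) (exp (2 * \<i> * pi * u)) *
    inv_kappa N (q_of \<zeta>) (p_of \<tau>) (1 / exp (2 * \<i> * pi * u)) = 1"
  using assms unfolding generic_at_def inv_kappa_def Let_def by (simp add: divide_simps)

lemma unitarity_factor_nonzero: "generic_at N \<zeta> \<tau> u \<Longrightarrow> unitarity_factor N \<zeta> u \<noteq> 0"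
  by (simp add: generic_at_def unitarity_factor_def Let_def)

lemma cosparse_generic_at:
  assumes im: "Im \<tau> > 0"
  shows "\<forall>\<^sub>\<approx>u. generic_at N \<zeta> \<tau> u"
proof -
  define a p where "a = q_of \<zeta> ^ (2 * N)" and "p = p_of \<tau>"
  have ap: "norm a < 1" "a \<noteq> 0" "norm p < 1" using norm_q_of_power_less_1 im by (simp_all add: a_def p_def norm_p_of)
  have plus: "\<forall>\<^sub>\<approx>u. qpoch (c * exp (2 * \<i> * pi * u)) [p, a] \<noteq> 0" for c
    using ap by (intro cosparse_qpoch_exp) auto
  have minus: "\<forall>\<^sub>\<approx>u. qpoch (c / exp (2 * \<i> * pi * u)) [p, a] \<noteq> 0" for c
    using cosparse_qpoch_exp[of "[p, a]" "- (2 * \<i> * pi)" c] ap by (simp add: exp_minus divide_inverse)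
  have aa: "qpoch a [a] \<noteq> 0"
  proof -
    have "a * a ^ n \<noteq> 1" for n
    proof
      assume "a * a ^ n = 1"
      then have "norm a ^ Suc n = 1" by (metis norm_power norm_one power_Suc)
      moreover have "norm a ^ Suc n < 1" using ap by (intro power_Suc_less_one) auto
      ultimately show False by simp
    qed
    then show ?thesis using ap by (simp add: qpoch_zero_iff)
  qed
  have T1: "\<forall>\<^sub>\<approx>u. Theta a (c * exp (2 * \<i> * pi * u)) \<noteq> 0" if "c \<noteq> 0" for c
  proof -
    have "\<forall>\<^sub>\<approx>u. qpoch (c * exp (2 * \<i> * pi * u)) [a] \<noteq> 0 \<and> qpoch (a / c * exp (- (2 * \<i> * pi) * u)) [a] \<noteq> 0"
      using ap by (intro eventually_conj cosparse_qpoch_exp) auto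
    then show ?thesis
      by (rule eventually_mono) (use aa that in \<open>auto simp: Theta_def exp_minus field_simps\<close>)
  qed
  have T2: "\<forall>\<^sub>\<approx>u. Theta a (c / exp (2 * \<i> * pi * u)) \<noteq> 0" if "c \<noteq> 0" for c
    using cosparse_reflect[OF T1[OF that], of 0] by (simp add: exp_minus divide_inverse)
  have t: "\<forall>\<^sub>\<approx>u. th \<tau> u \<noteq> 0"
    by (rule cosparse_entire_nonzero[OF th_holomorphic[OF im] th_half[OF im]])
  show ?thesis
    unfolding generic_at_def Let_def a_def[symmetric] p_def[symmetric]
    using T1[of 1] T2[of 1] T1[of "(q_of \<zeta>)\<^sup>2"] T2[of "(q_of \<zeta>)\<^sup>2"]
    by (intro eventually_conj plus minus t cosparse_shift[OF t] cosparse_reflect[OF t]) auto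
qed

lemma scalar_factor_unitarity:
  assumes im: "Im \<tau> > 0" and g: "generic_at N \<zeta> \<tau> u" and z: "th \<tau> \<zeta> \<noteq> 0"
  shows "scalar_factor N \<zeta> \<tau> u * scalar_factor N \<zeta> \<tau> (- u)
    * (th \<tau> (\<zeta> + u) * th \<tau> (\<zeta> - u) / (th \<tau> \<zeta>)\<^sup>2) = unitarity_factor N \<zeta> u"
proof -
  define x where "x = exp (2 * \<i> * pi * u)"
  define T where "T = Theta (q_of \<zeta> ^ (2 * N))"
  define d where "d = 2 / of_nat N - (2 :: complex)"
  define K where "K = inv_kappa N (q_of \<zeta>) (p_of \<tau>)"
  have x: "exp (2 * \<i> * pi * (- u)) = 1 / x" by (simp add: x_def exp_minus inverse_eq_divide)
  have x0: "x \<noteq> 0" by (simp add: x_def)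
  have KK: "K x * K (1 / x) = 1" using inv_kappa_minus[OF g] by (simp add: K_def x_def)
  have e: "exp (\<i> * pi * \<zeta> / 2 * d) * exp (\<i> * pi * \<zeta> / 2 * d) = exp (\<i> * pi * \<zeta> * d)"
    unfolding exp_add[symmetric] by (rule arg_cong[of _ _ exp]) (simp add: field_simps)
  have g': "th \<tau> (\<zeta> + u) \<noteq> 0" "th \<tau> (\<zeta> - u) \<noteq> 0"
    using g by (auto simp: generic_at_def Let_def add.commute)
  have 1: "scalar_factor N \<zeta> \<tau> u = exp (\<i> * pi * \<zeta> / 2 * d) * (T ((q_of \<zeta>)\<^sup>2 / x) / T x) * K x * (th \<tau> \<zeta> / th \<tau> (\<zeta> + u))"
    by (simp add: scalar_factor_def Let_def x_def T_def K_def d_def add.commute)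
  have 2: "scalar_factor N \<zeta> \<tau> (- u) = exp (\<i> * pi * \<zeta> / 2 * d) * (T ((q_of \<zeta>)\<^sup>2 * x) / T (1 / x)) * K (1 / x) * (th \<tau> \<zeta> / th \<tau> (\<zeta> - u))"
    unfolding scalar_factor_def Let_def x using x0 by (simp add: T_def K_def d_def)
  have "scalar_factor N \<zeta> \<tau> u * scalar_factor N \<zeta> \<tau> (- u) * (th \<tau> (\<zeta> + u) * th \<tau> (\<zeta> - u) / (th \<tau> \<zeta>)\<^sup>2)
    = (exp (\<i> * pi * \<zeta> / 2 * d) * exp (\<i> * pi * \<zeta> / 2 * d)) * (K x * K (1 / x)) *
      (T ((q_of \<zeta>)\<^sup>2 / x) * T ((q_of \<zeta>)\<^sup>2 * x) / (T x * T (1 / x)))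
      * (th \<tau> \<zeta> / th \<tau> (\<zeta> + u) * (th \<tau> \<zeta> / th \<tau> (\<zeta> - u)) * (th \<tau> (\<zeta> + u) * th \<tau> (\<zeta> - u) / (th \<tau> \<zeta>)\<^sup>2))"
    unfolding 1 2 by (simp add: mult_ac)
  also have "th \<tau> \<zeta> / th \<tau> (\<zeta> + u) * (th \<tau> \<zeta> / th \<tau> (\<zeta> - u)) * (th \<tau> (\<zeta> + u) * th \<tau> (\<zeta> - u) / (th \<tau> \<zeta>)\<^sup>2) = 1"
    using g' z by (simp add: power2_eq_square)
  finally show ?thesis
    unfolding e KK by (simp add: unitarity_factor_def Let_def x_def T_def d_def)
qed

text \<open>Each of the eight double products gains or loses one single product of nome a. These
  pair up into four values of \<open>Theta a\<close> by means of a = q^(2N-2) q^2; the common factor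
  \<open>qpoch a [a]\<close> cancels.\<close>

lemma inv_kappa_p_shift:
  assumes im: "Im \<tau> > 0" and g: "generic_at N \<zeta> \<tau> u" "generic_at N \<zeta> \<tau> (u + \<tau>)"
  defines "x \<equiv> exp (2 * \<i> * pi * u)" and "p \<equiv> p_of \<tau>" and "q \<equiv> q_of \<zeta>"
  shows "inv_kappa N q p (p * x) * (Theta (q ^ (2 * N)) (q\<^sup>2 * x) * Theta (q ^ (2 * N)) (q\<^sup>2 / (p * x)))
    = inv_kappa N q p x * (Theta (q ^ (2 * N)) (p * x) * Theta (q ^ (2 * N)) (1 / x))"
proof -
  define a where "a = q ^ (2 * N)"
  define b where "b = q ^ (2 * N - 2)"
  have nz: "x \<noteq> 0" "p \<noteq> 0" "q \<noteq> 0" "a \<noteq> 0" by (simp_all add: x_def p_def q_def a_def)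
  have ab: "a = b * q\<^sup>2" using N unfolding a_def b_def power_add[symmetric] by (intro arg_cong2[of _ _ _ _ "(^)"]) auto
  have ap: "norm a < 1" "norm p < 1" using norm_q_of_power_less_1 im by (simp_all add: a_def q_def p_def norm_p_of)
  have px: "exp (2 * \<i> * pi * (u + \<tau>)) = p * x"
    unfolding p_def p_of_def x_def exp_add[symmetric] by (rule arg_cong[of _ _ exp]) (simp add: algebra_simps)
  define P where "P y = qpoch y [p, a]" for y
  define S where "S y = qpoch y [a]" for y
  have sh: "P y = S y * P (y * p)" for y
    unfolding P_def S_def by (rule qpoch_Cons) (use ap in auto)
  have e1: "P (a / (p * x)) = S (a / (p * x)) * P (a / x)" using sh[of "a / (p * x)"] nz by simp
  have e2: "P (q\<^sup>2 * x) = S (q\<^sup>2 * x) * P (q\<^sup>2 * (p * x))" using sh[of "q\<^sup>2 * x"] by (simp add: mult_ac)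
  have e3: "P (p / (p * x)) = S (1 / x) * P (p / x)" using sh[of "1 / x"] nz by simp
  have e4: "P (p * b * x) = S (p * b * x) * P (p * b * (p * x))" using sh[of "p * b * x"] by (simp add: mult_ac)
  have e5: "P (a * x) = S (a * x) * P (a * (p * x))" using sh[of "a * x"] by (simp add: mult_ac)
  have e6: "P (q\<^sup>2 / (p * x)) = S (q\<^sup>2 / (p * x)) * P (q\<^sup>2 / x)" using sh[of "q\<^sup>2 / (p * x)"] nz by simp
  have e7: "P (p * x) = S (p * x) * P (p * (p * x))" using sh[of "p * x"] by (simp add: mult_ac)
  have e8: "P (p * b / (p * x)) = S (b / x) * P (p * b / x)" using sh[of "b / x"] nz by (simp add: mult_ac)
  have t1: "Theta a (q\<^sup>2 * x) = S (q\<^sup>2 * x) * S (b / x) * S a"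
    and t2: "Theta a (q\<^sup>2 / (p * x)) = S (q\<^sup>2 / (p * x)) * S (p * b * x) * S a"
    and t3: "Theta a (p * x) = S (p * x) * S (a / (p * x)) * S a"
    and t4: "Theta a (1 / x) = S (1 / x) * S (a * x) * S a"
    using nz by (simp_all add: Theta_def S_def ab mult_ac)
  have nz1: "P (a * x) \<noteq> 0" "P (q\<^sup>2 / x) \<noteq> 0" "P (p * x) \<noteq> 0" "P (p * b / x) \<noteq> 0"
    using g(1) unfolding generic_at_def Let_def x_def p_def q_def a_def b_def P_def by auto
  have nz2: "P (a * (p * x)) \<noteq> 0" "P (q\<^sup>2 / (p * x)) \<noteq> 0" "P (p * (p * x)) \<noteq> 0" "P (p * b / (p * x)) \<noteq> 0"
    using g(2) unfolding generic_at_def Let_def px p_def[symmetric] q_def[symmetric] a_def[symmetric] b_def[symmetric] P_def by auto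
  show ?thesis
    unfolding inv_kappa_def Let_def a_def[symmetric] b_def[symmetric] P_def[symmetric] t1 t2 t3 t4 e1 e2 e3 e4 e5 e6 e7 e8
    using nz1 nz2 unfolding e5 e6 e7 e8 by (simp add: field_simps)
qed

text \<open>Same pairing as for the shift by p, but with the roles of the two nomes exchanged:
  stripping a factor in the direction of a leaves single products of nome p.\<close>

lemma inv_kappa_a_shift:
  assumes im: "Im \<tau> > 0" and g: "generic_at N \<zeta> \<tau> u" "generic_at N \<zeta> \<tau> (u + of_nat N * \<zeta>)"
  defines "x \<equiv> exp (2 * \<i> * pi * u)" and "p \<equiv> p_of \<tau>" and "q \<equiv> q_of \<zeta>"
  defines "a \<equiv> q ^ (2 * N)"
  shows "inv_kappa N q p x * (Theta p (1 / x) * Theta p (a * x))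
    = inv_kappa N q p (a * x) * (Theta p (q\<^sup>2 * x) * Theta p (q\<^sup>2 / (a * x)))"
proof -
  define b where "b = q ^ (2 * N - 2)"
  have nz: "x \<noteq> 0" "p \<noteq> 0" "q \<noteq> 0" "a \<noteq> 0" by (simp_all add: x_def p_def q_def a_def)
  have ab: "a = b * q\<^sup>2" using N unfolding a_def b_def power_add[symmetric] by (intro arg_cong2[of _ _ _ _ "(^)"]) auto
  have b0: "b \<noteq> 0" using nz by (simp add: b_def)
  have ap: "norm a < 1" "norm p < 1" using norm_q_of_power_less_1 im by (simp_all add: a_def q_def p_def norm_p_of)
  have ax: "exp (2 * \<i> * pi * (u + of_nat N * \<zeta>)) = a * x"
    unfolding a_def q_def q_of_power x_def exp_add[symmetric] by (rule arg_cong[of _ _ exp]) (simp add: algebra_simps)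
  define P where "P y = qpoch y [p, a]" for y
  define S where "S y = qpoch y [p]" for y
  have sh: "P y = S y * P (y * a)" for y
    unfolding P_def S_def by (rule qpoch_shift_second) (use ap in auto)
  have e1: "P (a / (a * x)) = S (1 / x) * P (a / x)" using sh[of "1 / x"] nz by simp
  have e2: "P (q\<^sup>2 * x) = S (q\<^sup>2 * x) * P (q\<^sup>2 * (a * x))" using sh[of "q\<^sup>2 * x"] by (simp add: mult_ac)
  have e3: "P (p / (a * x)) = S (p / (a * x)) * P (p / x)" using sh[of "p / (a * x)"] nz by simp
  have e4: "P (p * b * x) = S (p * b * x) * P (p * b * (a * x))" using sh[of "p * b * x"] by (simp add: mult_ac)
  have e5: "P (a * x) = S (a * x) * P (a * (a * x))" using sh[of "a * x"] by (simp add: mult_ac)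
  have e6: "P (q\<^sup>2 / (a * x)) = S (q\<^sup>2 / (a * x)) * P (q\<^sup>2 / x)" using sh[of "q\<^sup>2 / (a * x)"] nz by simp
  have e7: "P (p * x) = S (p * x) * P (p * (a * x))" using sh[of "p * x"] by (simp add: mult_ac)
  have e8: "P (p * b / (a * x)) = S (p * b / (a * x)) * P (p * b / x)" using sh[of "p * b / (a * x)"] nz by simp
  have t1: "Theta p (q\<^sup>2 * x) = S (q\<^sup>2 * x) * S (p * b / (a * x)) * S p"
    and t2: "Theta p (q\<^sup>2 / (a * x)) = S (q\<^sup>2 / (a * x)) * S (p * b * x) * S p"
    and t3: "Theta p (a * x) = S (a * x) * S (p / (a * x)) * S p"
    and t4: "Theta p (1 / x) = S (1 / x) * S (p * x) * S p"
    using nz b0 by (simp_all add: Theta_def S_def ab mult_ac)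
  have nz1: "P (a * x) \<noteq> 0" "P (q\<^sup>2 / x) \<noteq> 0" "P (p * x) \<noteq> 0" "P (p * b / x) \<noteq> 0"
    using g(1) unfolding generic_at_def Let_def x_def p_def q_def a_def b_def P_def by auto
  have nz2: "P (a * (a * x)) \<noteq> 0" "P (q\<^sup>2 / (a * x)) \<noteq> 0" "P (p * (a * x)) \<noteq> 0" "P (p * b / (a * x)) \<noteq> 0"
    using g(2) unfolding generic_at_def Let_def ax p_def[symmetric] q_def[symmetric] a_def[symmetric] b_def[symmetric] P_def by auto
  show ?thesis
    unfolding inv_kappa_def Let_def a_def[symmetric] b_def[symmetric] P_def[symmetric] t1 t2 t3 t4 e1 e2 e3 e4 e5 e6 e7 e8
    using nz1 nz2 unfolding e5 e6 e7 e8 by (simp add: field_simps)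
qed


text \<open>The exponential is the part of the multiplier of \<open>phi\<close> at y = \<zeta>/N
  that does not depend on the index. Including it here leaves only a phase in \<alpha> and 1/U in
  the multiplier of a coefficient.\<close>

lemma scalar_factor_quasiperiod:
  assumes im: "Im \<tau> > 0" and g: "generic_at N \<zeta> \<tau> u" "generic_at N \<zeta> \<tau> (u + (\<tau> + 1))"
  shows "scalar_factor N \<zeta> \<tau> (u + (\<tau> + 1))
      * exp (- \<i> * pi * \<tau> - 2 * \<i> * pi * (u + \<zeta> / of_nat N)) * unitarity_factor N \<zeta> u
    = scalar_factor N \<zeta> \<tau> u"
proof -
  define x where "x = exp (2 * \<i> * pi * u)"
  define p where "p = p_of \<tau>"
  define q where "q = q_of \<zeta>"
  define T where "T = Theta (q ^ (2 * N))"
  define d where "d = 2 / of_nat N - (2 :: complex)"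
  define K where "K = inv_kappa N q p"
  have nz: "x \<noteq> 0" "p \<noteq> 0" "q \<noteq> 0" by (simp_all add: x_def p_def q_def)
  have px: "exp (2 * \<i> * pi * (u + \<tau>)) = p * x"
    unfolding p_def p_of_def x_def exp_add[symmetric] by (rule arg_cong[of _ _ exp]) (simp add: algebra_simps)
  have px1: "exp (2 * \<i> * pi * (u + (\<tau> + 1))) = p * x"
  proof -
    have "2 * \<i> * pi * (u + (\<tau> + 1)) = 2 * \<i> * pi * (u + \<tau>) + 2 * \<i> * pi * of_int 1"
      by (simp add: algebra_simps)
    then show ?thesis by (simp only: exp_add_2pi_int px)
  qed
  define e where "e = exp (- \<i> * pi * \<tau> - 2 * \<i> * pi * (u + \<zeta>))"
  have thz: "th \<tau> (u + (\<tau> + 1) + \<zeta>) = e * th \<tau> (u + \<zeta>)"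
  proof -
    have "u + (\<tau> + 1) + \<zeta> = u + \<zeta> + \<tau> + 1" by simp
    then show ?thesis by (simp only: th_plus_1[OF im] th_plus_tau[OF im] e_def) simp
  qed
  have g2: "generic_at N \<zeta> \<tau> (u + \<tau>)"
  proof -
    have 1: "th \<tau> (u + (\<tau> + 1)) = - th \<tau> (u + \<tau>)"
      using th_plus_1[OF im, of "u + \<tau>"] by (simp add: add.assoc)
    have 2: "th \<tau> (u + (\<tau> + 1) + \<zeta>) = - th \<tau> (u + \<tau> + \<zeta>)"
      using th_plus_1[OF im, of "u + \<tau> + \<zeta>"] by (simp add: add_ac)
    have 3: "th \<tau> (\<zeta> - (u + \<tau>)) = - th \<tau> (\<zeta> - (u + (\<tau> + 1)))"
      using th_plus_1[OF im, of "\<zeta> - (u + (\<tau> + 1))"] by (simp add: algebra_simps)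
    show ?thesis using g(2) unfolding generic_at_def Let_def px1 px 1 2 3 by simp
  qed
  have K: "K (p * x) * (T (q\<^sup>2 * x) * T (q\<^sup>2 / (p * x))) = K x * (T (p * x) * T (1 / x))"
    using inv_kappa_p_shift[OF im g(1) g2] by (simp add: K_def T_def x_def p_def q_def)
  have nz1: "T x \<noteq> 0" "T (1 / x) \<noteq> 0" "T (q\<^sup>2 * x) \<noteq> 0" "T (q\<^sup>2 / x) \<noteq> 0" "th \<tau> (u + \<zeta>) \<noteq> 0"
    using g(1) by (simp_all add: generic_at_def Let_def T_def x_def q_def)
  have nz2: "T (p * x) \<noteq> 0"
    using g2 unfolding generic_at_def Let_def px by (simp add: T_def q_def)
  have K': "T (q\<^sup>2 / (p * x)) / T (p * x) * K (p * x) = K x * T (1 / x) / T (q\<^sup>2 * x)"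
    using K nz1 nz2 by (simp add: field_simps)
  \<comment> \<open>The theta function in the prefactor is shifted by \<zeta>, those in the sum by
    \<zeta>/N. The constant exponential of \<open>unitarity_factor\<close>, with exponent 2/N - 2,
    is exactly the discrepancy.\<close>
  have ee: "exp (- \<i> * pi * \<tau> - 2 * \<i> * pi * (u + \<zeta> / of_nat N)) * exp (\<i> * pi * \<zeta> * d) = e"
    unfolding e_def d_def exp_add[symmetric] by (rule arg_cong[of _ _ exp]) (simp add: field_simps)
  have 1: "scalar_factor N \<zeta> \<tau> u = exp (\<i> * pi * \<zeta> / 2 * d) * (T (q\<^sup>2 / x) / T x) * K x * (th \<tau> \<zeta> / th \<tau> (u + \<zeta>))"
    by (simp add: scalar_factor_def Let_def x_def T_def K_def d_def p_def q_def)
  have 2: "scalar_factor N \<zeta> \<tau> (u + (\<tau> + 1)) =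
      exp (\<i> * pi * \<zeta> / 2 * d) * (T (q\<^sup>2 / (p * x)) / T (p * x)) * K (p * x) * (th \<tau> \<zeta> / (e * th \<tau> (u + \<zeta>)))"
    unfolding scalar_factor_def Let_def px1 thz by (simp add: T_def K_def d_def p_def q_def)
  have 3: "unitarity_factor N \<zeta> u = exp (\<i> * pi * \<zeta> * d) * (T (q\<^sup>2 / x) * T (q\<^sup>2 * x) / (T x * T (1 / x)))"
    by (simp add: unitarity_factor_def Let_def x_def T_def d_def q_def)
  have "scalar_factor N \<zeta> \<tau> (u + (\<tau> + 1)) * exp (- \<i> * pi * \<tau> - 2 * \<i> * pi * (u + \<zeta> / of_nat N)) * unitarity_factor N \<zeta> u
    = exp (\<i> * pi * \<zeta> / 2 * d) * (T (q\<^sup>2 / (p * x)) / T (p * x) * K (p * x)) * (th \<tau> \<zeta> / (e * th \<tau> (u + \<zeta>)))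
      * (exp (- \<i> * pi * \<tau> - 2 * \<i> * pi * (u + \<zeta> / of_nat N)) * exp (\<i> * pi * \<zeta> * d))
      * (T (q\<^sup>2 / x) * T (q\<^sup>2 * x) / (T x * T (1 / x)))"
    unfolding 2 3 by (simp only: mult_ac)
  also have "\<dots> = scalar_factor N \<zeta> \<tau> u"
  proof -
    have "e \<noteq> 0" by (simp add: e_def)
    then show ?thesis unfolding K' ee 1 using nz1 by (simp add: field_simps)
  qed
  finally show ?thesis .
qed

text \<open>By \<open>inv_kappa_minus\<close> the product of the two values of
  \<open>inv_kappa\<close> is a quotient of values at x and a x, which
  \<open>inv_kappa_a_shift\<close> expresses through theta functions of nome p. These cancel the
  denominators of the prefactors and leave th(\<zeta>)^2.\<close>

lemma scalar_factor_crossing: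
  assumes im: "Im \<tau> > 0" and g: "generic_at N \<zeta> \<tau> v" "generic_at N \<zeta> \<tau> (v + of_nat N * \<zeta>)"
  shows "scalar_factor N \<zeta> \<tau> v * scalar_factor N \<zeta> \<tau> (- v - of_nat N * \<zeta>) * (th \<tau> v * th \<tau> (v + of_nat N * \<zeta>))
    = - (th \<tau> \<zeta>)\<^sup>2 * unitarity_factor N \<zeta> v"
proof -
  define w where "w = v + of_nat N * \<zeta>"
  define x where "x = exp (2 * \<i> * pi * v)"
  define p where "p = p_of \<tau>"
  define q where "q = q_of \<zeta>"
  define a where "a = q ^ (2 * N)"
  define T where "T = Theta a"
  define d where "d = 2 / of_nat N - (2 :: complex)"
  define K where "K = inv_kappa N q p"
  have nz: "x \<noteq> 0" "p \<noteq> 0" "q \<noteq> 0" "a \<noteq> 0" by (simp_all add: x_def p_def q_def a_def)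
  have ax: "exp (2 * \<i> * pi * w) = a * x"
    unfolding w_def a_def q_def q_of_power x_def exp_add[symmetric] by (rule arg_cong[of _ _ exp]) (simp add: algebra_simps)
  have mw: "- v - of_nat N * \<zeta> = - w" by (simp add: w_def)
  have xm: "exp (2 * \<i> * pi * (- w)) = 1 / (a * x)" using ax by (simp add: exp_minus inverse_eq_divide)
  have gw: "generic_at N \<zeta> \<tau> w" using g(2) by (simp add: w_def)
  have KK: "K (a * x) * K (1 / (a * x)) = 1" using inv_kappa_minus[OF gw] unfolding ax by (simp add: K_def p_def q_def)
  have Ks: "K x * (Theta p (1 / x) * Theta p (a * x)) = K (a * x) * (Theta p (q\<^sup>2 * x) * Theta p (q\<^sup>2 / (a * x)))"
    using inv_kappa_a_shift[OF im g] by (simp add: K_def x_def p_def q_def a_def)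
  have th1: "Theta p (1 / x) = exp (- (\<i> * pi * v)) * - th \<tau> v"
    using Theta_th[of \<tau> "- v"] by (simp add: p_def x_def exp_minus inverse_eq_divide th_minus[OF im])
  have th2: "Theta p (a * x) = exp (\<i> * pi * w) * th \<tau> w"
    using Theta_th[of \<tau> w] unfolding ax by (simp add: p_def)
  have th3: "Theta p (q\<^sup>2 * x) = exp (\<i> * pi * (v + \<zeta>)) * th \<tau> (v + \<zeta>)"
  proof -
    have "exp (2 * \<i> * pi * (v + \<zeta>)) = q\<^sup>2 * x"
      using q_of_power[of \<zeta> 1] by (simp add: q_def x_def exp_add distrib_left)
    then show ?thesis using Theta_th[of \<tau> "v + \<zeta>"] by (simp only: p_def)
  qed
  have th4: "Theta p (q\<^sup>2 / (a * x)) = exp (\<i> * pi * (\<zeta> - w)) * th \<tau> (\<zeta> - w)"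
  proof -
    have "exp (2 * \<i> * pi * (\<zeta> - w)) = q\<^sup>2 / (a * x)"
      using q_of_power[of \<zeta> 1] by (simp add: q_def ax[symmetric] exp_diff right_diff_distrib)
    then show ?thesis using Theta_th[of \<tau> "\<zeta> - w"] by (simp only: p_def)
  qed
  define c where "c = exp (2 * \<i> * pi * (\<zeta> - of_nat N * \<zeta>))"
  have E1: "exp (- (\<i> * pi * v)) * exp (\<i> * pi * w) * c = exp (\<i> * pi * (v + \<zeta>)) * exp (\<i> * pi * (\<zeta> - w))"
    unfolding c_def w_def exp_add[symmetric] by (rule arg_cong[of _ _ exp]) (simp add: algebra_simps)
  define ee where "ee = exp (- (\<i> * pi * v)) * exp (\<i> * pi * w)"
  have ee0: "ee \<noteq> 0" by (simp add: ee_def)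
  have "ee * (- (K x * (th \<tau> v * th \<tau> w))) = ee * (K (a * x) * (c * (th \<tau> (v + \<zeta>) * th \<tau> (\<zeta> - w))))"
  proof -
    have "ee * (- (K x * (th \<tau> v * th \<tau> w))) = K x * (Theta p (1 / x) * Theta p (a * x))"
      unfolding th1 th2 ee_def by (simp add: mult_ac)
    also have "\<dots> = K (a * x) * ((exp (\<i> * pi * (v + \<zeta>)) * exp (\<i> * pi * (\<zeta> - w))) * (th \<tau> (v + \<zeta>) * th \<tau> (\<zeta> - w)))"
      unfolding Ks th3 th4 by (simp only: mult_ac)
    also have "\<dots> = ee * (K (a * x) * (c * (th \<tau> (v + \<zeta>) * th \<tau> (\<zeta> - w))))"
      unfolding E1[symmetric] ee_def by (simp only: mult_ac)
    finally show ?thesis .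
  qed
  then have Kth: "- (K x * (th \<tau> v * th \<tau> w)) = K (a * x) * (c * (th \<tau> (v + \<zeta>) * th \<tau> (\<zeta> - w)))"
    using ee0 mult_left_cancel by blast
  have Kth': "K x * K (1 / (a * x)) * (th \<tau> v * th \<tau> w) = - c * (th \<tau> (v + \<zeta>) * th \<tau> (\<zeta> - w))"
  proof -
    have "K x * K (1 / (a * x)) * (th \<tau> v * th \<tau> w) = - (K (1 / (a * x)) * (- (K x * (th \<tau> v * th \<tau> w))))"
      by simp
    also have "\<dots> = - ((K (a * x) * K (1 / (a * x))) * (c * (th \<tau> (v + \<zeta>) * th \<tau> (\<zeta> - w))))"
      unfolding Kth by (simp only: mult_ac)
    finally show ?thesis unfolding KK by simp
  qed
  have sh: "T (a * y) = - T y / y" if "y \<noteq> 0" for y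
    using Theta_a_shift[OF that] by (simp add: T_def a_def q_def)
  have T1: "T (q\<^sup>2 * (a * x)) = - T (q\<^sup>2 * x) / (q\<^sup>2 * x)"
    using sh[of "q\<^sup>2 * x"] nz by (simp add: mult_ac)
  have T2: "T (1 / (a * x)) = - T (1 / x) / (a * x)"
    using sh[of "1 / (a * x)"] nz by (simp add: field_simps)
  have qm: "q\<^sup>2 / (1 / (a * x)) = q\<^sup>2 * (a * x)" using nz by simp
  have thnz: "th \<tau> (v + \<zeta>) \<noteq> 0" "th \<tau> (\<zeta> - w) \<noteq> 0"
    using g(1) gw by (simp_all add: generic_at_def Let_def)
  have Tnz: "T x \<noteq> 0" "T (1 / x) \<noteq> 0" using g(1) by (simp_all add: generic_at_def Let_def T_def x_def q_def a_def)
  have 1: "scalar_factor N \<zeta> \<tau> v = exp (\<i> * pi * \<zeta> / 2 * d) * (T (q\<^sup>2 / x) / T x) * K x * (th \<tau> \<zeta> / th \<tau> (v + \<zeta>))"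
    by (simp add: scalar_factor_def Let_def x_def T_def K_def d_def p_def q_def a_def)
  have 2: "scalar_factor N \<zeta> \<tau> (- w) =
      exp (\<i> * pi * \<zeta> / 2 * d) * (T (q\<^sup>2 * (a * x)) / T (1 / (a * x))) * K (1 / (a * x)) * (th \<tau> \<zeta> / th \<tau> (\<zeta> - w))"
    unfolding scalar_factor_def Let_def xm q_def[symmetric] qm by (simp add: T_def K_def d_def p_def a_def q_def)
  have 3: "unitarity_factor N \<zeta> v = exp (\<i> * pi * \<zeta> * d) * (T (q\<^sup>2 / x) * T (q\<^sup>2 * x) / (T x * T (1 / x)))"
    by (simp add: unitarity_factor_def Let_def x_def T_def d_def q_def a_def)
  have E2: "exp (\<i> * pi * \<zeta> / 2 * d) * exp (\<i> * pi * \<zeta> / 2 * d) = exp (\<i> * pi * \<zeta> * d)"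
    unfolding exp_add[symmetric] by (rule arg_cong[of _ _ exp]) (simp add: field_simps)
  \<comment> \<open>\<open>c\<close> is what remains of the exponentials relating
    \<open>Theta p\<close> to \<open>th\<close>, and a/q^2 is the automorphy factor of
    \<open>Theta a\<close>; they are inverse to each other.\<close>
  have ca: "c * (a / q\<^sup>2) = 1"
  proof -
    have "c = q\<^sup>2 / a"
      using q_of_power[of \<zeta> 1] q_of_power[of \<zeta> N] by (simp add: c_def a_def q_def exp_diff right_diff_distrib)
    then show ?thesis using nz by simp
  qed
  have TT: "T (q\<^sup>2 * (a * x)) / T (1 / (a * x)) = T (q\<^sup>2 * x) / T (1 / x) * (a / q\<^sup>2)"
    unfolding T1 T2 using nz Tnz by (simp add: field_simps)
  have "scalar_factor N \<zeta> \<tau> v * scalar_factor N \<zeta> \<tau> (- w) * (th \<tau> v * th \<tau> w)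
    = (exp (\<i> * pi * \<zeta> / 2 * d) * exp (\<i> * pi * \<zeta> / 2 * d)) * (T (q\<^sup>2 / x) * T (q\<^sup>2 * x) / (T x * T (1 / x)))
      * (a / q\<^sup>2) * (K x * K (1 / (a * x)) * (th \<tau> v * th \<tau> w)) * (th \<tau> \<zeta> * th \<tau> \<zeta> / (th \<tau> (v + \<zeta>) * th \<tau> (\<zeta> - w)))"
    unfolding 1 2 TT by (simp add: mult_ac)
  also have "\<dots> = unitarity_factor N \<zeta> v * (a / q\<^sup>2) * ((- c * (th \<tau> (v + \<zeta>) * th \<tau> (\<zeta> - w)))
      * (th \<tau> \<zeta> * th \<tau> \<zeta> / (th \<tau> (v + \<zeta>) * th \<tau> (\<zeta> - w))))"
    unfolding E2 Kth' 3 by (simp only: mult.assoc)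
  also have "(- c * (th \<tau> (v + \<zeta>) * th \<tau> (\<zeta> - w))) * (th \<tau> \<zeta> * th \<tau> \<zeta> / (th \<tau> (v + \<zeta>) * th \<tau> (\<zeta> - w)))
      = - c * (th \<tau> \<zeta>)\<^sup>2"
    using thnz by (simp add: power2_eq_square)
  also have "unitarity_factor N \<zeta> v * (a / q\<^sup>2) * (- c * (th \<tau> \<zeta>)\<^sup>2) = - (unitarity_factor N \<zeta> v * (c * (a / q\<^sup>2)) * (th \<tau> \<zeta>)\<^sup>2)"
    by simp
  also have "\<dots> = - (th \<tau> \<zeta>)\<^sup>2 * unitarity_factor N \<zeta> v"
    unfolding ca by simp
  finally show ?thesis unfolding mw w_def[symmetric] .
qed

lemma scalar_factor_plus_int:
  assumes im: "Im \<tau> > 0"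
  shows "scalar_factor N \<zeta> \<tau> (u + of_int k) = (-1) powi k * scalar_factor N \<zeta> \<tau> u"
proof -
  have "exp (2 * \<i> * pi * (u + of_int k)) = exp (2 * \<i> * pi * u)"
    using exp_add_2pi_int[of "2 * \<i> * pi * u" k] by (simp only: distrib_left)
  moreover have "th \<tau> (u + of_int k + \<zeta>) = (-1) powi k * th \<tau> (u + \<zeta>)"
    using th_plus_int[OF im, of "u + \<zeta>" k] by (simp add: add_ac)
  moreover have "th \<tau> \<zeta> / ((-1) powi k * th \<tau> (u + \<zeta>)) = (-1) powi k * (th \<tau> \<zeta> / th \<tau> (u + \<zeta>))"
    by (cases "even k") simp_all
  ultimately show ?thesis
    by (simp only: scalar_factor_def Let_def mult_ac)
qed

end

section \<open>Matrices on the tensor square\<close>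

lemma matrix_inv_eqI:
  fixes A B :: "'a::semiring_1^'n^'n"
  assumes "A ** B = mat 1" "B ** A = mat 1"
  shows "matrix_inv A = B"
proof -
  have "A ** matrix_inv A = mat 1 \<and> matrix_inv A ** A = mat 1"
    unfolding matrix_inv_def by (rule someI[of _ B]) (use assms in simp)
  then have "B ** (A ** matrix_inv A) = B" by simp
  then show ?thesis by (simp add: matrix_mul_assoc assms)
qed

section \<open>Partial transposes, the flip and linear combinations indexed by a group\<close>

definition pt1 :: "'a^('k::finite \<times> 'l::finite)^('k \<times> 'l) \<Rightarrow> 'a^('k \<times> 'l)^('k \<times> 'l)" where
  "pt1 X = (\<chi> i j. X $ (fst j, snd i) $ (fst i, snd j))"

definition pt2 :: "'a^('k::finite \<times> 'l::finite)^('k \<times> 'l) \<Rightarrow> 'a^('k \<times> 'l)^('k \<times> 'l)" where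
  "pt2 X = (\<chi> i j. X $ (fst i, snd j) $ (fst j, snd i))"

definition flip_mat :: "'a^('k::finite \<times> 'l::finite)^('k \<times> 'l) \<Rightarrow> 'a^('l \<times> 'k)^('l \<times> 'k)" where
  "flip_mat X = (\<chi> i j. X $ (snd i, fst i) $ (snd j, fst j))"

lemma mat_mult_nth: "(A ** B) $ i $ j = (\<Sum>k\<in>UNIV. A $ i $ k * B $ k $ j)"
  for A :: "'a::semiring_1^'k^'l" and B :: "'a^'m^'k"
  by (simp add: matrix_matrix_mult_def)

lemma sum_UNIV_prod: "(\<Sum>x\<in>UNIV. f x) = (\<Sum>i\<in>UNIV. \<Sum>j\<in>UNIV. f (i, j))"
  unfolding UNIV_Times_UNIV[symmetric] by (subst sum.cartesian_product) (simp add: case_prod_unfold)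

definition lin_mat :: "('b::finite \<Rightarrow> complex) \<Rightarrow> ('b \<Rightarrow> complex^'k^'l) \<Rightarrow> complex^'k^'l" where
  "lin_mat c F = (\<chi> i j. \<Sum>\<alpha>\<in>UNIV. c \<alpha> * F \<alpha> $ i $ j)"

text \<open>Multiplication becomes a convolution twisted by the weight \<open>w\<close>. The weight
  \<open>br\<close> serves unitarity, the constant weight 1 serves crossing.\<close>

lemma lin_mat_mult:
  fixes F :: "'b::{finite, ab_group_add} \<Rightarrow> complex^'k^'l" and G :: "'b \<Rightarrow> complex^'m^'k"
  assumes "\<And>\<alpha> \<beta>. F \<alpha> ** G \<beta> = map_matrix ((*) (w \<alpha> \<beta>)) (H (\<alpha> + \<beta>))"
  shows "lin_mat c F ** lin_mat e G = lin_mat (\<lambda>\<gamma>. \<Sum>\<alpha>\<in>UNIV. w \<alpha> (\<gamma> - \<alpha>) * (c \<alpha> * e (\<gamma> - \<alpha>))) H"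
proof -
  have "(lin_mat c F ** lin_mat e G) $ i $ k
      = lin_mat (\<lambda>\<gamma>. \<Sum>\<alpha>\<in>UNIV. w \<alpha> (\<gamma> - \<alpha>) * (c \<alpha> * e (\<gamma> - \<alpha>))) H $ i $ k" for i k
  proof -
    have "(lin_mat c F ** lin_mat e G) $ i $ k
      = (\<Sum>j\<in>UNIV. \<Sum>\<alpha>\<in>UNIV. \<Sum>\<beta>\<in>UNIV. c \<alpha> * F \<alpha> $ i $ j * (e \<beta> * G \<beta> $ j $ k))"
      by (simp add: matrix_matrix_mult_def lin_mat_def sum_product)
    also have "\<dots> = (\<Sum>\<alpha>\<in>UNIV. \<Sum>\<beta>\<in>UNIV. \<Sum>j\<in>UNIV. c \<alpha> * F \<alpha> $ i $ j * (e \<beta> * G \<beta> $ j $ k))"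
      by (subst sum.swap) (intro sum.cong refl, rule sum.swap)
    also have "\<dots> = (\<Sum>\<alpha>\<in>UNIV. \<Sum>\<beta>\<in>UNIV. c \<alpha> * e \<beta> * (F \<alpha> ** G \<beta>) $ i $ k)"
      by (simp add: matrix_matrix_mult_def sum_distrib_left mult_ac)
    also have "\<dots> = (\<Sum>\<alpha>\<in>UNIV. \<Sum>\<beta>\<in>UNIV. c \<alpha> * e \<beta> * (w \<alpha> \<beta> * H (\<alpha> + \<beta>) $ i $ k))"
      by (simp add: assms)
    also have "\<dots> = (\<Sum>\<alpha>\<in>UNIV. \<Sum>\<gamma>\<in>UNIV. c \<alpha> * e (\<gamma> - \<alpha>) * (w \<alpha> (\<gamma> - \<alpha>) * H \<gamma> $ i $ k))"
    proof (rule sum.cong[OF refl])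
      fix \<alpha> :: 'b
      show "(\<Sum>\<beta>\<in>UNIV. c \<alpha> * e \<beta> * (w \<alpha> \<beta> * H (\<alpha> + \<beta>) $ i $ k))
        = (\<Sum>\<gamma>\<in>UNIV. c \<alpha> * e (\<gamma> - \<alpha>) * (w \<alpha> (\<gamma> - \<alpha>) * H \<gamma> $ i $ k))"
        by (rule sum.reindex_bij_witness[of _ "\<lambda>\<gamma>. \<gamma> - \<alpha>" "\<lambda>\<beta>. \<alpha> + \<beta>"]) auto
    qed
    also have "\<dots> = (\<Sum>\<gamma>\<in>UNIV. \<Sum>\<alpha>\<in>UNIV. c \<alpha> * e (\<gamma> - \<alpha>) * (w \<alpha> (\<gamma> - \<alpha>) * H \<gamma> $ i $ k))"
      by (rule sum.swap)
    also have "\<dots> = lin_mat (\<lambda>\<gamma>. \<Sum>\<alpha>\<in>UNIV. w \<alpha> (\<gamma> - \<alpha>) * (c \<alpha> * e (\<gamma> - \<alpha>))) H $ i $ k"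
      by (simp add: lin_mat_def sum_distrib_left sum_distrib_right mult_ac)
    finally show ?thesis .
  qed
  then show ?thesis by (simp add: vec_eq_iff)
qed

lemma pt2_lin_mat: "pt2 (lin_mat c F) = lin_mat c (\<lambda>\<alpha>. pt2 (F \<alpha>))"
  by (simp add: pt2_def lin_mat_def vec_eq_iff)

lemma flip_lin_mat: "flip_mat (lin_mat c F) = lin_mat c (\<lambda>\<alpha>. flip_mat (F \<alpha>))"
  by (simp add: flip_mat_def lin_mat_def vec_eq_iff)

lemma map_matrix_lin_mat: "map_matrix ((*) r) (lin_mat c F) = lin_mat (\<lambda>\<alpha>. r * c \<alpha>) F"
  by (simp add: lin_mat_def vec_eq_iff sum_distrib_left mult_ac)

lemma lin_mat_delta:
  fixes F :: "'b::{finite, zero} \<Rightarrow> complex^'k^'k"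
  assumes "F 0 = mat 1"
  shows "lin_mat (\<lambda>\<gamma>. if \<gamma> = 0 then r else 0) F = mat r"
  using assms by (simp add: lin_mat_def vec_eq_iff mat_def if_distrib[of "\<lambda>x. x * _"] cong: if_cong)

text \<open>The matrices \<open>I\<^sub>\<alpha> \<otimes> I\<^sub>\<alpha>\<inverse>\<close>, conjugated by the diagonal matrix \<open>d \<otimes> d\<close>.\<close>
definition Tm :: "('n::nontriv mod_ring \<Rightarrow> complex) \<Rightarrow> 'n zn2 \<Rightarrow> complex^('n zn2)^('n zn2)" where
  "Tm d \<alpha> = (\<chi> i j. if j = (fst i + fst \<alpha>, snd i - fst \<alpha>)
     then d (fst i) * d (snd i) / (d (fst j) * d (snd j)) * chi (snd \<alpha> * (fst i - snd j)) else 0)"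

context
  fixes d :: "'n::nontriv mod_ring \<Rightarrow> complex"
  assumes d0: "\<And>i. d i \<noteq> 0"
begin

lemma Tm_mult: "Tm d \<alpha> ** Tm d \<beta> = map_matrix ((*) (br \<alpha> \<beta>)) (Tm d (\<alpha> + \<beta>))"
proof -
  have "(Tm d \<alpha> ** Tm d \<beta>) $ i $ k = br \<alpha> \<beta> * Tm d (\<alpha> + \<beta>) $ i $ k" for i k
  proof -
    define j where "j = (fst i + fst \<alpha>, snd i - fst \<alpha>)"
    have "(Tm d \<alpha> ** Tm d \<beta>) $ i $ k = (\<Sum>j'\<in>UNIV. if j' = j then Tm d \<alpha> $ i $ j' * Tm d \<beta> $ j' $ k else 0)"
      unfolding mat_mult_nth by (intro sum.cong refl) (simp add: Tm_def j_def)
    then have 1: "(Tm d \<alpha> ** Tm d \<beta>) $ i $ k = Tm d \<alpha> $ i $ j * Tm d \<beta> $ j $ k" by simp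
    show ?thesis
    proof (cases "k = (fst i + fst (\<alpha> + \<beta>), snd i - fst (\<alpha> + \<beta>))")
      case True
      then have k: "k = (fst j + fst \<beta>, snd j - fst \<beta>)" by (simp add: j_def algebra_simps)
      have c: "chi (snd \<alpha> * (fst i - snd j)) * chi (snd \<beta> * (fst j - snd k))
          = br \<alpha> \<beta> * chi (snd (\<alpha> + \<beta>) * (fst i - snd k))"
        unfolding br_def chi_add[symmetric] by (rule arg_cong[of _ _ chi]) (simp add: True j_def algebra_simps)
      have "Tm d \<alpha> $ i $ j * Tm d \<beta> $ j $ k = (d (fst i) * d (snd i) / (d (fst k) * d (snd k)))
          * (chi (snd \<alpha> * (fst i - snd j)) * chi (snd \<beta> * (fst j - snd k)))"
        using k j_def d0 by (simp add: Tm_def)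
      also have "\<dots> = br \<alpha> \<beta> * Tm d (\<alpha> + \<beta>) $ i $ k"
        unfolding c using True by (simp add: Tm_def)
      finally show ?thesis using 1 by simp
    next
      case False
      then have k: "k \<noteq> (fst j + fst \<beta>, snd j - fst \<beta>)" by (auto simp: j_def algebra_simps)
      show ?thesis unfolding 1 using False k by (simp add: Tm_def)
    qed
  qed
  then show ?thesis by (simp add: vec_eq_iff)
qed

lemma pt2_Tm: "pt2 (Tm d \<alpha>) $ i $ j = (if j = (fst i + fst \<alpha>, snd i + fst \<alpha>)
    then d (fst i) * d (snd j) / (d (fst j) * d (snd i)) * chi (snd \<alpha> * (fst i - snd i)) else 0)"
proof -
  have "(fst j, snd i) = (fst (fst i, snd j) + fst \<alpha>, snd (fst i, snd j) - fst \<alpha>) \<longleftrightarrow> j = (fst i + fst \<alpha>, snd i + fst \<alpha>)"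
    by (auto simp: prod_eq_iff)
  then show ?thesis by (simp add: pt2_def Tm_def)
qed

text \<open>Transposing the second factor reverses the order of multiplication there. The cocycle of
  the inverses I_\<alpha>^(-1) then cancels that of the I_\<alpha>, while without the transpose the
  two combine to \<open>br\<close>.\<close>

lemma pt2_Tm_mult: "pt2 (Tm d \<alpha>) ** pt2 (Tm d \<beta>) = map_matrix ((*) 1) (pt2 (Tm d (\<alpha> + \<beta>)))"
proof -
  have "(pt2 (Tm d \<alpha>) ** pt2 (Tm d \<beta>)) $ i $ k = pt2 (Tm d (\<alpha> + \<beta>)) $ i $ k" for i k
  proof -
    define j where "j = (fst i + fst \<alpha>, snd i + fst \<alpha>)"
    have "(pt2 (Tm d \<alpha>) ** pt2 (Tm d \<beta>)) $ i $ k
        = (\<Sum>j'\<in>UNIV. if j' = j then pt2 (Tm d \<alpha>) $ i $ j' * pt2 (Tm d \<beta>) $ j' $ k else 0)"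
      unfolding mat_mult_nth by (intro sum.cong refl) (simp add: pt2_Tm j_def)
    then have 1: "(pt2 (Tm d \<alpha>) ** pt2 (Tm d \<beta>)) $ i $ k = pt2 (Tm d \<alpha>) $ i $ j * pt2 (Tm d \<beta>) $ j $ k" by simp
    show ?thesis
    proof (cases "k = (fst i + fst (\<alpha> + \<beta>), snd i + fst (\<alpha> + \<beta>))")
      case True
      then have k: "k = (fst j + fst \<beta>, snd j + fst \<beta>)" by (simp add: j_def algebra_simps)
      have c: "chi (snd \<alpha> * (fst i - snd i)) * chi (snd \<beta> * (fst j - snd j))
          = chi (snd (\<alpha> + \<beta>) * (fst i - snd i))"
        unfolding chi_add[symmetric] by (rule arg_cong[of _ _ chi]) (simp add: True j_def algebra_simps)
      have "pt2 (Tm d \<alpha>) $ i $ j * pt2 (Tm d \<beta>) $ j $ k = (d (fst i) * d (snd k) / (d (fst k) * d (snd i)))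
          * (chi (snd \<alpha> * (fst i - snd i)) * chi (snd \<beta> * (fst j - snd j)))"
        using k j_def d0 by (simp add: pt2_Tm mult_ac)
      also have "\<dots> = pt2 (Tm d (\<alpha> + \<beta>)) $ i $ k"
        unfolding c using True by (simp add: pt2_Tm)
      finally show ?thesis using 1 by simp
    next
      case False
      then have k: "k \<noteq> (fst j + fst \<beta>, snd j + fst \<beta>)" by (auto simp: j_def algebra_simps)
      show ?thesis unfolding 1 using False k by (simp add: pt2_Tm)
    qed
  qed
  then show ?thesis by (simp add: vec_eq_iff)
qed

lemma Tm_0: "Tm d 0 = mat 1"
  using d0 by (simp add: Tm_def mat_def vec_eq_iff)

lemma pt2_Tm_0: "pt2 (Tm d 0) = mat 1"
  using d0 by (simp add: vec_eq_iff pt2_Tm mat_def)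

lemma flip_Tm: "flip_mat (Tm d \<alpha>) = Tm d (- \<alpha>)"
proof -
  have "flip_mat (Tm d \<alpha>) $ i $ j = Tm d (- \<alpha>) $ i $ j" for i j
  proof (cases "j = (fst i - fst \<alpha>, snd i + fst \<alpha>)")
    case True
    have "snd \<alpha> * (snd i - (fst i - fst \<alpha>)) = - snd \<alpha> * (fst i - (snd i + fst \<alpha>))"
      by (simp add: algebra_simps)
    then show ?thesis using True by (simp add: flip_mat_def Tm_def mult.commute)
  next
    case False
    then have "\<not> (snd j = snd i + fst \<alpha> \<and> fst j = fst i - fst \<alpha>)" by (auto simp: prod_eq_iff)
    then show ?thesis using False by (auto simp: flip_mat_def Tm_def)
  qed
  then show ?thesis by (simp add: vec_eq_iff)
qed

lemma flip_lin_Tm: "flip_mat (lin_mat c (Tm d)) = lin_mat (\<lambda>\<alpha>. c (- \<alpha>)) (Tm d)"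
proof -
  have "(\<Sum>\<alpha>\<in>UNIV. c \<alpha> * Tm d (- \<alpha>) $ i $ j) = (\<Sum>\<alpha>\<in>UNIV. c (- \<alpha>) * Tm d \<alpha> $ i $ j)" for i j
    by (rule sum.reindex_bij_witness[of _ uminus uminus]) auto
  then show ?thesis by (simp add: flip_lin_mat flip_Tm) (simp add: lin_mat_def vec_eq_iff)
qed

text \<open>Undoing the conjugation by d turns \<open>G\<close> into h g. Moving h past a power of g
  and g past a power of h produces the two parts of the phase, with opposite signs.\<close>

lemma twist_Tm:
  assumes d2: "\<And>i. (d i)\<^sup>2 = chi i"
    and G: "\<And>i j. G $ i $ j = (if j = i + 1 then d i * d j else 0)"
  shows "tensor_mat G (mat 1) ** Tm d \<alpha> = map_matrix ((*) (chi (snd \<alpha> - fst \<alpha>))) (Tm d \<alpha> ** tensor_mat G (mat 1))"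
proof -
  have "(tensor_mat G (mat 1) ** Tm d \<alpha>) $ i $ k = chi (snd \<alpha> - fst \<alpha>) * (Tm d \<alpha> ** tensor_mat G (mat 1)) $ i $ k" for i k
  proof -
    have "(tensor_mat G (mat 1) ** Tm d \<alpha>) $ i $ k
      = (\<Sum>j\<in>UNIV. if j = (fst i + 1, snd i) then d (fst i) * d (fst j) * Tm d \<alpha> $ j $ k else 0)"
      unfolding mat_mult_nth
      by (intro sum.cong refl) (auto simp: tensor_mat_def G mat_def prod_eq_iff)
    then have 1: "(tensor_mat G (mat 1) ** Tm d \<alpha>) $ i $ k = d (fst i) * d (fst i + 1) * Tm d \<alpha> $ (fst i + 1, snd i) $ k"
      by simp
    define j where "j = (fst i + fst \<alpha>, snd i - fst \<alpha>)"
    have "(Tm d \<alpha> ** tensor_mat G (mat 1)) $ i $ k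
      = (\<Sum>j'\<in>UNIV. if j' = j then Tm d \<alpha> $ i $ j' * tensor_mat G (mat 1) $ j' $ k else 0)"
      unfolding mat_mult_nth by (intro sum.cong refl) (simp add: Tm_def j_def)
    then have 2: "(Tm d \<alpha> ** tensor_mat G (mat 1)) $ i $ k = Tm d \<alpha> $ i $ j * tensor_mat G (mat 1) $ j $ k" by simp
    show ?thesis
    proof (cases "k = (fst j + 1, snd j)")
      case True
      then have k: "k = (fst (fst i + 1, snd i) + fst \<alpha>, snd (fst i + 1, snd i) - fst \<alpha>)"
        by (simp add: j_def algebra_simps)
      have c: "chi (fst i + 1) * chi (snd \<alpha> * (fst i + 1 - snd k))
        = chi (snd \<alpha> - fst \<alpha>) * chi (fst k) * chi (snd \<alpha> * (fst i - snd k))"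
        unfolding chi_add[symmetric] by (rule arg_cong[of _ _ chi]) (simp add: True j_def algebra_simps)
      have "d (fst i) * d (fst i + 1) * Tm d \<alpha> $ (fst i + 1, snd i) $ k
        = d (fst i) * d (snd i) / (d (fst k) * d (snd k)) * ((d (fst i + 1))\<^sup>2 * chi (snd \<alpha> * (fst i + 1 - snd k)))"
        using k by (simp add: Tm_def power2_eq_square)
      also have "\<dots> = d (fst i) * d (snd i) / (d (fst k) * d (snd k)) * (chi (snd \<alpha> - fst \<alpha>) * (d (fst k))\<^sup>2 * chi (snd \<alpha> * (fst i - snd k)))"
        unfolding d2 c ..
      also have "\<dots> = chi (snd \<alpha> - fst \<alpha>) * (Tm d \<alpha> $ i $ j * tensor_mat G (mat 1) $ j $ k)"
        using True j_def d0 by (simp add: Tm_def tensor_mat_def G mat_def power2_eq_square)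
      finally show ?thesis unfolding 1 2 .
    next
      case False
      then have "k \<noteq> (fst i + 1 + fst \<alpha>, snd i - fst \<alpha>)" by (auto simp: j_def algebra_simps)
      moreover have "tensor_mat G (mat 1) $ j $ k = 0"
        using False by (auto simp: tensor_mat_def G mat_def prod_eq_iff)
      ultimately show ?thesis unfolding 1 2 by (simp add: Tm_def)
    qed
  qed
  then show ?thesis by (simp add: vec_eq_iff)
qed

end

section \<open>Coefficients of the R-matrix\<close>

lemma tensor_diagonal_conj:
  fixes X :: "complex^('k::finite \<times> 'k)^('k \<times> 'k)" and s r :: "complex^'k^'k"
  assumes s: "\<And>i j. s $ i $ j = (if i = j then d i else 0)" and r: "\<And>i j. r $ i $ j = (if i = j then e i else 0)"
  shows "(tensor_mat s s ** X ** tensor_mat r r) $ i $ j = d (fst i) * d (snd i) * X $ i $ j * (e (fst j) * e (snd j))"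
proof -
  have 1: "tensor_mat s s $ a $ b = (if a = b then d (fst a) * d (snd a) else 0)" for a b
    by (auto simp: tensor_mat_def s prod_eq_iff)
  have 2: "tensor_mat r r $ a $ b = (if a = b then e (fst b) * e (snd b) else 0)" for a b
    by (auto simp: tensor_mat_def r prod_eq_iff)
  show ?thesis
    by (simp add: matrix_matrix_mult_def 1 2 if_distrib[of "\<lambda>x. x * _"] if_distrib[of "\<lambda>x. _ * x"] cong: if_cong)
qed

lemma diagonal_inverse:
  fixes s :: "complex^'k^'k"
  assumes s: "\<And>i j. s $ i $ j = (if i = j then d i else 0)" and d0: "\<And>i. d i \<noteq> (0::complex)"
  shows "matrix_inv s $ i $ j = (if i = j then 1 / d i else 0)"
proof -
  define r :: "complex^'k^'k" where "r = (\<chi> i j. if i = j then 1 / d i else 0)"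
  have "matrix_inv s = r"
    by (rule matrix_inv_eqI) (use d0 in \<open>auto simp: r_def vec_eq_iff matrix_matrix_mult_def s mat_def
      if_distrib[of "\<lambda>x. x * _"] if_distrib[of "\<lambda>x. _ * x"] cong: if_cong\<close>)
  then show ?thesis by (simp add: r_def)
qed

lemma gmat_entries: "gmat $ i $ j = (if i = j then chi (i :: 'n::nontriv mod_ring) else 0)"
proof -
  have "omega CARD('n) powi to_int_mod_ring i = chi i" for i :: "'n mod_ring"
    unfolding omega_def chi_def exp_power_int by (rule arg_cong[of _ _ exp]) simp
  then show ?thesis by (simp add: gmat_def)
qed

lemma hmat_entries: "hmat $ i $ j = (if j = i + 1 then 1 else 0)" for i :: "'n::nontriv mod_ring"
  by (simp add: hmat_def)

lemma chi_power: "chi a ^ k = chi (a * of_nat k)"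
  by (induction k) (simp_all add: chi_add[symmetric] algebra_simps)

lemma nat_to_int_mod_ring [simp]: "of_nat (nat (to_int_mod_ring a)) = (a :: 'n::nontriv mod_ring)"
proof -
  have "0 \<le> to_int_mod_ring a" using range_to_int_mod_ring[where ?'a = 'n] by auto
  then show ?thesis by (metis of_int_to_int_mod_ring of_nat_nat of_int_of_nat_eq)
qed

lemma mat_power_gmat: "mat_power gmat k $ i $ j = (if i = j then chi (i :: 'n::nontriv mod_ring) ^ k else 0)"
proof (induction k arbitrary: i j)
  case 0 then show ?case by (simp add: mat_power_def mat_def)
next
  case (Suc k)
  have "mat_power gmat (Suc k) = gmat ** (mat_power gmat k :: complex^('n mod_ring)^('n mod_ring))"
    by (simp add: mat_power_def)
  then show ?case
    by (simp add: mat_mult_nth gmat_entries Suc if_distrib[of "\<lambda>x. x * _"] cong: if_cong)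
qed

lemma mat_power_hmat: "mat_power hmat k $ i $ j = (if j = i + of_nat k then 1 else 0)" for i :: "'n::nontriv mod_ring"
proof (induction k arbitrary: i j)
  case 0 then show ?case by (auto simp: mat_power_def mat_def)
next
  case (Suc k)
  have "mat_power hmat (Suc k) = hmat ** (mat_power hmat k :: complex^('n mod_ring)^('n mod_ring))"
    by (simp add: mat_power_def)
  then show ?case
    by (simp add: mat_mult_nth hmat_entries Suc if_distrib[of "\<lambda>x. x * _"] add_ac cong: if_cong)
qed

lemma Imat_entries: "Imat \<alpha>1 \<alpha>2 $ i $ j = (if j = i + \<alpha>1 then chi (\<alpha>2 * i) else 0)"
  for i :: "'n::nontriv mod_ring"
proof -
  have "Imat \<alpha>1 \<alpha>2 $ i $ j = (\<Sum>k\<in>UNIV. if k = i then (if j = i + \<alpha>1 then chi (\<alpha>2 * i) else 0) else 0)"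
    unfolding Imat_def mat_mult_nth
    by (intro sum.cong refl) (simp add: mat_power_gmat mat_power_hmat chi_power mult.commute)
  then show ?thesis by simp
qed

lemma Imat_inverse_entries: "matrix_inv (Imat \<alpha>1 \<alpha>2) $ i $ j = (if i = j + \<alpha>1 then chi (- (\<alpha>2 * j)) else 0)"
  for i :: "'n::nontriv mod_ring"
proof -
  define J :: "complex^('n mod_ring)^('n mod_ring)" where "J = (\<chi> i j. if i = j + \<alpha>1 then chi (- (\<alpha>2 * j)) else 0)"
  have "(Imat \<alpha>1 \<alpha>2 ** J) $ i $ k = mat 1 $ i $ k" for i k
  proof -
    have "(Imat \<alpha>1 \<alpha>2 ** J) $ i $ k = (\<Sum>j\<in>UNIV. if j = i + \<alpha>1 then chi (\<alpha>2 * i) * J $ j $ k else 0)"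
      unfolding mat_mult_nth by (intro sum.cong refl) (simp add: Imat_entries)
    then have "(Imat \<alpha>1 \<alpha>2 ** J) $ i $ k = chi (\<alpha>2 * i) * J $ (i + \<alpha>1) $ k" by simp
    then show ?thesis by (simp add: J_def mat_def chi_minus_mult)
  qed
  moreover have "(J ** Imat \<alpha>1 \<alpha>2) $ i $ k = mat 1 $ i $ k" for i k
  proof -
    have "(J ** Imat \<alpha>1 \<alpha>2) $ i $ k = (\<Sum>j\<in>UNIV. if j = i - \<alpha>1 then J $ i $ j * Imat \<alpha>1 \<alpha>2 $ j $ k else 0)"
      unfolding mat_mult_nth by (intro sum.cong refl) (auto simp: J_def)
    then have "(J ** Imat \<alpha>1 \<alpha>2) $ i $ k = J $ i $ (i - \<alpha>1) * Imat \<alpha>1 \<alpha>2 $ (i - \<alpha>1) $ k" by simp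
    then show ?thesis by (auto simp: J_def Imat_entries mat_def chi_minus_mult)
  qed
  ultimately have "matrix_inv (Imat \<alpha>1 \<alpha>2) = J"
    by (intro matrix_inv_eqI) (simp_all add: vec_eq_iff)
  then show ?thesis by (simp add: J_def)
qed

lemma diagonal_sqrt_gD:
  fixes s :: "complex^('n::nontriv mod_ring)^('n mod_ring)"
  assumes "diagonal_sqrt_g s"
  shows "i \<noteq> j \<Longrightarrow> s $ i $ j = 0" "(s $ i $ i)\<^sup>2 = chi i" "s $ i $ i \<noteq> 0"
proof -
  show 1: "s $ i $ j = 0" if "i \<noteq> j" for i j
    using assms that by (simp add: diagonal_sqrt_g_def)
  have "(s ** s) $ i $ i = chi i" using assms by (simp add: diagonal_sqrt_g_def gmat_entries)
  also have "(s ** s) $ i $ i = (\<Sum>j\<in>UNIV. if j = i then s $ i $ i * s $ i $ i else 0)"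
    unfolding mat_mult_nth by (intro sum.cong refl) (simp add: 1)
  finally show 2: "(s $ i $ i)\<^sup>2 = chi i" by (simp add: power2_eq_square)
  then show "s $ i $ i \<noteq> 0" by (metis chi_nonzero zero_power2)
qed

text \<open>The Gaussian factors and the constant of \<open>jtheta_th\<close> are common to
  numerator and denominator; only their dependence on \<xi> survives, and it is the exponential in
  \<open>phi\<close>.\<close>

lemma Wfun_phi:
  assumes im: "Im \<tau> > 0"
  shows "Wfun \<alpha>1 \<alpha>2 \<xi> \<zeta> \<tau> = 1 / of_nat CARD('n::nontriv) * phi \<tau> (\<alpha>1 :: 'n mod_ring, \<alpha>2) \<xi> (\<zeta> / of_nat CARD('n))"
proof -
  obtain C where C: "C \<noteq> 0" "\<forall>(a1::real) (a2::real) (\<xi>::complex). jtheta (1/2 + a1) (1/2 + a2) \<xi> \<tau>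
    = C * exp (\<i> * pi * a1\<^sup>2 * \<tau> + 2 * \<i> * pi * a1 * (\<xi> + 1/2 + a2)) * th \<tau> (\<xi> + a1 * \<tau> + a2)"
    using jtheta_th[OF im] by (elim exE conjE)
  define N where "N = CARD('n)"
  define a1 a2 where "a1 = real_of_int (to_int_mod_ring \<alpha>1) / real N" and "a2 = real_of_int (to_int_mod_ring \<alpha>2) / real N"
  define y where "y = \<zeta> / of_nat N"
  define E where "E = (\<lambda>\<xi>::complex. exp (\<i> * pi * a1\<^sup>2 * \<tau> + 2 * \<i> * pi * a1 * (\<xi> + 1/2 + a2)))"
  have t: "a1 * \<tau> + a2 = tors \<tau> (\<alpha>1, \<alpha>2)"
    by (simp add: tors_def a1_def a2_def N_def add_divide_distrib)
  have j: "jtheta (1/2 + a1) (1/2 + a2) v \<tau> = C * E v * th \<tau> (v + tors \<tau> (\<alpha>1, \<alpha>2))" for v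
    unfolding C(2)[rule_format] E_def t[symmetric] by (simp add: add.assoc)
  have e: "E (\<xi> + y) = exp (2 * \<i> * pi * a1 * \<xi>) * E y"
    unfolding E_def exp_add[symmetric] by (rule arg_cong[of _ _ exp]) (simp add: algebra_simps)
  have E0: "E y \<noteq> 0" by (simp add: E_def)
  have "jtheta (1/2 + a1) (1/2 + a2) (\<xi> + y) \<tau> / jtheta (1/2 + a1) (1/2 + a2) y \<tau>
    = phi \<tau> (\<alpha>1, \<alpha>2) \<xi> y"
    unfolding j e phi_def using C(1) E0 by (simp add: a1_def N_def)
  then show ?thesis unfolding Wfun_def Let_def a1_def a2_def N_def y_def by (simp only:)
qed

lemma jtheta_half_ratio:
  assumes im: "Im \<tau> > 0"
  shows "jtheta (1/2) (1/2) v \<tau> / jtheta (1/2) (1/2) w \<tau> = th \<tau> v / th \<tau> w"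
proof -
  obtain C where C: "C \<noteq> 0" "\<forall>(a1::real) (a2::real) (\<xi>::complex). jtheta (1/2 + a1) (1/2 + a2) \<xi> \<tau>
    = C * exp (\<i> * pi * a1\<^sup>2 * \<tau> + 2 * \<i> * pi * a1 * (\<xi> + 1/2 + a2)) * th \<tau> (\<xi> + a1 * \<tau> + a2)"
    using jtheta_th[OF im] by (elim exE conjE)
  have "jtheta (1/2) (1/2) v \<tau> = C * th \<tau> v" for v
    using C(2)[rule_format, of 0 0 v] by simp
  then show ?thesis using C(1) by simp
qed

definition Rcoeff :: "complex \<Rightarrow> complex \<Rightarrow> complex \<Rightarrow> 'n::nontriv zn2 \<Rightarrow> complex" where
  "Rcoeff \<zeta> \<tau> u \<alpha> = scalar_factor CARD('n) \<zeta> \<tau> u * phi \<tau> \<alpha> u (\<zeta> / of_nat CARD('n)) / of_nat CARD('n)"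

lemma Rhat_lin_mat:
  fixes s :: "complex^('n::nontriv mod_ring)^('n mod_ring)"
  assumes im: "Im \<tau> > 0" and s: "diagonal_sqrt_g s"
  shows "Rhat s u \<zeta> \<tau> = lin_mat (Rcoeff \<zeta> \<tau> u) (Tm (\<lambda>i. s $ i $ i))"
proof -
  define N where "N = CARD('n)"
  define d where "d i = s $ i $ i" for i
  note sD = diagonal_sqrt_gD[OF s]
  have d0: "d i \<noteq> 0" for i using sD(3) by (simp add: d_def)
  have se: "s $ i $ j = (if i = j then d i else 0)" for i j using sD(1) by (simp add: d_def)
  have ie: "matrix_inv s $ i $ j = (if i = j then 1 / d i else 0)" for i j by (rule diagonal_inverse[OF se d0])
  define pref where "pref = exp (\<i> * pi * u * (2 / of_nat N - 2))
                 * inv_kappa N (q_of \<zeta>) (p_of \<tau>) (exp (2 * \<i> * pi * u))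
                 * (th \<tau> \<zeta> / th \<tau> (u + \<zeta>))"
  have "Rhat s u \<zeta> \<tau> $ i $ j = lin_mat (Rcoeff \<zeta> \<tau> u) (Tm d) $ i $ j" for i j
  proof -
    have R: "Rtilde u \<zeta> \<tau> $ i $ j = pref * (\<Sum>\<alpha>\<in>UNIV. 1 / of_nat N * phi \<tau> \<alpha> u (\<zeta> / of_nat N)
        * (Imat (fst \<alpha>) (snd \<alpha>) $ fst i $ fst j * matrix_inv (Imat (fst \<alpha>) (snd \<alpha>)) $ snd i $ snd j))"
    proof -
      have "Rtilde u \<zeta> \<tau> $ i $ j = exp (\<i> * pi * u * (2 / of_nat N - 2))
                 * inv_kappa N (q_of \<zeta>) (p_of \<tau>) (exp (2 * \<i> * pi * u))
                 * (jtheta (1/2) (1/2) \<zeta> \<tau> / jtheta (1/2) (1/2) (u + \<zeta>) \<tau>)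
          * (\<Sum>\<alpha>1\<in>UNIV. \<Sum>\<alpha>2\<in>UNIV. Wfun \<alpha>1 \<alpha>2 u \<zeta> \<tau> * (Imat \<alpha>1 \<alpha>2 $ fst i $ fst j * matrix_inv (Imat \<alpha>1 \<alpha>2) $ snd i $ snd j))"
        unfolding Rtilde_def Let_def N_def nth_map_matrix sum_component tensor_mat_def vec_lambda_beta ..
      then show ?thesis
        unfolding jtheta_half_ratio[OF im] pref_def sum_UNIV_prod fst_conv snd_conv Wfun_phi[OF im] N_def .
    qed
    have T: "d (fst i) * d (snd i) * (Imat (fst \<alpha>) (snd \<alpha>) $ fst i $ fst j * matrix_inv (Imat (fst \<alpha>) (snd \<alpha>)) $ snd i $ snd j)
        * (1 / d (fst j) * (1 / d (snd j))) = Tm d \<alpha> $ i $ j" for \<alpha>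
    proof (cases "j = (fst i + fst \<alpha>, snd i - fst \<alpha>)")
      case True
      have "chi (snd \<alpha> * fst i) * chi (- (snd \<alpha> * snd j)) = chi (snd \<alpha> * (fst i - snd j))"
        unfolding chi_add[symmetric] by (rule arg_cong[of _ _ chi]) (simp add: algebra_simps)
      then show ?thesis using True by (simp add: Tm_def Imat_entries Imat_inverse_entries)
    next
      case False
      then have "\<not> (fst j = fst i + fst \<alpha> \<and> snd i = snd j + fst \<alpha>)" by (auto simp: prod_eq_iff)
      then show ?thesis using False by (auto simp: Tm_def Imat_entries Imat_inverse_entries)
    qed
    have "Rhat s u \<zeta> \<tau> $ i $ j = tauN N \<zeta> (\<zeta> / 2 - u) *
       (d (fst i) * d (snd i) * Rtilde u \<zeta> \<tau> $ i $ j * (1 / d (fst j) * (1 / d (snd j))))"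
      unfolding Rhat_def Rmat_def nth_map_matrix tensor_diagonal_conj[OF se ie] by (simp add: N_def)
    also have "\<dots> = (tauN N \<zeta> (\<zeta> / 2 - u) * pref) * (\<Sum>\<alpha>\<in>UNIV. 1 / of_nat N * phi \<tau> \<alpha> u (\<zeta> / of_nat N) * Tm d \<alpha> $ i $ j)"
      unfolding R T[symmetric] by (simp add: sum_distrib_left sum_distrib_right mult_ac)
    also have "tauN N \<zeta> (\<zeta> / 2 - u) * pref = scalar_factor N \<zeta> \<tau> u"
      unfolding pref_def by (rule tauN_scalar_factor)
    finally show ?thesis by (simp add: lin_mat_def Rcoeff_def N_def sum_distrib_left mult_ac)
  qed
  then show ?thesis by (simp add: vec_eq_iff d_def[abs_def])
qed

section \<open>Exchange relations over a noncommutative algebra\<close>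

lemma tensor_mat_left_nth: "tensor_mat A (mat 1) $ i $ j = (if snd i = snd j then A $ fst i $ fst j else 0)"
  by (simp add: tensor_mat_def mat_def)

lemma tensor_mat_right_nth: "tensor_mat (mat 1) A $ i $ j = (if fst i = fst j then A $ snd i $ snd j else 0)"
  by (simp add: tensor_mat_def mat_def)

lemma left_mult_nth: "(tensor_mat A (mat 1) ** X) $ i $ j = (\<Sum>a\<in>UNIV. A $ fst i $ a * X $ (a, snd i) $ j)"
  unfolding mat_mult_nth sum_UNIV_prod
  by (simp add: tensor_mat_left_nth if_distrib[of "\<lambda>x. x * _"] cong: if_cong)

lemma right_mult_nth: "(tensor_mat (mat 1) A ** X) $ i $ j = (\<Sum>a\<in>UNIV. A $ snd i $ a * X $ (fst i, a) $ j)"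
proof -
  have "(tensor_mat (mat 1) A ** X) $ i $ j
      = (\<Sum>k\<in>UNIV. if k = fst i then (\<Sum>a\<in>UNIV. A $ snd i $ a * X $ (k, a) $ j) else 0)"
    unfolding mat_mult_nth sum_UNIV_prod
    by (intro sum.cong refl) (simp add: tensor_mat_right_nth)
  then show ?thesis by simp
qed

lemma mult_left_nth: "(X ** tensor_mat A (mat 1)) $ i $ j = (\<Sum>a\<in>UNIV. X $ i $ (a, snd j) * A $ a $ fst j)"
  unfolding mat_mult_nth sum_UNIV_prod
  by (simp add: tensor_mat_left_nth if_distrib[of "\<lambda>x. _ * x"] cong: if_cong)

lemma mult_right_nth: "(X ** tensor_mat (mat 1) A) $ i $ j = (\<Sum>a\<in>UNIV. X $ i $ (fst j, a) * A $ a $ snd j)"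
proof -
  have "(X ** tensor_mat (mat 1) A) $ i $ j
      = (\<Sum>k\<in>UNIV. if k = fst j then (\<Sum>a\<in>UNIV. X $ i $ (k, a) * A $ a $ snd j) else 0)"
    unfolding mat_mult_nth sum_UNIV_prod
    by (intro sum.cong refl) (simp add: tensor_mat_right_nth)
  then show ?thesis by simp
qed

lemma tensor_left_mult: "tensor_mat A (mat 1) ** tensor_mat B (mat 1) = tensor_mat (A ** B) (mat 1)"
  by (simp add: vec_eq_iff left_mult_nth) (simp add: tensor_mat_left_nth mat_mult_nth)

lemma tensor_right_mult: "tensor_mat (mat 1) A ** tensor_mat (mat 1) B = tensor_mat (mat 1) (A ** B)"
  by (simp add: vec_eq_iff right_mult_nth) (simp add: tensor_mat_right_nth mat_mult_nth)

lemma tensor_mat_1_1: "tensor_mat (mat 1) (mat 1) = mat 1"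
  by (auto simp: vec_eq_iff tensor_mat_def mat_def)

lemma flip_tensor: "flip_mat (tensor_mat A (mat 1)) = tensor_mat (mat 1) A" "flip_mat (tensor_mat (mat 1) A) = tensor_mat A (mat 1)"
  by (simp_all add: vec_eq_iff flip_mat_def tensor_mat_left_nth tensor_mat_right_nth)

lemma flip_mult: "flip_mat (A ** B) = flip_mat A ** flip_mat (B :: 'a::semiring_1^('k::finite \<times> 'l::finite)^('k \<times> 'l))"
proof -
  have "(\<Sum>k\<in>UNIV. A $ i $ k * B $ k $ j) = (\<Sum>k\<in>UNIV. A $ i $ (snd k, fst k) * B $ (snd k, fst k) $ j)" for i j
    by (rule sum.reindex_bij_witness[of _ "\<lambda>k. (snd k, fst k)" "\<lambda>k. (snd k, fst k)"]) simp_all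
  then show ?thesis by (simp add: vec_eq_iff mat_mult_nth flip_mat_def)
qed

lemma flip_flip [simp]: "flip_mat (flip_mat X) = X"
  by (simp add: flip_mat_def vec_eq_iff)

lemma pt1_pt1 [simp]: "pt1 (pt1 X) = X"
  by (simp add: pt1_def vec_eq_iff)

lemma pt1_flip: "pt1 (flip_mat X) = flip_mat (pt2 X)" "flip_mat (pt1 X) = pt2 (flip_mat X)" "pt1 (flip_mat (pt2 X)) = flip_mat X"
  by (simp_all add: flip_mat_def pt1_def pt2_def vec_eq_iff)

lemma flip_mat_1: "flip_mat (mat c) = mat c"
  by (auto simp: flip_mat_def mat_def vec_eq_iff)

lemma trace_flip: "trace (flip_mat X) = trace X"
  unfolding trace_def flip_mat_def
  by (rule sum.reindex_bij_witness[of _ "\<lambda>k. (snd k, fst k)" "\<lambda>k. (snd k, fst k)"]) simp_all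

text \<open>Only the summation indices of the first tensor factor are renamed. The order of the two
  entries in each product is kept, so commutativity is not involved.\<close>

lemma trace_pt1: "trace (P ** Q) = trace (pt1 P ** pt1 Q)"
proof -
  have "trace (P ** Q) = (\<Sum>x\<in>UNIV \<times> UNIV. P $ fst x $ snd x * Q $ snd x $ fst x)"
    by (simp add: trace_def mat_mult_nth sum.cartesian_product case_prod_unfold)
  also have "\<dots> = (\<Sum>x\<in>UNIV \<times> UNIV. pt1 P $ fst x $ snd x * pt1 Q $ snd x $ fst x)"
    by (rule sum.reindex_bij_witness[of _ "\<lambda>x. ((fst (snd x), snd (fst x)), (fst (fst x), snd (snd x)))"
        "\<lambda>x. ((fst (snd x), snd (fst x)), (fst (fst x), snd (snd x)))"]) (auto simp: pt1_def)
  also have "\<dots> = trace (pt1 P ** pt1 Q)"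
    by (simp add: trace_def mat_mult_nth sum.cartesian_product case_prod_unfold)
  finally show ?thesis .
qed

text \<open>Tr(A B) equals the trace of the product of the transposes in the same order, since both
  sum products of an entry of A followed by one of B. The transposed form is chosen because the
  partially transposed exchange relation acts on the transpose of B next to A'.\<close>

lemma trace_product:
  fixes A B :: "'a::ring_1^'k^'k" and C D :: "'a^'l^'l"
  shows "trace (A ** B) * trace (C ** D) =
   trace (tensor_mat (transpose A) (mat 1) ** tensor_mat (transpose B) (mat 1) ** (tensor_mat (mat 1) C ** tensor_mat (mat 1) D))"
proof -
  have 1: "trace (tensor_mat X (mat 1) ** tensor_mat (mat 1) Y) = trace X * trace Y" for X :: "'a^'k^'k" and Y :: "'a^'l^'l"
  proof -
    have "(tensor_mat X (mat 1) ** tensor_mat (mat 1) Y) $ i $ i = X $ fst i $ fst i * Y $ snd i $ snd i" for i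
      unfolding left_mult_nth by (simp add: tensor_mat_right_nth if_distrib[of "\<lambda>x. _ * x"] cong: if_cong)
    then show ?thesis unfolding trace_def sum_UNIV_prod by (simp add: sum_product)
  qed
  have 2: "trace (transpose A ** transpose B) = trace (A ** B)"
    unfolding trace_def mat_mult_nth transpose_def by (simp, rule sum.swap)
  show ?thesis unfolding tensor_left_mult tensor_right_mult 1 2 ..
qed

section \<open>Traces and exchange relations with central scalars\<close>

context
  fixes \<iota> :: "complex \<Rightarrow> 'a::ring_1"
  assumes alg: "complex_algebra \<iota>"
begin

lemma iota_1: "\<iota> 1 = 1" and iota_add: "\<iota> (x + y) = \<iota> x + \<iota> y" and iota_mult: "\<iota> (x * y) = \<iota> x * \<iota> y"
  and iota_central: "\<iota> x * b = b * \<iota> x"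
  using alg unfolding complex_algebra_def by blast+

lemma iota_0: "\<iota> 0 = 0"
  using iota_add[of 0 0] by simp

lemma iota_sum: "\<iota> (sum f A) = (\<Sum>x\<in>A. \<iota> (f x))"
  by (induction A rule: infinite_finite_induct) (simp_all add: iota_0 iota_add)

lemma iota_matrix_mult: "map_matrix \<iota> (A ** B) = map_matrix \<iota> A ** map_matrix \<iota> B"
  by (simp add: vec_eq_iff mat_mult_nth iota_sum iota_mult)

lemma iota_mat: "map_matrix \<iota> (mat c) = mat (\<iota> c)"
  by (simp add: vec_eq_iff mat_def iota_0)

lemma iota_mat_1: "map_matrix \<iota> (mat 1) = mat 1"
  by (simp add: iota_mat iota_1)

lemma iota_scale: "map_matrix \<iota> (map_matrix ((*) c) A) = mat (\<iota> c) ** map_matrix \<iota> A"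
  by (simp add: vec_eq_iff mat_mult_nth mat_def iota_mult if_distrib[of "\<lambda>x. x * _"] cong: if_cong)

lemma scalar_mat_central: "mat (\<iota> c) ** A = A ** mat (\<iota> c)"
  by (simp add: vec_eq_iff mat_mult_nth mat_def iota_central if_distrib[of "\<lambda>x. x * _"] if_distrib[of "\<lambda>x. _ * x"] cong: if_cong)

lemma trace_scalar: "trace (mat (\<iota> c) ** A) = \<iota> c * trace A"
  by (simp add: trace_def mat_mult_nth mat_def sum_distrib_left if_distrib[of "\<lambda>x. x * _"] cong: if_cong)

text \<open>Cyclicity of the trace fails over a noncommutative ring; it survives when the entries of
  one factor are central.\<close>

lemma trace_iota_commute: "trace (map_matrix \<iota> C ** Z) = trace (Z ** map_matrix \<iota> C)"
  unfolding trace_def mat_mult_nth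
  by (subst sum.swap) (simp add: iota_central)

lemma iota_flip: "map_matrix \<iota> (flip_mat A) = flip_mat (map_matrix \<iota> A)"
  by (simp add: flip_mat_def vec_eq_iff)

lemma iota_tensor_left: "map_matrix \<iota> (tensor_mat A (mat 1)) = tensor_mat (map_matrix \<iota> A) (mat 1)"
  by (simp add: vec_eq_iff tensor_mat_left_nth iota_0)

lemma iota_tensor_right: "map_matrix \<iota> (tensor_mat (mat 1) A) = tensor_mat (mat 1) (map_matrix \<iota> A)"
  by (simp add: vec_eq_iff tensor_mat_right_nth iota_0)

lemma tensor_commute:
  "tensor_mat (map_matrix \<iota> C) (mat 1) ** tensor_mat (mat 1) A = tensor_mat (mat 1) A ** tensor_mat (map_matrix \<iota> C) (mat 1)"
proof -
  have "(tensor_mat (map_matrix \<iota> C) (mat 1) ** tensor_mat (mat 1) A) $ i $ j = \<iota> (C $ fst i $ fst j) * A $ snd i $ snd j" for i j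
    unfolding left_mult_nth by (simp add: tensor_mat_right_nth if_distrib[of "\<lambda>x. _ * x"] cong: if_cong)
  moreover have "(tensor_mat (mat 1) A ** tensor_mat (map_matrix \<iota> C) (mat 1)) $ i $ j = A $ snd i $ snd j * \<iota> (C $ fst i $ fst j)" for i j
    unfolding right_mult_nth by (simp add: tensor_mat_left_nth if_distrib[of "\<lambda>x. _ * x"] cong: if_cong)
  ultimately show ?thesis by (simp add: vec_eq_iff iota_central)
qed

text \<open>Because scalar entries are central, the partial transpose extracts the matrix that
  stands between A and A'. This turns an exchange relation with scalars in the middle into one with
  scalars outside.\<close>

lemma pt1_left: "pt1 (tensor_mat A (mat 1) ** map_matrix \<iota> C ** tensor_mat (mat 1) A')
  = map_matrix \<iota> (pt1 C) ** tensor_mat (transpose A) (mat 1) ** tensor_mat (mat 1) A'"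
  by (simp add: vec_eq_iff pt1_def mult_right_nth mult_left_nth left_mult_nth transpose_def iota_central)

lemma pt1_right: "pt1 (tensor_mat (mat 1) A' ** map_matrix \<iota> D ** tensor_mat B (mat 1))
  = tensor_mat (mat 1) A' ** tensor_mat (transpose B) (mat 1) ** map_matrix \<iota> (pt1 D)"
  unfolding matrix_mul_assoc[symmetric]
  by (simp add: vec_eq_iff pt1_def mult_left_nth right_mult_nth left_mult_nth transpose_def iota_central)

text \<open>The inverse \<open>X\<close> of the partial transpose of \<open>C\<close> permits the
  interchange of B and A' inside the trace. A second partial transpose under the trace then restores
  A and B and puts the scalar matrices back in positions where the other relations apply.\<close>

lemma trace_exchange:
  assumes BA: "tensor_mat B (mat 1) ** map_matrix \<iota> C ** tensor_mat (mat 1) A'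
      = tensor_mat (mat 1) A' ** map_matrix \<iota> D ** tensor_mat B (mat 1)"
    and X: "X ** pt1 C = mat 1"
  shows "trace (A ** B) * trace (A' ** B') = trace (map_matrix \<iota> (pt1 X) ** tensor_mat A (mat 1) ** tensor_mat (mat 1) A'
    ** (map_matrix \<iota> D ** tensor_mat B (mat 1) ** tensor_mat (mat 1) B'))"
proof -
  let ?At = "tensor_mat (transpose A) (mat 1)" and ?Bt = "tensor_mat (transpose B) (mat 1)"
    and ?A = "tensor_mat (mat 1) A'" and ?B = "tensor_mat (mat 1) B'"
  have "map_matrix \<iota> (pt1 C) ** ?Bt ** ?A = ?A ** ?Bt ** map_matrix \<iota> (pt1 D)"
    using arg_cong[OF BA, of pt1] unfolding pt1_left pt1_right .
  then have "map_matrix \<iota> X ** (map_matrix \<iota> (pt1 C) ** ?Bt ** ?A) = map_matrix \<iota> X ** (?A ** ?Bt ** map_matrix \<iota> (pt1 D))"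
    by simp
  moreover have "map_matrix \<iota> X ** map_matrix \<iota> (pt1 C) = mat 1"
    unfolding iota_matrix_mult[symmetric] X by (rule iota_mat_1)
  ultimately have ex: "?Bt ** ?A = map_matrix \<iota> X ** (?A ** ?Bt ** map_matrix \<iota> (pt1 D))"
    by (simp add: matrix_mul_assoc)
  have "trace (A ** B) * trace (A' ** B') = trace (?At ** (?Bt ** ?A) ** ?B)"
    unfolding trace_product by (simp only: matrix_mul_assoc)
  also have "\<dots> = trace ((?At ** map_matrix \<iota> X ** ?A) ** (?Bt ** map_matrix \<iota> (pt1 D) ** ?B))"
    unfolding ex by (simp only: matrix_mul_assoc)
  also have "\<dots> = trace (pt1 (?At ** map_matrix \<iota> X ** ?A) ** pt1 (?Bt ** map_matrix \<iota> (pt1 D) ** ?B))"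
    by (rule trace_pt1)
  finally show ?thesis unfolding pt1_left by simp
qed

text \<open>Both products of traces are multiples of the trace of \<open>A'\<^sub>2 A\<^sub>1 B\<^sub>1 B'\<^sub>2\<close>.\<close>
lemma quadratic_exchange:
  fixes A B A' B' :: "'a^'k^'k"
  assumes AA: "map_matrix \<iota> R ** tensor_mat A (mat 1) ** tensor_mat (mat 1) A'
      = tensor_mat (mat 1) A' ** tensor_mat A (mat 1) ** map_matrix \<iota> Rs"
    and BB: "map_matrix \<iota> Rs ** tensor_mat (mat 1) B' ** tensor_mat B (mat 1)
      = tensor_mat B (mat 1) ** tensor_mat (mat 1) B' ** map_matrix \<iota> R"
    and BA: "tensor_mat B (mat 1) ** map_matrix \<iota> C ** tensor_mat (mat 1) A'
      = tensor_mat (mat 1) A' ** map_matrix \<iota> (flip_mat Rsm) ** tensor_mat B (mat 1)"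
    and BA': "tensor_mat B' (mat 1) ** map_matrix \<iota> C' ** tensor_mat (mat 1) A
      = tensor_mat (mat 1) A ** map_matrix \<iota> (flip_mat Rs) ** tensor_mat B' (mat 1)"
    and X: "X ** pt1 C = mat 1" "pt1 X = map_matrix ((*) a) R"
    and X': "X' ** pt1 C' = mat 1" "pt1 X' = map_matrix ((*) a') Rm"
    and U: "Rs ** flip_mat Rsm = mat U" "R ** flip_mat Rm = mat U"
    and a': "a' \<noteq> 0"
  shows "trace (A ** B) * trace (A' ** B') = \<iota> (a / a') * trace (A' ** B') * trace (A ** B)"
proof -
  let ?A = "tensor_mat A (mat 1)" and ?A' = "tensor_mat (mat 1) A'"
    and ?B = "tensor_mat B (mat 1)" and ?B' = "tensor_mat (mat 1) B'"
  define T where "T = trace (?A' ** ?A ** ?B ** ?B')"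
  have "trace (A ** B) * trace (A' ** B')
      = trace (mat (\<iota> a) ** (map_matrix \<iota> R ** ?A ** ?A') ** (map_matrix \<iota> (flip_mat Rsm) ** ?B ** ?B'))"
    unfolding trace_exchange[OF BA X(1)] X(2) iota_scale by (simp only: matrix_mul_assoc)
  also have "\<dots> = \<iota> a * trace (?A' ** ?A ** (map_matrix \<iota> Rs ** map_matrix \<iota> (flip_mat Rsm)) ** ?B ** ?B')"
    unfolding AA unfolding matrix_mul_assoc[symmetric] trace_scalar by (simp only: matrix_mul_assoc)
  also have "?A' ** ?A ** (map_matrix \<iota> Rs ** map_matrix \<iota> (flip_mat Rsm)) ** ?B ** ?B' = mat (\<iota> U) ** (?A' ** ?A ** ?B ** ?B')"
    unfolding iota_matrix_mult[symmetric] U iota_mat scalar_mat_central by (simp only: matrix_mul_assoc scalar_mat_central[symmetric])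
  finally have 1: "trace (A ** B) * trace (A' ** B') = \<iota> a * (\<iota> U * T)"
    unfolding trace_scalar T_def .
  have "trace (A' ** B') * trace (A ** B)
      = trace (mat (\<iota> a') ** map_matrix \<iota> Rm ** tensor_mat A' (mat 1) ** tensor_mat (mat 1) A
         ** (map_matrix \<iota> (flip_mat Rs) ** tensor_mat B' (mat 1) ** tensor_mat (mat 1) B))"
    unfolding trace_exchange[OF BA' X'(1)] X'(2) iota_scale ..
  \<comment> \<open>Exchanging the tensor factors places A and B in the first space again, so that
    this trace can be compared with the one for the opposite order.\<close>
  also have "\<dots> = trace (flip_mat (mat (\<iota> a') ** map_matrix \<iota> Rm ** tensor_mat A' (mat 1) ** tensor_mat (mat 1) A
         ** (map_matrix \<iota> (flip_mat Rs) ** tensor_mat B' (mat 1) ** tensor_mat (mat 1) B)))"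
    by (simp only: trace_flip)
  also have "\<dots> = trace (mat (\<iota> a') ** map_matrix \<iota> (flip_mat Rm) ** ?A' ** ?A ** (map_matrix \<iota> Rs ** ?B' ** ?B))"
    by (simp only: flip_mult flip_tensor flip_mat_1 iota_flip flip_flip)
  also have "\<dots> = \<iota> a' * trace ((map_matrix \<iota> (flip_mat Rm) ** ?A' ** ?A ** ?B ** ?B') ** map_matrix \<iota> R)"
    unfolding BB unfolding matrix_mul_assoc[symmetric] trace_scalar by (simp only: matrix_mul_assoc)
  also have "trace ((map_matrix \<iota> (flip_mat Rm) ** ?A' ** ?A ** ?B ** ?B') ** map_matrix \<iota> R)
      = trace ((map_matrix \<iota> R ** map_matrix \<iota> (flip_mat Rm)) ** (?A' ** ?A ** ?B ** ?B'))"
    unfolding trace_iota_commute[symmetric] by (simp only: matrix_mul_assoc)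
  finally have 2: "trace (A' ** B') * trace (A ** B) = \<iota> a' * (\<iota> U * T)"
    unfolding iota_matrix_mult[symmetric] U iota_mat trace_scalar T_def .
  have "\<iota> (a / a') * (trace (A' ** B') * trace (A ** B)) = \<iota> (a / a' * a') * (\<iota> U * T)"
    unfolding 2 iota_mult by (simp only: mult.assoc)
  also have "a / a' * a' = a" using a' by simp
  finally show ?thesis using 1 by (simp only: mult.assoc)
qed


lemma iota_inverse_left:
  assumes "G ** H = mat 1"
  shows "tensor_mat (map_matrix \<iota> G) (mat 1) ** tensor_mat (map_matrix \<iota> H) (mat 1) = mat 1"
    "tensor_mat (mat 1) (map_matrix \<iota> G) ** tensor_mat (mat 1) (map_matrix \<iota> H) = mat 1"
  unfolding tensor_left_mult tensor_right_mult iota_matrix_mult[symmetric] assms iota_mat_1 by (rule tensor_mat_1_1)+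

text \<open>\<open>R\<close> and \<open>Rs\<close> commute with the conjugating matrix applied in
  both tensor factors, so the conjugated matrices satisfy the same exchange relation as L; inverting
  both of them reverses the order of the factors.\<close>

lemma inverse_exchange:
  fixes L L' B B' :: "'a^'k^'k"
  assumes ex: "map_matrix \<iota> R ** tensor_mat L (mat 1) ** tensor_mat (mat 1) L'
      = tensor_mat (mat 1) L' ** tensor_mat L (mat 1) ** map_matrix \<iota> Rs"
    and GH: "G ** H = mat 1" "H ** G = mat 1"
    and B: "B ** (map_matrix \<iota> G ** L ** map_matrix \<iota> H) = mat 1" "(map_matrix \<iota> G ** L ** map_matrix \<iota> H) ** B = mat 1"
    and B': "B' ** (map_matrix \<iota> G ** L' ** map_matrix \<iota> H) = mat 1" "(map_matrix \<iota> G ** L' ** map_matrix \<iota> H) ** B' = mat 1"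
    and RG: "tensor_mat G (mat 1) ** tensor_mat (mat 1) G ** R = R ** (tensor_mat G (mat 1) ** tensor_mat (mat 1) G)"
    and RsG: "tensor_mat G (mat 1) ** tensor_mat (mat 1) G ** Rs = Rs ** (tensor_mat G (mat 1) ** tensor_mat (mat 1) G)"
  shows "map_matrix \<iota> Rs ** tensor_mat (mat 1) B' ** tensor_mat B (mat 1)
      = tensor_mat B (mat 1) ** tensor_mat (mat 1) B' ** map_matrix \<iota> R"
proof -
  define g1 g2 h1 h2 where "g1 = tensor_mat (map_matrix \<iota> G) (mat 1 :: 'a^'k^'k)"
    and "g2 = tensor_mat (mat 1 :: 'a^'k^'k) (map_matrix \<iota> G)"
    and "h1 = tensor_mat (map_matrix \<iota> H) (mat 1 :: 'a^'k^'k)"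
    and "h2 = tensor_mat (mat 1 :: 'a^'k^'k) (map_matrix \<iota> H)"
  define l1 l2 where "l1 = tensor_mat L (mat 1 :: 'a^'k^'k)" and "l2 = tensor_mat (mat 1 :: 'a^'k^'k) L'"
  define P P' where "P = tensor_mat (map_matrix \<iota> G ** L ** map_matrix \<iota> H) (mat 1 :: 'a^'k^'k)"
    and "P' = tensor_mat (mat 1 :: 'a^'k^'k) (map_matrix \<iota> G ** L' ** map_matrix \<iota> H)"
  define b1 b2 where "b1 = tensor_mat B (mat 1 :: 'a^'k^'k)" and "b2 = tensor_mat (mat 1 :: 'a^'k^'k) B'"
  define r rs where "r = map_matrix \<iota> R" and "rs = map_matrix \<iota> Rs"
  have P: "P = g1 ** l1 ** h1" "P' = g2 ** l2 ** h2"
    by (simp_all add: P_def P'_def g1_def l1_def h1_def g2_def l2_def h2_def tensor_left_mult tensor_right_mult)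
  have gh: "h1 ** g1 = mat 1" "h2 ** g2 = mat 1" "g1 ** h1 = mat 1" "g2 ** h2 = mat 1"
    unfolding g1_def h1_def g2_def h2_def using iota_inverse_left[OF GH(1)] iota_inverse_left[OF GH(2)] by simp_all
  have c: "h1 ** g2 = g2 ** h1" "h1 ** l2 = l2 ** h1" "g1 ** g2 = g2 ** g1" "g1 ** l2 = l2 ** g1" "h1 ** h2 = h2 ** h1" "g1 ** h2 = h2 ** g1"
    unfolding h1_def g1_def g2_def l2_def h2_def by (rule tensor_commute)+
  have c2: "l1 ** g2 = g2 ** l1" "l1 ** h2 = h2 ** l1"
  proof -
    have "flip_mat (tensor_mat (map_matrix \<iota> C) (mat 1) ** tensor_mat (mat 1) L) = flip_mat (tensor_mat (mat 1) L ** tensor_mat (map_matrix \<iota> C) (mat 1 :: 'a^'k^'k))" for C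
      by (simp only: tensor_commute)
    then have "tensor_mat (mat 1 :: 'a^'k^'k) (map_matrix \<iota> C) ** tensor_mat L (mat 1) = tensor_mat L (mat 1) ** tensor_mat (mat 1) (map_matrix \<iota> C)" for C
      by (simp only: flip_mult flip_tensor)
    from this[symmetric] show "l1 ** g2 = g2 ** l1" "l1 ** h2 = h2 ** l1" by (simp_all only: l1_def g2_def h2_def)
  qed
  have rg: "g1 ** g2 ** r = r ** (g1 ** g2)" "g1 ** g2 ** rs = rs ** (g1 ** g2)"
    unfolding g1_def g2_def r_def rs_def iota_tensor_left[symmetric] iota_tensor_right[symmetric] iota_matrix_mult[symmetric]
    by (simp_all only: RG RsG)
  have hhgg: "(h1 ** h2) ** (g1 ** g2) = mat 1" "(g1 ** g2) ** (h1 ** h2) = mat 1"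
  proof -
    have "(h1 ** h2) ** (g1 ** g2) = h2 ** ((h1 ** g1) ** g2)" unfolding c(5) by (simp only: matrix_mul_assoc)
    then show "(h1 ** h2) ** (g1 ** g2) = mat 1" by (simp add: gh)
    have "(g1 ** g2) ** (h1 ** h2) = g1 ** (g2 ** h2) ** h1" unfolding c(5) by (simp only: matrix_mul_assoc)
    then show "(g1 ** g2) ** (h1 ** h2) = mat 1" by (simp add: gh)
  qed
  have hr: "rs ** (h1 ** h2) = (h1 ** h2) ** rs"
  proof -
    have "rs ** (h1 ** h2) = ((h1 ** h2) ** (g1 ** g2)) ** rs ** (h1 ** h2)" by (simp add: hhgg)
    also have "\<dots> = (h1 ** h2) ** (g1 ** g2 ** rs) ** (h1 ** h2)" by (simp only: matrix_mul_assoc)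
    also have "\<dots> = (h1 ** h2) ** rs ** ((g1 ** g2) ** (h1 ** h2))" unfolding rg by (simp only: matrix_mul_assoc)
    finally show ?thesis by (simp add: hhgg)
  qed
  have "r ** P ** P' = r ** g1 ** (l1 ** (h1 ** g2)) ** l2 ** h2" unfolding P by (simp only: matrix_mul_assoc)
  also have "\<dots> = r ** g1 ** (l1 ** g2) ** (h1 ** l2) ** h2" unfolding c(1) by (simp only: matrix_mul_assoc)
  also have "\<dots> = (r ** (g1 ** g2)) ** l1 ** l2 ** (h1 ** h2)" unfolding c(2) c2(1) by (simp only: matrix_mul_assoc)
  also have "\<dots> = (g1 ** g2) ** (r ** l1 ** l2) ** (h1 ** h2)" unfolding rg[symmetric] by (simp only: matrix_mul_assoc)
  also have "r ** l1 ** l2 = l2 ** l1 ** rs" unfolding r_def rs_def l1_def l2_def by (rule ex)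
  also have "(g1 ** g2) ** (l2 ** l1 ** rs) ** (h1 ** h2) = g1 ** g2 ** l2 ** l1 ** (rs ** (h1 ** h2))"
    by (simp only: matrix_mul_assoc)
  also have "\<dots> = g2 ** (g1 ** l2) ** (l1 ** h2) ** h1 ** rs" unfolding hr unfolding c(3) c(5) by (simp only: matrix_mul_assoc)
  also have "\<dots> = g2 ** l2 ** (g1 ** h2) ** l1 ** h1 ** rs" unfolding c(4) c2(2) by (simp only: matrix_mul_assoc)
  also have "\<dots> = P' ** P ** rs" unfolding c(6) P by (simp only: matrix_mul_assoc)
  finally have RPP: "r ** P ** P' = P' ** P ** rs" .
  have bP: "b1 ** P = mat 1" "P ** b1 = mat 1" "b2 ** P' = mat 1" "P' ** b2 = mat 1"
    by (simp_all add: b1_def P_def b2_def P'_def tensor_left_mult tensor_right_mult B B' tensor_mat_1_1)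
  have "b1 ** b2 ** r = b1 ** b2 ** r ** (P ** (P' ** b2) ** b1)" by (simp add: bP)
  also have "\<dots> = b1 ** b2 ** (r ** P ** P') ** b2 ** b1" by (simp only: matrix_mul_assoc)
  also have "\<dots> = (b1 ** (b2 ** P') ** P) ** rs ** b2 ** b1" unfolding RPP by (simp only: matrix_mul_assoc)
  also have "\<dots> = rs ** b2 ** b1" by (simp add: bP)
  finally show ?thesis by (simp only: b1_def b2_def r_def rs_def)
qed

text \<open>Here only the first tensor factor is conjugated, so quasi-periodicity replaces the
  R-matrices by those at the unshifted arguments. \<open>C\<close> and \<open>D\<close> are their
  unitarity partners, and the factors 1/U make them exact inverses.\<close>

lemma mixed_exchange:
  fixes L A B :: "'a^'k^'k"
  assumes ex: "map_matrix \<iota> Rv ** tensor_mat L (mat 1) ** tensor_mat (mat 1) A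
      = tensor_mat (mat 1) A ** tensor_mat L (mat 1) ** map_matrix \<iota> Rsv"
    and GH: "G ** H = mat 1" "H ** G = mat 1"
    and B: "B ** (map_matrix \<iota> G ** L ** map_matrix \<iota> H) = mat 1" "(map_matrix \<iota> G ** L ** map_matrix \<iota> H) ** B = mat 1"
    and tw: "tensor_mat G (mat 1) ** Rv = map_matrix ((*) (1 / U)) R ** tensor_mat G (mat 1)"
    and tws: "tensor_mat G (mat 1) ** Rsv = map_matrix ((*) (1 / Us)) Rs ** tensor_mat G (mat 1)"
    and C: "C ** R = mat U" and D: "Rs ** D = mat Us" and U: "U \<noteq> 0" "Us \<noteq> 0"
  shows "tensor_mat B (mat 1) ** map_matrix \<iota> C ** tensor_mat (mat 1) A
      = tensor_mat (mat 1) A ** map_matrix \<iota> D ** tensor_mat B (mat 1)"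
proof -
  define g h where "g = tensor_mat (map_matrix \<iota> G) (mat 1 :: 'a^'k^'k)"
    and "h = tensor_mat (map_matrix \<iota> H) (mat 1 :: 'a^'k^'k)"
  define l b where "l = tensor_mat L (mat 1 :: 'a^'k^'k)" and "b = tensor_mat B (mat 1 :: 'a^'k^'k)"
  define x where "x = tensor_mat (mat 1 :: 'a^'k^'k) A"
  define P where "P = tensor_mat (map_matrix \<iota> G ** L ** map_matrix \<iota> H) (mat 1 :: 'a^'k^'k)"
  define rv rsv r rs cc dd where "rv = map_matrix \<iota> Rv" and "rsv = map_matrix \<iota> Rsv"
    and "r = map_matrix \<iota> (map_matrix ((*) (1 / U)) R)" and "rs = map_matrix \<iota> (map_matrix ((*) (1 / Us)) Rs)"
    and "cc = map_matrix \<iota> C" and "dd = map_matrix \<iota> D"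
  have P: "P = g ** l ** h" by (simp add: P_def g_def l_def h_def tensor_left_mult)
  have gh: "g ** h = mat 1" "h ** g = mat 1" using iota_inverse_left(1)[OF GH(1)] iota_inverse_left(1)[OF GH(2)] by (simp_all add: g_def h_def)
  have c: "g ** x = x ** g" "h ** x = x ** h" unfolding g_def h_def x_def by (rule tensor_commute)+
  have grv: "g ** rv = r ** g" unfolding g_def rv_def r_def iota_tensor_left[symmetric] iota_matrix_mult[symmetric] tw ..
  have grsv: "g ** rsv = rs ** g" unfolding g_def rsv_def rs_def iota_tensor_left[symmetric] iota_matrix_mult[symmetric] tws ..
  have cr: "cc ** r = mat 1"
  proof -
    have "C ** map_matrix ((*) (1 / U)) R = mat 1"
    proof -
      have "(C ** map_matrix ((*) (1 / U)) R) $ i $ j = 1 / U * (C ** R) $ i $ j" for i j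
        by (simp add: mat_mult_nth sum_divide_distrib)
      then show ?thesis using U by (simp add: vec_eq_iff C mat_def)
    qed
    then show ?thesis unfolding cc_def r_def iota_matrix_mult[symmetric] by (simp only: iota_mat_1)
  qed
  have rd: "rs ** dd = mat 1"
  proof -
    have "map_matrix ((*) (1 / Us)) Rs ** D = mat 1"
    proof -
      have "(map_matrix ((*) (1 / Us)) Rs ** D) $ i $ j = 1 / Us * (Rs ** D) $ i $ j" for i j
        by (simp add: mat_mult_nth sum_divide_distrib)
      then show ?thesis using U by (simp add: vec_eq_iff D mat_def)
    qed
    then show ?thesis unfolding dd_def rs_def iota_matrix_mult[symmetric] by (simp only: iota_mat_1)
  qed
  have bP: "b ** P = mat 1" "P ** b = mat 1" by (simp_all add: b_def P_def tensor_left_mult B tensor_mat_1_1)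
  have ex': "rv ** l ** x = x ** l ** rsv" unfolding rv_def rsv_def l_def x_def by (rule ex)
  have "r ** P ** x = (r ** g) ** l ** (h ** x)" unfolding P by (simp only: matrix_mul_assoc)
  also have "\<dots> = g ** (rv ** l ** x) ** h" unfolding grv[symmetric] c by (simp only: matrix_mul_assoc)
  also have "\<dots> = (g ** x) ** l ** rsv ** h" unfolding ex' by (simp only: matrix_mul_assoc)
  also have "\<dots> = x ** g ** l ** ((h ** g) ** rsv ** h)" unfolding c gh by (simp only: matrix_mul_assoc matrix_mul_lid)
  also have "\<dots> = x ** g ** l ** h ** (g ** rsv) ** h" by (simp only: matrix_mul_assoc)
  also have "\<dots> = x ** P ** rs ** (g ** h)" unfolding grsv P by (simp only: matrix_mul_assoc)
  finally have key: "r ** P ** x = x ** P ** rs" unfolding gh by simp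
  have "b ** cc ** x = b ** cc ** x ** (P ** b)" by (simp add: bP)
  also have "\<dots> = b ** cc ** (x ** P ** (rs ** dd)) ** b" unfolding rd by (simp add: matrix_mul_assoc)
  also have "\<dots> = b ** cc ** (x ** P ** rs) ** dd ** b" by (simp only: matrix_mul_assoc)
  also have "\<dots> = b ** (cc ** r) ** P ** x ** dd ** b" unfolding key[symmetric] by (simp only: matrix_mul_assoc)
  also have "\<dots> = x ** dd ** b" unfolding cr by (simp add: bP)
  finally show ?thesis by (simp only: b_def cc_def x_def dd_def)
qed

end

section \<open>Unitarity, crossing and quasi-periodicity\<close>

lemma lin_mat_twist:
  fixes F :: "'b::finite \<Rightarrow> complex^'k^'k"
  assumes "\<And>\<alpha>. K ** F \<alpha> = map_matrix ((*) (x \<alpha>)) (F \<alpha> ** K)"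
  shows "K ** lin_mat c F = lin_mat (\<lambda>\<alpha>. c \<alpha> * x \<alpha>) F ** K"
proof -
  have "(K ** lin_mat c F) $ i $ j = (lin_mat (\<lambda>\<alpha>. c \<alpha> * x \<alpha>) F ** K) $ i $ j" for i j
  proof -
    have "(K ** lin_mat c F) $ i $ j = (\<Sum>k\<in>UNIV. \<Sum>\<alpha>\<in>UNIV. K $ i $ k * (c \<alpha> * F \<alpha> $ k $ j))"
      by (simp add: mat_mult_nth lin_mat_def sum_distrib_left)
    also have "\<dots> = (\<Sum>\<alpha>\<in>UNIV. \<Sum>k\<in>UNIV. K $ i $ k * (c \<alpha> * F \<alpha> $ k $ j))"
      by (rule sum.swap)
    also have "\<dots> = (\<Sum>\<alpha>\<in>UNIV. c \<alpha> * (K ** F \<alpha>) $ i $ j)"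
      by (simp add: mat_mult_nth sum_distrib_left mult_ac)
    also have "\<dots> = (\<Sum>\<alpha>\<in>UNIV. \<Sum>k\<in>UNIV. c \<alpha> * x \<alpha> * F \<alpha> $ i $ k * K $ k $ j)"
      unfolding assms by (simp add: mat_mult_nth sum_distrib_left mult_ac)
    also have "\<dots> = (\<Sum>k\<in>UNIV. \<Sum>\<alpha>\<in>UNIV. c \<alpha> * x \<alpha> * F \<alpha> $ i $ k * K $ k $ j)"
      by (rule sum.swap)
    also have "\<dots> = (lin_mat (\<lambda>\<alpha>. c \<alpha> * x \<alpha>) F ** K) $ i $ j"
      by (simp add: mat_mult_nth lin_mat_def sum_distrib_right)
    finally show ?thesis .
  qed
  then show ?thesis by (simp add: vec_eq_iff)
qed

lemma scalar_inverse_commute: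
  fixes A B :: "complex^'k^'k"
  assumes "A ** B = mat r" "r \<noteq> 0"
  shows "B ** A = mat r"
proof -
  have 1: "A ** map_matrix ((*) (1 / r)) B = mat 1"
  proof -
    have "(A ** map_matrix ((*) (1 / r)) B) $ i $ j = 1 / r * (A ** B) $ i $ j" for i j
      by (simp add: mat_mult_nth sum_divide_distrib)
    then show ?thesis using assms by (simp add: vec_eq_iff mat_def)
  qed
  then have 2: "map_matrix ((*) (1 / r)) B ** A = mat 1" by (simp only: matrix_left_right_inverse)
  have "(B ** A) $ i $ j = r * (map_matrix ((*) (1 / r)) B ** A) $ i $ j" for i j
    using assms(2) by (simp add: mat_mult_nth sum_divide_distrib[symmetric])
  then show ?thesis by (simp add: vec_eq_iff 2 mat_def)
qed

lemma p_of_power_int: "p_of \<tau> powi n = exp (2 * \<i> * pi * (of_int n * \<tau>))"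
  by (simp add: p_of_def exp_power_int algebra_simps)

text \<open>An N-torsion relation for \<zeta>/N would place \<zeta> itself in the lattice, that is,
  make q^2 an integer power of p.\<close>

lemma regular_at_criterion:
  assumes im: "Im \<tau> > 0" and N: "N \<ge> 1" and q: "\<And>n::int. (q_of \<zeta>)\<^sup>2 \<noteq> p_of \<tau> powi n"
  shows "regular_at N \<tau> (\<zeta> / of_nat N)"
  unfolding regular_at_def
proof (intro allI notI)
  fix k l :: int
  assume "th \<tau> (\<zeta> / of_nat N + (of_int k * \<tau> + of_int l) / of_nat N) = 0"
  then obtain m n :: int where "\<zeta> / of_nat N + (of_int k * \<tau> + of_int l) / of_nat N = of_int m * \<tau> + of_int n"
    using th_zero_iff[OF im] by blast
  then have "\<zeta> = of_int (int N * m - k) * \<tau> + of_int (int N * n - l)"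
    using N by (simp add: field_simps)
  then have "2 * \<i> * pi * \<zeta> = 2 * \<i> * pi * (of_int (int N * m - k) * \<tau>) + 2 * \<i> * pi * of_int (int N * n - l)"
    by (simp only: distrib_left)
  then have "exp (2 * \<i> * pi * \<zeta>) = p_of \<tau> powi (int N * m - k)"
    by (simp only: exp_add_2pi_int p_of_power_int)
  moreover have "exp (2 * \<i> * pi * \<zeta>) = (q_of \<zeta>)\<^sup>2" using q_of_power[of \<zeta> 1] by simp
  ultimately show False using q by simp
qed

context
  fixes s :: "complex^('n::nontriv mod_ring)^('n mod_ring)"
  assumes s: "diagonal_sqrt_g s"
begin

lemma card_ge_1: "CARD('n) \<ge> 1"
  using nontriv[where ?'a = 'n] by simp

lemma card_nz: "(of_nat CARD('n) :: complex) \<noteq> 0"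
  using card_ge_1 by simp

lemma s_nonzero: "s $ i $ i \<noteq> 0"
  using diagonal_sqrt_gD(3)[OF s] .

abbreviation Ts :: "'n zn2 \<Rightarrow> complex^('n zn2)^('n zn2)" where
  "Ts \<equiv> Tm (\<lambda>i. s $ i $ i)"

lemma Ts_mult: "lin_mat c Ts ** lin_mat e Ts = lin_mat (\<lambda>\<gamma>. \<Sum>\<alpha>\<in>UNIV. br \<alpha> (\<gamma> - \<alpha>) * (c \<alpha> * e (\<gamma> - \<alpha>))) Ts"
  by (rule lin_mat_mult, rule Tm_mult, rule s_nonzero)

lemma pt2_Ts_mult: "lin_mat c (\<lambda>\<alpha>. pt2 (Ts \<alpha>)) ** lin_mat e (\<lambda>\<alpha>. pt2 (Ts \<alpha>))
    = lin_mat (\<lambda>\<gamma>. \<Sum>\<alpha>\<in>UNIV. 1 * (c \<alpha> * e (\<gamma> - \<alpha>))) (\<lambda>\<alpha>. pt2 (Ts \<alpha>))"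
  by (rule lin_mat_mult[where w = "\<lambda>_ _. 1"], rule pt2_Tm_mult, rule s_nonzero)

lemma Ts_0: "Ts 0 = mat 1"
  by (rule Tm_0, rule s_nonzero)

lemma pt2_Ts_0: "pt2 (Ts 0) = mat 1"
  by (rule pt2_Tm_0, rule s_nonzero)

lemma flip_Ts: "flip_mat (Ts \<alpha>) = Ts (- \<alpha>)"
  by (rule flip_Tm, rule s_nonzero)

lemma flip_lin_Ts: "flip_mat (lin_mat c Ts) = lin_mat (\<lambda>\<alpha>. c (- \<alpha>)) Ts"
  by (rule flip_lin_Tm, rule s_nonzero)

lemma G_entries: "(s ** hmat ** s) $ i $ j = (if j = i + 1 then s $ i $ i * s $ j $ j else 0)"
proof -
  have 1: "(s ** hmat) $ i $ j = (\<Sum>k\<in>UNIV. if k = i then s $ i $ i * hmat $ i $ j else 0)" for i j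
    unfolding mat_mult_nth by (intro sum.cong refl) (simp add: diagonal_sqrt_gD(1)[OF s])
  have "(s ** hmat ** s) $ i $ j = (\<Sum>k\<in>UNIV. if k = j then (s ** hmat) $ i $ j * s $ j $ j else 0)"
    unfolding mat_mult_nth[of "s ** hmat"] by (intro sum.cong refl) (simp add: diagonal_sqrt_gD(1)[OF s])
  then show ?thesis by (simp add: 1 hmat_entries)
qed

context
  fixes \<zeta> \<tau> :: complex
  assumes imz: "Im \<zeta> > 0" and im: "Im \<tau> > 0" and reg: "regular_at CARD('n) \<tau> (\<zeta> / of_nat CARD('n))"
begin

lemma th_zeta: "th \<tau> \<zeta> \<noteq> 0"
  using regular_multiple[OF im reg] card_ge_1 card_nz by simp

lemma Rcoeff_flip:
  "Rcoeff \<zeta> \<tau> (- w) (- \<alpha>) = scalar_factor CARD('n) \<zeta> \<tau> (- w) * phi \<tau> \<alpha> w (- (\<zeta> / of_nat CARD('n))) / of_nat CARD('n)"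
  for \<alpha> :: "'n zn2"
  by (simp add: Rcoeff_def phi_minus[OF im])

lemma Rhat_unitarity:
  assumes g: "generic_at CARD('n) \<zeta> \<tau> u"
  shows "Rhat s u \<zeta> \<tau> ** flip_mat (Rhat s (- u) \<zeta> \<tau>) = mat (unitarity_factor CARD('n) \<zeta> u)"
proof -
  define N where "N = CARD('n)"
  define y where "y = \<zeta> / of_nat N"
  have Ny: "of_nat N * y = \<zeta>" using card_nz by (simp add: y_def N_def)
  let ?sf = "scalar_factor N \<zeta> \<tau>"
  have c: "(\<Sum>\<alpha>\<in>UNIV. br \<alpha> (\<gamma> - \<alpha>) * (Rcoeff \<zeta> \<tau> u \<alpha> * Rcoeff \<zeta> \<tau> (- u) (- (\<gamma> - \<alpha>))))
    = (if \<gamma> = 0 then unitarity_factor N \<zeta> u else 0)" for \<gamma> :: "'n zn2"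
  proof -
    \<comment> \<open>The pairing is alternating, so the twist of the matrix product is the Fourier
      phase occurring in \<open>unitarity_convolution\<close>.\<close>
    have "br \<alpha> (\<gamma> - \<alpha>) = br \<alpha> \<gamma>" for \<alpha>
      using br_add(2)[of \<alpha> "\<gamma> - \<alpha>" \<alpha>] by simp
    then have "(\<Sum>\<alpha>\<in>UNIV. br \<alpha> (\<gamma> - \<alpha>) * (Rcoeff \<zeta> \<tau> u \<alpha> * Rcoeff \<zeta> \<tau> (- u) (- (\<gamma> - \<alpha>))))
      = ?sf u * ?sf (- u) / (of_nat N)\<^sup>2 * (\<Sum>\<alpha>\<in>UNIV. br \<alpha> \<gamma> * (phi \<tau> \<alpha> u y * phi \<tau> (\<gamma> - \<alpha>) u (- y)))"
      unfolding Rcoeff_flip sum_distrib_left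
      by (intro sum.cong refl) (simp add: Rcoeff_def N_def y_def power2_eq_square)
    also have "\<dots> = (if \<gamma> = 0 then ?sf u * ?sf (- u) * (th \<tau> (\<zeta> + u) * th \<tau> (\<zeta> - u) / (th \<tau> \<zeta>)\<^sup>2) else 0)"
      using unitarity_convolution[OF im reg, of \<gamma> u] card_nz
      unfolding N_def[symmetric] y_def[symmetric] Ny by simp
    also have "\<dots> = (if \<gamma> = 0 then unitarity_factor N \<zeta> u else 0)"
      using scalar_factor_unitarity[OF card_ge_1 imz im g th_zeta] by (simp add: N_def)
    finally show ?thesis .
  qed
  show ?thesis
    unfolding Rhat_lin_mat[OF im s] flip_lin_Ts Ts_mult c
      N_def[symmetric]
    by (rule lin_mat_delta, rule Ts_0)
qed

lemma Rhat_unitarity':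
  assumes "generic_at CARD('n) \<zeta> \<tau> u"
  shows "flip_mat (Rhat s (- u) \<zeta> \<tau>) ** Rhat s u \<zeta> \<tau> = mat (unitarity_factor CARD('n) \<zeta> u)"
  using Rhat_unitarity[OF assms] unitarity_factor_nonzero[OF card_ge_1 imz assms] by (rule scalar_inverse_commute)

lemma Rhat_crossing:
  "\<exists>k. k \<noteq> 0 \<and> (\<forall>v. generic_at CARD('n) \<zeta> \<tau> v \<longrightarrow> generic_at CARD('n) \<zeta> \<tau> (v + of_nat CARD('n) * \<zeta>) \<longrightarrow>
     pt2 (flip_mat (Rhat s (- v - of_nat CARD('n) * \<zeta>) \<zeta> \<tau>)) ** pt2 (Rhat s v \<zeta> \<tau>)
       = mat (k * unitarity_factor CARD('n) \<zeta> v))"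
proof -
  define N where "N = CARD('n)"
  define y where "y = \<zeta> / of_nat N"
  have N0: "(of_nat N :: complex) \<noteq> 0" using card_nz by (simp add: N_def)
  have Ny: "(of_nat N)\<^sup>2 * y = of_nat N * \<zeta>" using N0 by (simp add: y_def power2_eq_square)
  let ?sf = "scalar_factor N \<zeta> \<tau>"
  obtain C where C: "C \<noteq> 0" "\<forall>u (\<gamma> :: 'n zn2).
    (\<Sum>\<alpha>\<in>UNIV. phi \<tau> \<alpha> u y * phi \<tau> (\<gamma> - \<alpha>) (u + of_nat N * \<zeta>) (- y))
     = (if \<gamma> = 0 then C * th \<tau> u * th \<tau> (u + of_nat N * \<zeta>) else 0)"
    using crossing_convolution[OF im reg] unfolding N_def[symmetric] y_def[symmetric] Ny by (elim exE conjE)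
  \<comment> \<open>It collects the constant of the convolution and th(\<zeta>)^2 from the
    prefactors. Independence of v is what lets it cancel in the structure function.\<close>
  define k where "k = - (C * (th \<tau> \<zeta>)\<^sup>2 / (of_nat N)\<^sup>2)"
  have k0: "k \<noteq> 0" using C(1) th_zeta N0 by (simp add: k_def)
  have "pt2 (flip_mat (Rhat s (- v - of_nat N * \<zeta>) \<zeta> \<tau>)) ** pt2 (Rhat s v \<zeta> \<tau>) = mat (k * unitarity_factor N \<zeta> v)"
    if g: "generic_at N \<zeta> \<tau> v" "generic_at N \<zeta> \<tau> (v + of_nat N * \<zeta>)" for v
  \<comment> \<open>The convolution computes the product in the opposite order; for square complex
    matrices whose product is a nonzero scalar the order is immaterial.\<close>
  proof (rule scalar_inverse_commute)
    define w where "w = v + of_nat N * \<zeta>"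
    have mw: "- v - of_nat N * \<zeta> = - w" by (simp add: w_def)
    have c: "(\<Sum>\<alpha>\<in>UNIV. 1 * (Rcoeff \<zeta> \<tau> v \<alpha> * Rcoeff \<zeta> \<tau> (- w) (- (\<gamma> - \<alpha>))))
      = (if \<gamma> = 0 then k * unitarity_factor N \<zeta> v else 0)" for \<gamma> :: "'n zn2"
    proof -
      have "(\<Sum>\<alpha>\<in>UNIV. 1 * (Rcoeff \<zeta> \<tau> v \<alpha> * Rcoeff \<zeta> \<tau> (- w) (- (\<gamma> - \<alpha>))))
        = ?sf v * ?sf (- w) / (of_nat N)\<^sup>2 * (\<Sum>\<alpha>\<in>UNIV. phi \<tau> \<alpha> v y * phi \<tau> (\<gamma> - \<alpha>) w (- y))"
        unfolding Rcoeff_flip sum_distrib_left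
        by (intro sum.cong refl) (simp add: Rcoeff_def N_def y_def power2_eq_square)
      also have "\<dots> = (if \<gamma> = 0 then C / (of_nat N)\<^sup>2 * (?sf v * ?sf (- w) * (th \<tau> v * th \<tau> w)) else 0)"
        using C(2)[rule_format, of v \<gamma>] unfolding w_def by simp
      also have "?sf v * ?sf (- w) * (th \<tau> v * th \<tau> w) = - (th \<tau> \<zeta>)\<^sup>2 * unitarity_factor N \<zeta> v"
        using scalar_factor_crossing[OF _ imz im g] card_ge_1 unfolding mw w_def[symmetric] by (simp add: N_def)
      finally show ?thesis by (simp add: k_def)
    qed
    show "pt2 (Rhat s v \<zeta> \<tau>) ** pt2 (flip_mat (Rhat s (- v - of_nat N * \<zeta>) \<zeta> \<tau>)) = mat (k * unitarity_factor N \<zeta> v)"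
      unfolding mw Rhat_lin_mat[OF im s] flip_lin_Ts pt2_lin_mat pt2_Ts_mult c
      by (rule lin_mat_delta, rule pt2_Ts_0)
    show "k * unitarity_factor N \<zeta> v \<noteq> 0"
      using k0 unitarity_factor_nonzero[OF _ imz g(1)] card_ge_1 by (simp add: N_def)
  qed
  then show ?thesis unfolding N_def[symmetric] by (intro exI[of _ k] conjI allI impI k0)
qed

lemma Rcoeff_quasiperiod:
  assumes g: "generic_at CARD('n) \<zeta> \<tau> u" "generic_at CARD('n) \<zeta> \<tau> (u + (\<tau> + 1))"
  shows "Rcoeff \<zeta> \<tau> (u + (\<tau> + 1)) \<alpha> = chi (fst \<alpha> - snd \<alpha>) / unitarity_factor CARD('n) \<zeta> u * Rcoeff \<zeta> \<tau> u (\<alpha> :: 'n zn2)"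
proof -
  define y where "y = \<zeta> / of_nat CARD('n)"
  define e where "e = exp (- \<i> * pi * \<tau> - 2 * \<i> * pi * (u + y))"
  have U: "unitarity_factor CARD('n) \<zeta> u \<noteq> 0" by (rule unitarity_factor_nonzero[OF card_ge_1 imz g(1)])
  have "phi \<tau> \<alpha> (u + (\<tau> + 1)) y = chi (fst \<alpha>) * chi (- snd \<alpha>) * e * phi \<tau> \<alpha> u y"
    using phi_plus_1[OF im, of \<alpha> "u + \<tau>" y] phi_plus_tau[OF im, of \<alpha> u y] by (simp add: add.assoc e_def)
  also have "chi (fst \<alpha>) * chi (- snd \<alpha>) = chi (fst \<alpha> - snd \<alpha>)" unfolding chi_add[symmetric] by simp
  finally have p: "phi \<tau> \<alpha> (u + (\<tau> + 1)) y = chi (fst \<alpha> - snd \<alpha>) * e * phi \<tau> \<alpha> u y" .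
  have sf: "scalar_factor CARD('n) \<zeta> \<tau> (u + (\<tau> + 1)) * e = scalar_factor CARD('n) \<zeta> \<tau> u / unitarity_factor CARD('n) \<zeta> u"
    using scalar_factor_quasiperiod[OF card_ge_1 imz im g] U unfolding e_def y_def by (simp add: eq_divide_eq)
  have "Rcoeff \<zeta> \<tau> (u + (\<tau> + 1)) \<alpha>
    = chi (fst \<alpha> - snd \<alpha>) * (scalar_factor CARD('n) \<zeta> \<tau> (u + (\<tau> + 1)) * e) * phi \<tau> \<alpha> u y / of_nat CARD('n)"
    unfolding Rcoeff_def y_def[symmetric] p by (simp only: mult_ac)
  then show ?thesis unfolding sf by (simp add: Rcoeff_def y_def)
qed

text \<open>The index-dependent phase of the coefficients is inverse to the one created by moving G
  through the basis matrices, so only the scalar 1/U remains.\<close>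

lemma Rhat_quasiperiod:
  assumes g: "generic_at CARD('n) \<zeta> \<tau> u" "generic_at CARD('n) \<zeta> \<tau> (u + (\<tau> + 1))"
  shows "tensor_mat (s ** hmat ** s) (mat 1) ** Rhat s (u + (\<tau> + 1)) \<zeta> \<tau>
    = map_matrix ((*) (1 / unitarity_factor CARD('n) \<zeta> u)) (Rhat s u \<zeta> \<tau>) ** tensor_mat (s ** hmat ** s) (mat 1)"
proof -
  have "Rcoeff \<zeta> \<tau> (u + (\<tau> + 1)) \<alpha> * chi (snd \<alpha> - fst \<alpha>) = 1 / unitarity_factor CARD('n) \<zeta> u * Rcoeff \<zeta> \<tau> u \<alpha>" for \<alpha> :: "'n zn2"
  proof -
    have "chi (fst \<alpha> - snd \<alpha>) * chi (snd \<alpha> - fst \<alpha>) = 1" unfolding chi_add[symmetric] by simp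
    then show ?thesis unfolding Rcoeff_quasiperiod[OF g] by (simp add: mult_ac)
  qed
  then show ?thesis
    unfolding Rhat_lin_mat[OF im s] lin_mat_twist[OF twist_Tm[OF s_nonzero diagonal_sqrt_gD(2)[OF s] G_entries]] map_matrix_lin_mat
    by simp
qed

lemma Rcoeff_quasiperiod_nat:
  assumes "\<And>j. j \<le> m \<Longrightarrow> generic_at CARD('n) \<zeta> \<tau> (u + of_nat j * (\<tau> + 1))"
  shows "Rcoeff \<zeta> \<tau> (u + of_nat m * (\<tau> + 1)) \<alpha>
    = chi (fst \<alpha> - snd \<alpha>) ^ m * (\<Prod>j<m. 1 / unitarity_factor CARD('n) \<zeta> (u + of_nat j * (\<tau> + 1))) * Rcoeff \<zeta> \<tau> u (\<alpha> :: 'n zn2)"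
  using assms
proof (induction m)
  case (Suc m)
  have s: "u + of_nat (Suc m) * (\<tau> + 1) = (u + of_nat m * (\<tau> + 1)) + (\<tau> + 1)" by (simp add: algebra_simps)
  have g: "generic_at CARD('n) \<zeta> \<tau> (u + of_nat m * (\<tau> + 1))" "generic_at CARD('n) \<zeta> \<tau> ((u + of_nat m * (\<tau> + 1)) + (\<tau> + 1))"
    using Suc.prems[of m] Suc.prems[of "Suc m"] unfolding s by auto
  have IH: "Rcoeff \<zeta> \<tau> (u + of_nat m * (\<tau> + 1)) \<alpha>
    = chi (fst \<alpha> - snd \<alpha>) ^ m * (\<Prod>j<m. 1 / unitarity_factor CARD('n) \<zeta> (u + of_nat j * (\<tau> + 1))) * Rcoeff \<zeta> \<tau> u \<alpha>"
    by (rule Suc.IH, rule Suc.prems) simp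
  show ?case unfolding s Rcoeff_quasiperiod[OF g] IH by simp
qed simp

lemma Rhat_quasiperiod_multiple:
  assumes "CARD('n) dvd m" "\<And>j. j \<le> m \<Longrightarrow> generic_at CARD('n) \<zeta> \<tau> (u + of_nat j * (\<tau> + 1))"
  shows "Rhat s (u + of_nat m * (\<tau> + 1)) \<zeta> \<tau>
    = map_matrix ((*) (\<Prod>j<m. 1 / unitarity_factor CARD('n) \<zeta> (u + of_nat j * (\<tau> + 1)))) (Rhat s u \<zeta> \<tau>)"
proof -
  have "chi a ^ m = 1" for a :: "'n mod_ring"
  proof -
    obtain r where "m = CARD('n) * r" using assms(1) by blast
    then have "chi a ^ m = chi (a * (of_nat CARD('n) * of_nat r))" unfolding chi_power by simp
    then show ?thesis by simp
  qed
  then have "Rcoeff \<zeta> \<tau> (u + of_nat m * (\<tau> + 1)) = (\<lambda>\<alpha> :: 'n zn2. (\<Prod>j<m. 1 / unitarity_factor CARD('n) \<zeta> (u + of_nat j * (\<tau> + 1))) * Rcoeff \<zeta> \<tau> u \<alpha>)"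
    using Rcoeff_quasiperiod_nat[OF assms(2)] by auto
  then show ?thesis unfolding Rhat_lin_mat[OF im s] map_matrix_lin_mat by simp
qed

end

text \<open>The signs from the theta function in \<open>phi\<close> and from th(u + \<zeta>) in the
  prefactor cancel. A unit shift thus leaves the phase \<open>chi (fst \<alpha>)\<close>, whose N-th
  power is 1.\<close>

lemma Rhat_period:
  assumes imz: "Im \<zeta> > 0" and im: "Im \<tau> > 0"
  shows "Rhat s (u + of_int (int CARD('n) * k)) \<zeta> \<tau> = Rhat s u \<zeta> \<tau>"
proof -
  have nat: "Rcoeff \<zeta> \<tau> (u + of_nat (CARD('n) * m)) \<alpha> = Rcoeff \<zeta> \<tau> u \<alpha>" for m u and \<alpha> :: "'n zn2"
  proof -
    define y where "y = \<zeta> / of_nat CARD('n)"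
    have phn: "phi \<tau> \<alpha> (u + of_nat n) y = (-1) ^ n * chi (fst \<alpha>) ^ n * phi \<tau> \<alpha> u y" for n
    proof (induction n)
      case (Suc n)
      then show ?case using phi_plus_1[OF im, of \<alpha> "u + of_nat n" y] by (simp add: add_ac)
    qed simp
    have c: "chi (fst \<alpha>) ^ (CARD('n) * m) = 1" by (simp add: chi_power)
    have "phi \<tau> \<alpha> (u + of_nat (CARD('n) * m)) y = (-1) ^ (CARD('n) * m) * phi \<tau> \<alpha> u y"
      unfolding phn c by (simp only: mult_1_right)
    moreover have "scalar_factor CARD('n) \<zeta> \<tau> (u + of_nat (CARD('n) * m)) = (-1) ^ (CARD('n) * m) * scalar_factor CARD('n) \<zeta> \<tau> u"
      using scalar_factor_plus_int[OF card_ge_1 imz im, of u "int (CARD('n) * m)"] by (simp del: of_nat_mult)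
    moreover have "(-1 :: complex) ^ (CARD('n) * m) * (-1) ^ (CARD('n) * m) = 1"
      unfolding power_mult_distrib[symmetric] by simp
    ultimately show ?thesis unfolding Rcoeff_def y_def[symmetric] by (simp add: mult.assoc[symmetric])
  qed
  have "Rcoeff \<zeta> \<tau> (u + of_int (int CARD('n) * k)) \<alpha> = Rcoeff \<zeta> \<tau> u \<alpha>" for \<alpha> :: "'n zn2"
  proof (cases k rule: int_cases2)
    case (nonneg m) then show ?thesis using nat[of u m \<alpha>] by simp
  next
    case (nonpos m) then show ?thesis using nat[of "u - of_nat (CARD('n) * m)" m \<alpha>] by simp
  qed
  then show ?thesis unfolding Rhat_lin_mat[OF im s] by (simp add: lin_mat_def)
qed

text \<open>Flipping the tensor factors replaces \<alpha> by -\<alpha>, so G in the second factor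
  produces the inverse of the phase it produces in the first.\<close>

lemma Rhat_commute:
  assumes im: "Im \<tau> > 0"
  shows "tensor_mat (s ** hmat ** s) (mat 1) ** tensor_mat (mat 1) (s ** hmat ** s) ** Rhat s u \<zeta> \<tau>
    = Rhat s u \<zeta> \<tau> ** (tensor_mat (s ** hmat ** s) (mat 1) ** tensor_mat (mat 1) (s ** hmat ** s))"
proof -
  let ?G = "s ** hmat ** s" and ?T = "Tm (\<lambda>i. s $ i $ i)"
  note tw = twist_Tm[OF s_nonzero diagonal_sqrt_gD(2)[OF s] G_entries]
  have 2: "tensor_mat (mat 1) ?G ** ?T \<alpha> = map_matrix ((*) (chi (fst \<alpha> - snd \<alpha>))) (?T \<alpha> ** tensor_mat (mat 1) ?G)" for \<alpha>
  proof -
    have "flip_mat (tensor_mat ?G (mat 1) ** ?T (- \<alpha>)) = flip_mat (map_matrix ((*) (chi (snd (- \<alpha>) - fst (- \<alpha>)))) (?T (- \<alpha>) ** tensor_mat ?G (mat 1)))"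
      by (simp only: tw)
    also have "\<dots> = map_matrix ((*) (chi (snd (- \<alpha>) - fst (- \<alpha>)))) (flip_mat (?T (- \<alpha>) ** tensor_mat ?G (mat 1)))"
      by (simp add: flip_mat_def vec_eq_iff)
    finally show ?thesis by (simp add: flip_mult flip_tensor flip_Ts)
  qed
  have "tensor_mat ?G (mat 1) ** tensor_mat (mat 1) ?G ** ?T \<alpha> = map_matrix ((*) 1) (?T \<alpha> ** (tensor_mat ?G (mat 1) ** tensor_mat (mat 1) ?G))" for \<alpha>
  proof -
    have sc: "A ** map_matrix ((*) r) B = map_matrix ((*) r) (A ** B)" "map_matrix ((*) r) A ** B = map_matrix ((*) r) (A ** B)"
      for A B :: "complex^('n zn2)^('n zn2)" and r
      by (simp_all add: vec_eq_iff mat_mult_nth sum_distrib_left mult_ac)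
    have "tensor_mat ?G (mat 1) ** tensor_mat (mat 1) ?G ** ?T \<alpha> = tensor_mat ?G (mat 1) ** (tensor_mat (mat 1) ?G ** ?T \<alpha>)"
      by (simp only: matrix_mul_assoc)
    also have "\<dots> = map_matrix ((*) (chi (fst \<alpha> - snd \<alpha>))) ((tensor_mat ?G (mat 1) ** ?T \<alpha>) ** tensor_mat (mat 1) ?G)"
      unfolding 2 sc by (simp only: matrix_mul_assoc)
    also have "\<dots> = map_matrix ((*) (chi (fst \<alpha> - snd \<alpha>))) (map_matrix ((*) (chi (snd \<alpha> - fst \<alpha>))) (?T \<alpha> ** (tensor_mat ?G (mat 1) ** tensor_mat (mat 1) ?G)))"
      unfolding tw sc by (simp only: matrix_mul_assoc)
    also have "\<dots> = map_matrix ((*) (chi (fst \<alpha> - snd \<alpha>) * chi (snd \<alpha> - fst \<alpha>))) (?T \<alpha> ** (tensor_mat ?G (mat 1) ** tensor_mat (mat 1) ?G))"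
      by (simp add: vec_eq_iff mult.assoc)
    also have "chi (fst \<alpha> - snd \<alpha>) * chi (snd \<alpha> - fst \<alpha>) = 1" unfolding chi_add[symmetric] by simp
    finally show ?thesis .
  qed
  from lin_mat_twist[of _ ?T, OF this] show ?thesis
    unfolding Rhat_lin_mat[OF im s] by simp
qed

lemma G_inverse: "(s ** hmat ** s) ** matrix_inv (s ** hmat ** s) = mat 1" "matrix_inv (s ** hmat ** s) ** (s ** hmat ** s) = mat 1"
proof -
  define H :: "complex^('n mod_ring)^('n mod_ring)" where "H = (\<chi> i j. if i = j + 1 then 1 / (s $ i $ i * s $ j $ j) else 0)"
  have 1: "((s ** hmat ** s) ** H) $ i $ j = mat 1 $ i $ j" for i j
  proof -
    have "((s ** hmat ** s) ** H) $ i $ j = (\<Sum>k\<in>UNIV. if k = i + 1 then s $ i $ i * s $ k $ k * H $ k $ j else 0)"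
      unfolding mat_mult_nth[of "s ** hmat ** s"] by (intro sum.cong refl) (simp add: G_entries)
    also have "\<dots> = mat 1 $ i $ j"
      using s_nonzero by (auto simp: H_def mat_def)
    finally show ?thesis .
  qed
  then have "(s ** hmat ** s) ** H = mat 1" by (simp add: vec_eq_iff)
  moreover from this have "H ** (s ** hmat ** s) = mat 1" by (simp only: matrix_left_right_inverse)
  ultimately have "matrix_inv (s ** hmat ** s) = H" "(s ** hmat ** s) ** H = mat 1" "H ** (s ** hmat ** s) = mat 1"
    by (auto intro: matrix_inv_eqI)
  then show "(s ** hmat ** s) ** matrix_inv (s ** hmat ** s) = mat 1" "matrix_inv (s ** hmat ** s) ** (s ** hmat ** s) = mat 1"
    by simp_all
qed

end

section \<open>Closure of the quadratic algebra\<close>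

lemma invertible_matrix_inv:
  assumes "invertible A"
  shows "A ** matrix_inv A = mat 1" "matrix_inv A ** A = mat 1"
proof -
  have "A ** matrix_inv A = mat 1 \<and> matrix_inv A ** A = mat 1"
    unfolding matrix_inv_def by (rule someI_ex) (use assms in \<open>simp add: invertible_def\<close>)
  then show "A ** matrix_inv A = mat 1" "matrix_inv A ** A = mat 1" by simp_all
qed

text \<open>The square of w/z is exp(-2 i pi (\<xi> - \<eta>)), so factors p^k become shifts of the
  argument by k \<tau>; the constants in \<open>unitarity_factor_alt\<close> cancel.\<close>

lemma Yfactor_unitarity_factor:
  assumes "N \<ge> 1" "Im \<zeta> > 0"
  shows "Yfactor N (p_of \<tau>) (q_of \<zeta>) (exp (\<i> * pi * \<eta>) / exp (\<i> * pi * \<xi>)) k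
    = unitarity_factor N \<zeta> (\<xi> - \<eta> - of_nat k * \<tau>) / unitarity_factor N \<zeta> (\<xi> - \<eta> + of_nat k * \<tau>)"
proof -
  define X where "X = exp (- 2 * \<i> * pi * (\<xi> - \<eta>))"
  define p where "p = p_of \<tau>"
  define T where "T = Theta (q_of \<zeta> ^ (2 * N))"
  have x2: "(exp (\<i> * pi * \<eta>) / exp (\<i> * pi * \<xi>))\<^sup>2 = X"
    unfolding X_def exp_diff[symmetric] power2_eq_square exp_add[symmetric]
    by (rule arg_cong[of _ _ exp]) (simp add: algebra_simps)
  have pk: "p ^ k = exp (2 * \<i> * pi * (of_nat k * \<tau>))"
    unfolding p_def p_of_def exp_of_nat_mult[symmetric] by (rule arg_cong[of _ _ exp]) simp
  have m: "exp (- 2 * \<i> * pi * (\<xi> - \<eta> - of_nat k * \<tau>)) = X * p ^ k"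
    unfolding X_def pk exp_add[symmetric] by (rule arg_cong[of _ _ exp]) (simp add: algebra_simps)
  have pl: "exp (- 2 * \<i> * pi * (\<xi> - \<eta> + of_nat k * \<tau>)) = X / p ^ k"
    unfolding X_def pk exp_diff[symmetric] by (rule arg_cong[of _ _ exp]) (simp add: algebra_simps)
  define c where "c = exp (\<i> * pi * \<zeta> * (2 / of_nat N - 2)) * (q_of \<zeta>)\<^sup>2"
  have c: "c \<noteq> 0" by (simp add: c_def)
  have "unitarity_factor N \<zeta> (\<xi> - \<eta> - of_nat k * \<tau>) = c * (T (X * (q_of \<zeta>)\<^sup>2 * p ^ k) * T (X / (q_of \<zeta>)\<^sup>2 * p ^ k) / (T (X * p ^ k))\<^sup>2)"
    unfolding unitarity_factor_alt[OF assms] m c_def T_def by (simp add: mult_ac)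
  moreover have "unitarity_factor N \<zeta> (\<xi> - \<eta> + of_nat k * \<tau>) = c * (T (X * (q_of \<zeta>)\<^sup>2 / p ^ k) * T (X / (q_of \<zeta>)\<^sup>2 / p ^ k) / (T (X / p ^ k))\<^sup>2)"
    unfolding unitarity_factor_alt[OF assms] pl c_def T_def by (simp add: mult_ac)
  moreover have "Yfactor N (p_of \<tau>) (q_of \<zeta>) (exp (\<i> * pi * \<eta>) / exp (\<i> * pi * \<xi>)) k
     = (T (X * (q_of \<zeta>)\<^sup>2 * p ^ k) * T (X / (q_of \<zeta>)\<^sup>2 * p ^ k) / (T (X * p ^ k))\<^sup>2)
       / (T (X * (q_of \<zeta>)\<^sup>2 / p ^ k) * T (X / (q_of \<zeta>)\<^sup>2 / p ^ k) / (T (X / p ^ k))\<^sup>2)"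
    unfolding Yfactor_def Let_def x2 p_def[symmetric] T_def[symmetric] by (simp add: mult_ac)
  ultimately show ?thesis using c by simp
qed

theorem theorem3:
  fixes \<iota> :: "complex \<Rightarrow> 'a::ring_1"
    and s :: "complex^('n::nontriv mod_ring)^('n mod_ring)"
    and L :: "complex \<Rightarrow> 'a^('n mod_ring)^('n mod_ring)"
    and \<zeta> \<tau> c :: complex and M :: int
  assumes "M \<noteq> 0"
    and "norm (q_of \<zeta>) < 1" and "norm (p_of \<tau>) < 1" and "norm (p_of (tau_star \<zeta> \<tau> c)) < 1"
    and "\<And>n::int. (q_of \<zeta>)\<^sup>2 \<noteq> p_of \<tau> powi n"
    and "\<And>n::int. (q_of \<zeta>)\<^sup>2 \<noteq> p_of (tau_star \<zeta> \<tau> c) powi n"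
    and "diagonal_sqrt_g s"
    and "elliptic_sl_algebra \<iota> s \<zeta> \<tau> c L"
    and "on_surface CARD('n) M \<zeta> \<tau> c"
  shows "\<forall>\<^sub>\<approx>u. \<forall>\<xi> \<eta>. \<xi> - \<eta> = u \<longrightarrow>
           invertible (Lminus \<iota> s \<tau> L \<xi>) \<longrightarrow> invertible (Lminus \<iota> s \<tau> L \<eta>) \<longrightarrow>
           tgen \<iota> s \<zeta> \<tau> c L \<xi> * tgen \<iota> s \<zeta> \<tau> c L \<eta>
           = \<iota> (Ystruct CARD('n) (p_of \<tau>) (q_of \<zeta>) M (exp (\<i> * pi * \<eta>) / exp (\<i> * pi * \<xi>)))
               * tgen \<iota> s \<zeta> \<tau> c L \<eta> * tgen \<iota> s \<zeta> \<tau> c L \<xi>"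
proof -
  define N where "N = CARD('n)"
  define \<tau>s where "\<tau>s = tau_star \<zeta> \<tau> c"
  have N1: "N \<ge> 1" and N0: "(of_nat N :: complex) \<noteq> 0"
    using nontriv[where ?'a = 'n] by (simp_all add: N_def)
  have imz: "Im \<zeta> > 0" and im: "Im \<tau> > 0" and ims: "Im \<tau>s > 0"
    using assms(2-4) by (simp_all add: norm_q_of norm_p_of \<tau>s_def)
  note s = \<open>diagonal_sqrt_g s\<close>
  have reg: "regular_at CARD('n) \<tau> (\<zeta> / of_nat CARD('n))"
    by (rule regular_at_criterion[OF im _ assms(5)]) (use N1 in \<open>simp add: N_def\<close>)
  have regs: "regular_at CARD('n) \<tau>s (\<zeta> / of_nat CARD('n))"
    by (rule regular_at_criterion[OF ims]) (use N1 assms(6) in \<open>simp_all add: N_def \<tau>s_def\<close>)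
  have alg: "complex_algebra \<iota>" and exr: "exchange_relation \<iota> s \<zeta> \<tau> c L"
    using assms(8) by (simp_all add: elliptic_sl_algebra_def)
  define R where "R u = Rhat s u \<zeta> \<tau>" for u
  define Rs where "Rs u = Rhat s u \<zeta> \<tau>s" for u
  define U where "U = unitarity_factor N \<zeta>"
  define gen where "gen = generic_at N \<zeta> \<tau>"
  define gens where "gens = generic_at N \<zeta> \<tau>s"
  define Ex where "Ex u \<longleftrightarrow> (\<forall>\<xi> \<eta>. \<xi> - \<eta> = u \<longrightarrow>
        map_matrix \<iota> (R u) ** tensor_mat (L \<xi>) (mat 1) ** tensor_mat (mat 1) (L \<eta>)
        = tensor_mat (mat 1) (L \<eta>) ** tensor_mat (L \<xi>) (mat 1) ** map_matrix \<iota> (Rs u))" for u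
  have Ex: "\<forall>\<^sub>\<approx>u. Ex u"
    using exr unfolding exchange_relation_def Ex_def R_def Rs_def \<tau>s_def .
  have cgen: "\<forall>\<^sub>\<approx>u. gen u" unfolding gen_def by (rule cosparse_generic_at[OF N1 imz im])
  have cgens: "\<forall>\<^sub>\<approx>u. gens u" unfolding gens_def by (rule cosparse_generic_at[OF N1 imz ims])
  obtain k where k: "k \<noteq> 0" "\<forall>v. gen v \<longrightarrow> gen (v + of_nat N * \<zeta>) \<longrightarrow>
     pt2 (flip_mat (R (- v - of_nat N * \<zeta>))) ** pt2 (R v) = mat (k * U v)"
    using Rhat_crossing[OF s imz im reg] unfolding gen_def N_def U_def R_def by (elim exE conjE)
  define n where "n = N * nat \<bar>M\<bar>"
  have n0: "n > 0" using N1 assms(1) by (simp add: n_def)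
  have dvd: "CARD('n) dvd n" by (simp add: n_def N_def)
  \<comment> \<open>The part in c comes from the argument of L in A, the part in N from
    crossing.\<close>
  define \<delta> where "\<delta> = - c * \<zeta> - of_nat N * \<zeta>"
  \<comment> \<open>The second surface equation fixes M (\<tau> + 1) up to an integer n'.
    Multiplication by N makes the ambiguity N n', a period of the R-matrix.\<close>
  obtain n' :: int where n': "of_int (int N * M) * (\<tau> + 1) = \<delta> + of_int (int N * n')"
  proof -
    have "exp (2 * \<i> * pi * of_int M * (\<tau> + 1)) = exp (2 * \<i> * pi * \<zeta> * (- c - of_nat N) / of_nat N)"
      using assms(9) by (simp add: on_surface_def N_def)
    then obtain n' :: int where "2 * \<i> * pi * of_int M * (\<tau> + 1) = 2 * \<i> * pi * \<zeta> * (- c - of_nat N) / of_nat N + of_int (2 * n') * pi * \<i>"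
      unfolding exp_eq by blast
    then have "(2 * \<i> * pi) * (of_int M * (\<tau> + 1)) = (2 * \<i> * pi) * (\<zeta> * (- c - of_nat N) / of_nat N + of_int n')"
      by (simp add: algebra_simps)
    then have "of_int M * (\<tau> + 1) = \<zeta> * (- c - of_nat N) / of_nat N + of_int n'"
      by (simp del: mult_cancel_left add: mult_left_cancel)
    then have "of_nat N * (of_int M * (\<tau> + 1)) = of_nat N * (\<zeta> * (- c - of_nat N) / of_nat N + of_int n')" by simp
    also have "\<dots> = \<delta> + of_nat N * of_int n'" using N0 by (simp add: \<delta>_def field_simps)
    finally show ?thesis using that[of n'] by (simp add: mult.assoc)
  qed
  \<comment> \<open>For M > 0 quasi-periodicity is iterated upwards from w. For M < 0 it is iterated
    from w - n (\<tau> + 1) up to w and then inverted, so U appears in the numerator and the base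
    points are shifted.\<close>
  define mm where "mm w = (if M > 0 then \<Prod>j<n. 1 / U (w + of_nat j * (\<tau> + 1))
      else \<Prod>j<n. U (w - of_nat n * (\<tau> + 1) + of_nat j * (\<tau> + 1)))" for w
  have shift: "R (w + \<delta>) = map_matrix ((*) (mm w)) (R w)"
    if g: "\<forall>j\<le>n. gen (w + of_nat j * (\<tau> + 1)) \<and> gen (w - of_nat j * (\<tau> + 1))" for w
  proof -
    have p: "R (v + of_int (int N * k)) = R v" for v k
      using Rhat_period[OF s imz im] by (simp only: R_def N_def)
    show ?thesis
    proof (cases "M > 0")
      case True
      then have "of_int (int N * M) = (of_nat n :: complex)" by (simp add: n_def)
      then have "w + \<delta> = w + of_nat n * (\<tau> + 1) + of_int (int N * - n')" using n' by (simp add: algebra_simps)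
      then have "R (w + \<delta>) = R (w + of_nat n * (\<tau> + 1))" using p by (simp only:)
      also have "\<dots> = map_matrix ((*) (\<Prod>j<n. 1 / U (w + of_nat j * (\<tau> + 1)))) (R w)"
        unfolding R_def U_def N_def by (rule Rhat_quasiperiod_multiple[OF s imz im reg dvd]) (use g in \<open>simp add: gen_def N_def\<close>)
      finally show ?thesis using True by (simp add: mm_def)
    next
      case False
      define v where "v = w - of_nat n * (\<tau> + 1)"
      have vj: "v + of_nat j * (\<tau> + 1) = w - of_nat (n - j) * (\<tau> + 1)" if "j \<le> n" for j
        using that by (simp add: v_def of_nat_diff algebra_simps)
      have gv: "gen (v + of_nat j * (\<tau> + 1))" if "j \<le> n" for j
        unfolding vj[OF that] using g by simp
      have "of_int (int N * M) = - (of_nat n :: complex)" using False assms(1) by (simp add: n_def)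
      then have "\<delta> = - (of_nat n * (\<tau> + 1)) - of_int (int N * n')"
        using n' by (simp only: eq_diff_eq) (simp only: mult_minus_left)
      then have "w + \<delta> = v + of_int (int N * - n')" by (simp add: v_def)
      then have 1: "R (w + \<delta>) = R v" using p by (simp only:)
      have "R (v + of_nat n * (\<tau> + 1)) = map_matrix ((*) (\<Prod>j<n. 1 / U (v + of_nat j * (\<tau> + 1)))) (R v)"
        unfolding R_def U_def N_def by (rule Rhat_quasiperiod_multiple[OF s imz im reg dvd]) (use gv in \<open>simp add: gen_def N_def\<close>)
      moreover have "v + of_nat n * (\<tau> + 1) = w" by (simp add: v_def)
      ultimately have 2: "R w = map_matrix ((*) (\<Prod>j<n. 1 / U (v + of_nat j * (\<tau> + 1)))) (R v)" by simp
      have "(\<Prod>j<n. U (v + of_nat j * (\<tau> + 1))) * (\<Prod>j<n. 1 / U (v + of_nat j * (\<tau> + 1))) = 1"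
        unfolding prod.distrib[symmetric]
        by (intro prod.neutral ballI) (use unitarity_factor_nonzero[OF N1 imz gv[unfolded gen_def]] in \<open>simp add: U_def\<close>)
      then have "map_matrix ((*) (\<Prod>j<n. U (v + of_nat j * (\<tau> + 1)))) (R w) = R v"
        unfolding 2 by (simp add: vec_eq_iff mult.assoc[symmetric])
      then show ?thesis using False 1 by (simp add: mm_def v_def)
    qed
  qed
  define G where "G = s ** hmat ** s"
  define H where "H = matrix_inv G"
  have GH: "G ** H = mat 1" "H ** G = mat 1"
    using G_inverse[OF s] by (simp_all add: G_def H_def)
  have RG: "tensor_mat G (mat 1) ** tensor_mat (mat 1) G ** R u = R u ** (tensor_mat G (mat 1) ** tensor_mat (mat 1) G)" for u
    unfolding G_def R_def by (rule Rhat_commute[OF s im])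
  have RsG: "tensor_mat G (mat 1) ** tensor_mat (mat 1) G ** Rs u = Rs u ** (tensor_mat G (mat 1) ** tensor_mat (mat 1) G)" for u
    unfolding G_def Rs_def by (rule Rhat_commute[OF s ims])
  \<comment> \<open>Half of the shift c \<zeta> is the definition of \<open>Lplus\<close>, the other
    half its argument in the generating function t.\<close>
  define A where "A \<xi> = L (\<xi> + c * \<zeta>)" for \<xi>
  define Lm where "Lm \<xi> = map_matrix \<iota> G ** L (\<xi> + (\<tau> + 1)) ** map_matrix \<iota> H" for \<xi>
  have Lm: "Lminus \<iota> s \<tau> L \<xi> = Lm \<xi>" for \<xi> by (simp add: Lminus_def Let_def Lm_def G_def H_def)
  define B where "B \<xi> = matrix_inv (Lm \<xi>)" for \<xi>
  have tg: "tgen \<iota> s \<zeta> \<tau> c L \<xi> = trace (A \<xi> ** B \<xi>)" for \<xi>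
    by (simp add: tgen_def Lplus_def Lm A_def B_def add.assoc distrib_right[symmetric] mult.commute[of c])
  have mixed: "tensor_mat (B \<xi>) (mat 1) ** map_matrix \<iota> (flip_mat (R (- (\<xi> - \<eta>) + c * \<zeta>))) ** tensor_mat (mat 1) (A \<eta>)
      = tensor_mat (mat 1) (A \<eta>) ** map_matrix \<iota> (flip_mat (Rs (- (\<xi> - \<eta>)))) ** tensor_mat (B \<xi>) (mat 1)"
    if ex: "Ex (\<xi> - \<eta> + (\<tau> + 1) - c * \<zeta>)"
      and g: "gen (\<xi> - \<eta> - c * \<zeta>)" "gen (\<xi> - \<eta> - c * \<zeta> + (\<tau> + 1))"
      and gs: "gens (\<xi> - \<eta>)" "gens (\<xi> - \<eta> + (\<tau>s + 1))"
      and inv: "invertible (Lm \<xi>)" for \<xi> \<eta>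
  proof (rule mixed_exchange[OF alg _ GH])
    define u where "u = \<xi> - \<eta>"
    have v1: "\<xi> - \<eta> + (\<tau> + 1) - c * \<zeta> = u - c * \<zeta> + (\<tau> + 1)" by (simp add: u_def)
    \<comment> \<open>In this relation the same argument is a shift by \<tau> + 1 of u - c \<zeta>
      for R and a shift by \<tau>* + 1 of u for R*, because \<tau>* = \<tau> - c \<zeta>. Hence the
      two sides acquire different spectral arguments.\<close>
    have v2: "u - c * \<zeta> + (\<tau> + 1) = u + (\<tau>s + 1)" by (simp add: \<tau>s_def tau_star_def)
    show "map_matrix \<iota> (R (u - c * \<zeta> + (\<tau> + 1))) ** tensor_mat (L (\<xi> + (\<tau> + 1))) (mat 1) ** tensor_mat (mat 1) (A \<eta>)
      = tensor_mat (mat 1) (A \<eta>) ** tensor_mat (L (\<xi> + (\<tau> + 1))) (mat 1) ** map_matrix \<iota> (Rs (u - c * \<zeta> + (\<tau> + 1)))"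
      using ex[unfolded v1 Ex_def, rule_format, of "\<xi> + (\<tau> + 1)" "\<eta> + c * \<zeta>"] unfolding A_def by (simp add: u_def)
    show "B \<xi> ** (map_matrix \<iota> G ** L (\<xi> + (\<tau> + 1)) ** map_matrix \<iota> H) = mat 1"
      "(map_matrix \<iota> G ** L (\<xi> + (\<tau> + 1)) ** map_matrix \<iota> H) ** B \<xi> = mat 1"
      using invertible_matrix_inv[OF inv] by (simp_all add: B_def Lm_def)
    show "tensor_mat G (mat 1) ** R (u - c * \<zeta> + (\<tau> + 1)) = map_matrix ((*) (1 / U (u - c * \<zeta>))) (R (u - c * \<zeta>)) ** tensor_mat G (mat 1)"
      unfolding G_def R_def U_def N_def by (rule Rhat_quasiperiod[OF s imz im reg]) (use g in \<open>simp_all add: gen_def N_def u_def\<close>)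
    show "tensor_mat G (mat 1) ** Rs (u - c * \<zeta> + (\<tau> + 1)) = map_matrix ((*) (1 / U u)) (Rs u) ** tensor_mat G (mat 1)"
      unfolding v2 G_def Rs_def U_def N_def by (rule Rhat_quasiperiod[OF s imz ims regs]) (use gs in \<open>simp_all add: gens_def N_def u_def\<close>)
    have w: "- (\<xi> - \<eta>) + c * \<zeta> = - (u - c * \<zeta>)" by (simp add: u_def)
    show "flip_mat (R (- (\<xi> - \<eta>) + c * \<zeta>)) ** R (u - c * \<zeta>) = mat (U (u - c * \<zeta>))"
      unfolding w R_def U_def N_def by (rule Rhat_unitarity'[OF s imz im reg]) (use g in \<open>simp add: gen_def N_def u_def\<close>)
    show "Rs u ** flip_mat (Rs (- (\<xi> - \<eta>))) = mat (U u)"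
      unfolding u_def[symmetric] Rs_def U_def N_def by (rule Rhat_unitarity[OF s imz ims regs]) (use gs in \<open>simp add: gens_def N_def u_def\<close>)
    show "U (u - c * \<zeta>) \<noteq> 0" "U u \<noteq> 0"
      unfolding U_def by (rule unitarity_factor_nonzero[OF N1 imz], use g gs in \<open>simp add: gen_def gens_def u_def\<close>)+
  qed
  \<comment> \<open>Crossing was stated for second partial transposes; a flip turns them into first
    ones. The two order-dependent uses below take v = -u + c \<zeta> and v = u + c \<zeta>.\<close>
  have left_inverse: "map_matrix ((*) (1 / (k * U v))) (pt1 (R (- v - of_nat N * \<zeta>))) ** pt1 (flip_mat (R v)) = mat 1"
    if g: "gen v" "gen (v + of_nat N * \<zeta>)" for v
  proof -
    have Uv: "U v \<noteq> 0" unfolding U_def by (rule unitarity_factor_nonzero[OF N1 imz]) (use g in \<open>simp add: gen_def\<close>)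
    have "pt1 (R (- v - of_nat N * \<zeta>)) ** pt1 (flip_mat (R v))
        = flip_mat (pt2 (flip_mat (R (- v - of_nat N * \<zeta>))) ** pt2 (R v))"
      by (simp only: flip_mult pt1_flip(1)) (simp add: pt1_flip(1)[symmetric])
    also have "\<dots> = mat (k * U v)" using k(2) g by (simp add: flip_mat_1)
    finally have 1: "pt1 (R (- v - of_nat N * \<zeta>)) ** pt1 (flip_mat (R v)) = mat (k * U v)" .
    have "(map_matrix ((*) (1 / (k * U v))) X ** Y) $ i $ j = 1 / (k * U v) * (X ** Y) $ i $ j"
      for X Y :: "complex^('n zn2)^('n zn2)" and i j
      by (simp add: mat_mult_nth sum_divide_distrib)
    then show ?thesis using Uv k(1) by (simp add: vec_eq_iff 1) (simp add: mat_def)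
  qed
  \<comment> \<open>All spectral parameters met for the pair and for the pair in reversed order.
    Each condition is a translate or a reflection of a cosparse one and there are finitely many, so
    the conjunction is cosparse.\<close>
  define good where "good u \<longleftrightarrow> Ex u \<and> Ex (u + (\<tau> + 1 - c * \<zeta>)) \<and> Ex (\<tau> + 1 - c * \<zeta> - u)
    \<and> gen u \<and> gen (u + (- c * \<zeta>)) \<and> gen (u + (\<tau> + 1 - c * \<zeta>)) \<and> gen (- c * \<zeta> - u) \<and> gen (\<tau> + 1 - c * \<zeta> - u)
    \<and> gens u \<and> gens (u + (\<tau>s + 1)) \<and> gens (0 - u) \<and> gens (\<tau>s + 1 - u)
    \<and> gen (c * \<zeta> - u) \<and> gen (c * \<zeta> + of_nat N * \<zeta> - u) \<and> gen (u + c * \<zeta>) \<and> gen (u + (c * \<zeta> + of_nat N * \<zeta>))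
    \<and> (\<forall>j\<in>{..n}. gen (u + of_nat j * (\<tau> + 1)) \<and> gen (u + - (of_nat j * (\<tau> + 1)))
        \<and> gen (of_nat j * (\<tau> + 1) - u) \<and> gen (- (of_nat j * (\<tau> + 1)) - u))" for u
  have "\<forall>\<^sub>\<approx>u. good u"
    unfolding good_def
    by (intro eventually_conj eventually_ball_finite ballI finite_atMost Ex cgen cgens
        cosparse_shift[OF Ex] cosparse_reflect[OF Ex] cosparse_shift[OF cgen] cosparse_reflect[OF cgen]
        cosparse_shift[OF cgens] cosparse_reflect[OF cgens])
  then show ?thesis
  proof (rule eventually_mono, intro allI impI)
    fix u \<xi> \<eta>
    assume good: "good u" and u: "\<xi> - \<eta> = u"
      and inv: "invertible (Lminus \<iota> s \<tau> L \<xi>)" "invertible (Lminus \<iota> s \<tau> L \<eta>)"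
    have mu: "\<eta> - \<xi> = - u" by (simp flip: u)
    \<comment> \<open>The scalars by which crossing and the surface relation replace the inverted
      matrices by R(u) and R(-u). The structure function is their quotient.\<close>
    define a where "a = mm u / (k * U (- u + c * \<zeta>))"
    define a' where "a' = mm (- u) / (k * U (u + c * \<zeta>))"
    have Unz: "U w \<noteq> 0" if "gen w" for w
      unfolding U_def by (rule unitarity_factor_nonzero[OF N1 imz]) (use that in \<open>simp add: gen_def\<close>)
    have gj: "gen (u + of_nat j * (\<tau> + 1))" "gen (u - of_nat j * (\<tau> + 1))"
      "gen (- u + of_nat j * (\<tau> + 1))" "gen (- u - of_nat j * (\<tau> + 1))" if "j \<le> n" for j
    proof -
      have "\<forall>j\<in>{..n}. gen (u + of_nat j * (\<tau> + 1)) \<and> gen (u + - (of_nat j * (\<tau> + 1)))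
          \<and> gen (of_nat j * (\<tau> + 1) - u) \<and> gen (- (of_nat j * (\<tau> + 1)) - u)"
        using good unfolding good_def by (elim conjE)
      then have "gen (u + of_nat j * (\<tau> + 1))" "gen (u + - (of_nat j * (\<tau> + 1)))"
          "gen (of_nat j * (\<tau> + 1) - u)" "gen (- (of_nat j * (\<tau> + 1)) - u)"
        using that by blast+
      then show "gen (u + of_nat j * (\<tau> + 1))" "gen (u - of_nat j * (\<tau> + 1))"
          "gen (- u + of_nat j * (\<tau> + 1))" "gen (- u - of_nat j * (\<tau> + 1))"
        by (simp_all only: diff_conv_add_uminus add.commute[of "- u"])
    qed
    have shifts: "R (u + \<delta>) = map_matrix ((*) (mm u)) (R u)" "R (- u + \<delta>) = map_matrix ((*) (mm (- u))) (R (- u))"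
      using gj by (intro shift; blast)+
    have g1: "gen (- u + c * \<zeta>)" "gen (- u + c * \<zeta> + of_nat N * \<zeta>)" "gen (u + c * \<zeta>)" "gen (u + c * \<zeta> + of_nat N * \<zeta>)"
      using good by (simp_all add: good_def algebra_simps)
    have g2: "gen (- u - c * \<zeta>)"
    proof -
      have "gen (- c * \<zeta> - u)" using good unfolding good_def by (elim conjE)
      then show ?thesis by (simp only: diff_conv_add_uminus add.commute[of "- u"] mult_minus_left)
    qed
    have mm0: "mm (- u) \<noteq> 0"
    proof -
      have "U (- u - of_nat n * (\<tau> + 1) + of_nat j * (\<tau> + 1)) \<noteq> 0" if "j < n" for j
      proof -
        have "- u - of_nat n * (\<tau> + 1) + of_nat j * (\<tau> + 1) = - u - of_nat (n - j) * (\<tau> + 1)"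
          using that by (simp add: of_nat_diff algebra_simps)
        then show ?thesis by (simp only:) (rule Unz, rule gj(4), simp)
      qed
      then show ?thesis using Unz gj(3) by (auto simp: mm_def)
    qed
    have a'0: "a' \<noteq> 0" using mm0 k(1) Unz[OF g1(3)] by (simp add: a'_def)
    have "trace (A \<xi> ** B \<xi>) * trace (A \<eta> ** B \<eta>) = \<iota> (a / a') * trace (A \<eta> ** B \<eta>) * trace (A \<xi> ** B \<xi>)"
    proof (rule quadratic_exchange[OF alg])
      show "map_matrix \<iota> (R u) ** tensor_mat (A \<xi>) (mat 1) ** tensor_mat (mat 1) (A \<eta>)
        = tensor_mat (mat 1) (A \<eta>) ** tensor_mat (A \<xi>) (mat 1) ** map_matrix \<iota> (Rs u)"
        using good u unfolding good_def Ex_def A_def by simp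
      show "map_matrix \<iota> (Rs u) ** tensor_mat (mat 1) (B \<eta>) ** tensor_mat (B \<xi>) (mat 1)
        = tensor_mat (B \<xi>) (mat 1) ** tensor_mat (mat 1) (B \<eta>) ** map_matrix \<iota> (R u)"
      proof (rule inverse_exchange[OF alg _ GH _ _ _ _ RG RsG])
        show "map_matrix \<iota> (R u) ** tensor_mat (L (\<xi> + (\<tau> + 1))) (mat 1) ** tensor_mat (mat 1) (L (\<eta> + (\<tau> + 1)))
          = tensor_mat (mat 1) (L (\<eta> + (\<tau> + 1))) ** tensor_mat (L (\<xi> + (\<tau> + 1))) (mat 1) ** map_matrix \<iota> (Rs u)"
          using good u unfolding good_def Ex_def by simp
      qed (use inv in \<open>simp_all add: B_def Lm Lm_def[symmetric] invertible_matrix_inv\<close>)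
      show "tensor_mat (B \<xi>) (mat 1) ** map_matrix \<iota> (flip_mat (R (- u + c * \<zeta>))) ** tensor_mat (mat 1) (A \<eta>)
        = tensor_mat (mat 1) (A \<eta>) ** map_matrix \<iota> (flip_mat (Rs (- u))) ** tensor_mat (B \<xi>) (mat 1)"
        unfolding u[symmetric]
        by (rule mixed) (use good u inv in \<open>simp_all add: good_def Lm algebra_simps\<close>)
      show "tensor_mat (B \<eta>) (mat 1) ** map_matrix \<iota> (flip_mat (R (u + c * \<zeta>))) ** tensor_mat (mat 1) (A \<xi>)
        = tensor_mat (mat 1) (A \<xi>) ** map_matrix \<iota> (flip_mat (Rs u)) ** tensor_mat (B \<eta>) (mat 1)"
      proof -
        have "u = - (\<eta> - \<xi>)" by (simp flip: u)
        then show ?thesis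
          by (simp only:) (rule mixed; (simp only: mu)?, use good g2 inv in \<open>simp add: good_def Lm algebra_simps\<close>)
      qed
      show "map_matrix ((*) (1 / (k * U (- u + c * \<zeta>)))) (pt1 (R (- (- u + c * \<zeta>) - of_nat N * \<zeta>))) ** pt1 (flip_mat (R (- u + c * \<zeta>))) = mat 1"
        by (rule left_inverse[OF g1(1,2)])
      show "map_matrix ((*) (1 / (k * U (u + c * \<zeta>)))) (pt1 (R (- (u + c * \<zeta>) - of_nat N * \<zeta>))) ** pt1 (flip_mat (R (u + c * \<zeta>))) = mat 1"
        by (rule left_inverse[OF g1(3,4)])
      have d1: "- (- u + c * \<zeta>) - of_nat N * \<zeta> = u + \<delta>" and d2: "- (u + c * \<zeta>) - of_nat N * \<zeta> = - u + \<delta>"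
        by (simp_all add: \<delta>_def)
      have pm: "pt1 (map_matrix f (pt1 X)) = map_matrix f X" for f :: "complex \<Rightarrow> complex" and X :: "complex^('n zn2)^('n zn2)"
        by (simp add: pt1_def vec_eq_iff)
      show "pt1 (map_matrix ((*) (1 / (k * U (- u + c * \<zeta>)))) (pt1 (R (- (- u + c * \<zeta>) - of_nat N * \<zeta>)))) = map_matrix ((*) a) (R u)"
        unfolding pm d1 shifts by (simp add: vec_eq_iff a_def)
      show "pt1 (map_matrix ((*) (1 / (k * U (u + c * \<zeta>)))) (pt1 (R (- (u + c * \<zeta>) - of_nat N * \<zeta>)))) = map_matrix ((*) a') (R (- u))"
        unfolding pm d2 shifts by (simp add: vec_eq_iff a'_def)
      show "Rs u ** flip_mat (Rs (- u)) = mat (U u)"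
        unfolding Rs_def U_def N_def by (rule Rhat_unitarity[OF s imz ims regs]) (use good in \<open>simp add: good_def gens_def N_def\<close>)
      show "R u ** flip_mat (R (- u)) = mat (U u)"
        unfolding R_def U_def N_def by (rule Rhat_unitarity[OF s imz im reg]) (use good in \<open>simp add: good_def gen_def N_def\<close>)
    qed (rule a'0)
    moreover have "a / a' = Ystruct CARD('n) (p_of \<tau>) (q_of \<zeta>) M (exp (\<i> * pi * \<eta>) / exp (\<i> * pi * \<xi>))"
    proof -
      \<comment> \<open>The value of \<open>Yfactor\<close> at index j, written with U; the integer
        part of each shift j (\<tau> + 1) is invisible to U.\<close>
      define f where "f j = U (u - of_nat j * \<tau>) / U (u + of_nat j * \<tau>)" for j
      have Uint: "U (w + of_int j) = U w" for w j
        unfolding U_def by (rule unitarity_factor_plus_int[OF N1 imz])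
      have Ueven: "U (- w) = U w" for w
        unfolding U_def by (rule unitarity_factor_minus[OF N1 imz])
      have Uz: "U (w + of_nat N * \<zeta>) = U w" for w
        unfolding U_def by (rule unitarity_factor_quasiperiod[OF N1 imz])
      have Uj: "U (w + of_nat j * (\<tau> + 1)) = U (w + of_nat j * \<tau>)" for w j
        using Uint[of "w + of_nat j * \<tau>" "int j"] by (simp add: algebra_simps)
      have Ujm: "U (w - of_nat j * (\<tau> + 1)) = U (w - of_nat j * \<tau>)" for w j
        using Uint[of "w - of_nat j * \<tau>" "- int j"] by (simp add: algebra_simps)
      \<comment> \<open>On the surface (c + N) \<zeta> is -N M \<tau> up to an integer, and U has
        the periods N \<zeta> and 1.\<close>
      have Uc: "U (w + c * \<zeta>) = U (w - of_int (int N * M) * \<tau>)" for w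
      proof -
        have "w + c * \<zeta> + of_nat N * \<zeta> = w - of_int (int N * M) * \<tau> + of_int (int N * n' - int N * M)"
          using n' by (simp add: \<delta>_def algebra_simps)
        then show ?thesis using Uz[of "w + c * \<zeta>"] Uint by metis
      qed
      have f0: "f 0 = 1" using Unz good by (simp add: f_def good_def)
      have Yf: "Yfactor CARD('n) (p_of \<tau>) (q_of \<zeta>) (exp (\<i> * pi * \<eta>) / exp (\<i> * pi * \<xi>)) j = f j" for j
        using Yfactor_unitarity_factor[OF N1 imz, of \<tau> \<eta> \<xi> j] unfolding u by (simp add: f_def U_def N_def)
      have aa: "a / a' = mm u * U (u + c * \<zeta>) / (mm (- u) * U (- u + c * \<zeta>))"
        using k(1) by (simp add: a_def a'_def)
      have Um: "U (- u + of_nat j * \<tau>) = U (u - of_nat j * \<tau>)" "U (- u - of_nat j * \<tau>) = U (u + of_nat j * \<tau>)" for j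
        using Ueven[of "u - of_nat j * \<tau>"] Ueven[of "u + of_nat j * \<tau>"] by (simp_all add: algebra_simps)
      show ?thesis
      proof (cases "M > 0")
        case True
        have NM: "of_int (int N * M) = (of_nat n :: complex)" using True by (simp add: n_def)
        have mmp: "mm w = (\<Prod>j<n. 1 / U (w + of_nat j * \<tau>))" for w
          using True by (simp only: mm_def Uj if_True)
        \<comment> \<open>The product runs over 0, ..., n - 1, the U-values from crossing add index
          n, and the trivial index 0 is then dropped.\<close>
        have "a / a' = (\<Prod>j<n. f j) * f n"
          unfolding aa Uc NM mmp Um f_def by (simp add: prod_dividef)
        also have "\<dots> = (\<Prod>j\<le>n. f j)" by (simp add: lessThan_Suc_atMost[symmetric])
        also have "\<dots> = (\<Prod>j = 1..n. f j)"
          by (simp add: atMost_atLeast0 prod.atLeast_Suc_atMost f0)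
        finally show ?thesis using True by (simp add: Ystruct_def Yf n_def N_def)
      next
        case False
        have NM: "of_int (int N * M) = - (of_nat n :: complex)" using False assms(1) by (simp add: n_def)
        have mmn: "mm w = (\<Prod>j = 1..n. U (w - of_nat j * \<tau>))" for w
        proof -
          have "mm w = (\<Prod>j<n. U (w - of_nat (n - j) * \<tau>))"
          proof -
            have "w - of_nat n * (\<tau> + 1) + of_nat j * (\<tau> + 1) = w - of_nat (n - j) * (\<tau> + 1)" if "j < n" for j
              using that by (simp add: of_nat_diff algebra_simps)
            then have "U (w - of_nat n * (\<tau> + 1) + of_nat j * (\<tau> + 1)) = U (w - of_nat (n - j) * \<tau>)" if "j < n" for j
              using that by (simp only: Ujm)
            then show ?thesis
              unfolding mm_def using False by (auto intro!: prod.cong simp del: of_nat_diff)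
          qed
          also have "\<dots> = (\<Prod>j = 1..n. U (w - of_nat j * \<tau>))"
            by (rule prod.reindex_bij_witness[of _ "\<lambda>j. n - j" "\<lambda>j. n - j"]) auto
          finally show ?thesis .
        qed
        have fn: "f n \<noteq> 0"
          using Unz gj(1,2)[of n] by (simp add: f_def Uj[symmetric] Ujm[symmetric])
        \<comment> \<open>Iterating downwards gives the indices 1, ..., n, and the U-values from
          crossing now remove index n; this is the origin of the upper limit N |M| - 1.\<close>
        have "a / a' = (\<Prod>j = 1..n. f j) * (1 / f n)"
          unfolding aa Uc NM mmn f_def by (simp only: mult_minus_left diff_minus_eq_add Um) (simp add: prod_dividef)
        also have "(\<Prod>j = 1..n. f j) = (\<Prod>j = 1..n - 1. f j) * f n"
          using n0 prod.nat_ivl_Suc'[of 1 "n - 1" f] by (simp add: mult.commute)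
        finally show ?thesis using False fn by (simp add: Ystruct_def Yf n_def N_def)
      qed
    qed
    ultimately show "tgen \<iota> s \<zeta> \<tau> c L \<xi> * tgen \<iota> s \<zeta> \<tau> c L \<eta>
           = \<iota> (Ystruct CARD('n) (p_of \<tau>) (q_of \<zeta>) M (exp (\<i> * pi * \<eta>) / exp (\<i> * pi * \<xi>)))
               * tgen \<iota> s \<zeta> \<tau> c L \<eta> * tgen \<iota> s \<zeta> \<tau> c L \<xi>"
      unfolding tg by simp
  qed
qed

end
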